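(* Let $F$ be a finitely generated free group, $q\ge2$, $r\in\gamma_q(F)\setminus\gamma_{q+1}(F)$, $G=F/\langle\!\langle r\rangle\!\rangle$ with quotient map $\pi\colon F\to G$, and assume the simplicial volume of $G$ is nonzero. Let $r^\flat\in\gamma_q(F)$ with $r^\flat\gamma_{q+1}(F)=r\gamma_{q+1}(F)$, and write $r^\flat=[f_1,f_1']\cdots[f_s,f_s']$ with $s\in\mathbb{N}$, $f_i\in F$, $f_i'\in\gamma_{q-1}(F)$. Put $g_i=\pi(f_i)$, $g_i'=\pi(f_i')$ and define $\Psi^\flat\colon\mathbb{Z}\to\gamma_{q+1}(G)$ by $\Psi^\flat(m)=[g_1,(g_1')^m]\cdots[g_s,(g_s')^m]$. Then $A^\flat=\Psi^\flat(\mathbb{Z})$ represents the coarse kernel of $\iota_{G,\gamma_q(G)}\colon(\gamma_{q+1}(G),d_{\mathrm{scl}_{G,\gamma_q(G)}})\to(\gamma_{q+1}(G),d_{\mathrm{scl}_G})$, and $\Psi^\flat$, viewed as a map $(\mathbb{Z},|\cdot|)\to(A^\flat,d_{\mathrm{scl}_{G,\gamma_q(G)}})$, is a coarse isomorphism which is also a quasi-isometry.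
   Context: $[x,y]=xyx^{-1}y^{-1}$; $\gamma_1(H)=H$, $\gamma_{k+1}(H)=[H,\gamma_k(H)]$; $\langle\!\langle r\rangle\!\rangle$ is the normal closure. Simplicial volume of $G$: the $\ell^1$-seminorm of the image in $\mathrm{H}_2(G;\mathbb{R})$ of a generator of $\mathrm{H}_2(G;\mathbb{Z})\cong\mathbb{Z}$. For $N\trianglelefteq G$: $[G,N]$ is generated by $[g,x]$, $\mathrm{cl}_{G,N}$ is word length w.r.t. these, $\mathrm{scl}_{G,N}(y)=\lim_n\mathrm{cl}_{G,N}(y^n)/n$, $\mathrm{scl}_G=\mathrm{scl}_{G,G}$, $d_{\mathrm{scl}_{G,N}}(y_1,y_2)=\mathrm{scl}_{G,N}(y_1^{-1}y_2)$; note $[G,\gamma_q(G)]=\gamma_{q+1}(G)$. $\iota_{G,\gamma_q(G)}$ is the identity map. A subset $A$ represents its coarse kernel if $A$ has finite $d_{\mathrm{scl}_G}$-diameter and every subset of $\gamma_{q+1}(G)$ of finite $d_{\mathrm{scl}_G}$-diameter lies within bounded $d_{\mathrm{scl}_{G,\gamma_q(G)}}$-distance of $A$. A coarse isomorphism $\Psi\colon\mathbb{Z}\to A$ means: $\Psi$ is a controlled pre-coarse homomorphism ($\sup d(\Psi(m+n),\Psi(m)\Psi(n))<\infty$) and there is a map $\Phi\colon A\to\mathbb{Z}$, the restriction of a pre-coarse homomorphism $\gamma_{q+1}(G)\to\mathbb{Z}$, controlled on $A$, with $\Phi\circ\Psi$, $\Psi\circ\Phi$ at bounded distance from the identities. Quasi-isometry: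 a coarse equivalence with $C_1d-D_1\le d'\le C_2d+D_2$ bounds. *)

theory Defs
  imports Complex_Main "HOL-Algebra.Algebra"
begin

definition commutator :: "('g, 'm) monoid_scheme \<Rightarrow> 'g \<Rightarrow> 'g \<Rightarrow> 'g" where
  "commutator G x y = x \<otimes>\<^bsub>G\<^esub> y \<otimes>\<^bsub>G\<^esub> inv\<^bsub>G\<^esub> x \<otimes>\<^bsub>G\<^esub> inv\<^bsub>G\<^esub> y"

definition mprod :: "('g, 'm) monoid_scheme \<Rightarrow> 'g list \<Rightarrow> 'g" where
  "mprod G xs = foldr (\<lambda>x y. x \<otimes>\<^bsub>G\<^esub> y) xs \<one>\<^bsub>G\<^esub>"

text \<open>Lower central series: gamma_1(G) = G, gamma_(k+1)(G) = [G, gamma_k(G)].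
  (The index 0 is not used; it is set to G as well.)\<close>
fun lcs :: "('g, 'm) monoid_scheme \<Rightarrow> nat \<Rightarrow> 'g set" where
  "lcs G 0 = carrier G"
| "lcs G (Suc 0) = carrier G"
| "lcs G (Suc (Suc k)) =
     generate G {commutator G h x | h x. h \<in> carrier G \<and> x \<in> lcs G (Suc k)}"

definition normal_closure :: "('g, 'm) monoid_scheme \<Rightarrow> 'g set \<Rightarrow> 'g set" where
  "normal_closure G S =
     generate G {g \<otimes>\<^bsub>G\<^esub> s \<otimes>\<^bsub>G\<^esub> inv\<^bsub>G\<^esub> g | g s. g \<in> carrier G \<and> s \<in> S}"

definition letter_val :: "('g, 'm) monoid_scheme \<Rightarrow> 'g \<times> bool \<Rightarrow> 'g" where
  "letter_val G l = (if snd l then fst l else inv\<^bsub>G\<^esub> (fst l))"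

definition freely_reduced :: "('g \<times> bool) list \<Rightarrow> bool" where
  "freely_reduced w \<longleftrightarrow>
     (\<forall>i. Suc i < length w \<longrightarrow> \<not> (fst (w ! i) = fst (w ! Suc i) \<and> snd (w ! i) \<noteq> snd (w ! Suc i)))"

definition free_group_on :: "('g, 'm) monoid_scheme \<Rightarrow> 'g set \<Rightarrow> bool" where
  "free_group_on F B \<longleftrightarrow> group F \<and> B \<subseteq> carrier F \<and> generate F B = carrier F \<and>
     (\<forall>w. set (map fst w) \<subseteq> B \<longrightarrow> freely_reduced w \<longrightarrow> w \<noteq> [] \<longrightarrow>
          mprod F (map (letter_val F) w) \<noteq> one F)"

definition finitely_generated_free_group :: "('g, 'm) monoid_scheme \<Rightarrow> bool" where
  "finitely_generated_free_group F \<longleftrightarrow> (\<exists>B. finite B \<and> free_group_on F B)"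

definition comm_set :: "('g, 'm) monoid_scheme \<Rightarrow> 'g set \<Rightarrow> 'g set" where
  "comm_set G N = {commutator G g x | g x. g \<in> carrier G \<and> x \<in> N}"

definition cl :: "('g, 'm) monoid_scheme \<Rightarrow> 'g set \<Rightarrow> 'g \<Rightarrow> nat" where
  "cl G N y = (LEAST n. \<exists>ws. length ws = n \<and>
       set ws \<subseteq> comm_set G N \<union> (\<lambda>c. inv\<^bsub>G\<^esub> c) ` comm_set G N \<and> mprod G ws = y)"

definition scl :: "('g, 'm) monoid_scheme \<Rightarrow> 'g set \<Rightarrow> 'g \<Rightarrow> real" where
  "scl G N y = lim (\<lambda>n::nat. real (cl G N (y [^]\<^bsub>G\<^esub> n)) / real n)"

definition dscl :: "('g, 'm) monoid_scheme \<Rightarrow> 'g set \<Rightarrow> 'g \<Rightarrow> 'g \<Rightarrow> real" where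
  "dscl G N y1 y2 = scl G N (inv\<^bsub>G\<^esub> y1 \<otimes>\<^bsub>G\<^esub> y2)"

section \<open>Group homology in degree 2 via the (inhomogeneous) bar complex, trivial coefficients\<close>

definition chain_supp :: "('c \<Rightarrow> 'r::zero) \<Rightarrow> 'c set" where
  "chain_supp c = {\<sigma>. c \<sigma> \<noteq> 0}"

definition is_chain :: "'c set \<Rightarrow> ('c \<Rightarrow> 'r::zero) \<Rightarrow> bool" where
  "is_chain S c \<longleftrightarrow> finite (chain_supp c) \<and> chain_supp c \<subseteq> S"

definition bd2 :: "('g, 'm) monoid_scheme \<Rightarrow> ('g \<times> 'g \<Rightarrow> 'r::comm_ring_1) \<Rightarrow> 'g \<Rightarrow> 'r" where
  "bd2 G c h = (\<Sum>\<sigma>\<in>chain_supp c. c \<sigma> *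
      ((if snd \<sigma> = h then 1 else 0) - (if fst \<sigma> \<otimes>\<^bsub>G\<^esub> snd \<sigma> = h then 1 else 0)
       + (if fst \<sigma> = h then 1 else 0)))"

definition bd3 :: "('g, 'm) monoid_scheme \<Rightarrow> ('g \<times> 'g \<times> 'g \<Rightarrow> 'r::comm_ring_1) \<Rightarrow> 'g \<times> 'g \<Rightarrow> 'r" where
  "bd3 G z p = (\<Sum>\<sigma>\<in>chain_supp z. (case \<sigma> of (x, y, w) \<Rightarrow> z \<sigma> *
      ((if (y, w) = p then 1 else 0) - (if (x \<otimes>\<^bsub>G\<^esub> y, w) = p then 1 else 0)
       + (if (x, y \<otimes>\<^bsub>G\<^esub> w) = p then 1 else 0) - (if (x, y) = p then 1 else 0))))"

definition is_cycle2 :: "('g, 'm) monoid_scheme \<Rightarrow> ('g \<times> 'g \<Rightarrow> 'r::comm_ring_1) \<Rightarrow> bool" where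
  "is_cycle2 G c \<longleftrightarrow> is_chain (carrier G \<times> carrier G) c \<and> bd2 G c = (\<lambda>_. 0)"

definition is_boundary2 :: "('g, 'm) monoid_scheme \<Rightarrow> ('g \<times> 'g \<Rightarrow> 'r::comm_ring_1) \<Rightarrow> bool" where
  "is_boundary2 G c \<longleftrightarrow> (\<exists>z. is_chain (carrier G \<times> carrier G \<times> carrier G) z \<and> c = bd3 G z)"

definition H2_generator :: "('g, 'm) monoid_scheme \<Rightarrow> ('g \<times> 'g \<Rightarrow> int) \<Rightarrow> bool" where
  "H2_generator G c \<longleftrightarrow> is_cycle2 G c \<and>
     (\<forall>c'. is_cycle2 G c' \<longrightarrow> (\<exists>k::int. is_boundary2 G (\<lambda>\<sigma>. c' \<sigma> - k * c \<sigma>)))"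

definition H2_infinite_cyclic :: "('g, 'm) monoid_scheme \<Rightarrow> bool" where
  "H2_infinite_cyclic G \<longleftrightarrow> (\<exists>c. H2_generator G c \<and>
     (\<forall>k::int. k \<noteq> 0 \<longrightarrow> \<not> is_boundary2 G (\<lambda>\<sigma>. k * c \<sigma>)))"

definition l1norm :: "('c \<Rightarrow> real) \<Rightarrow> real" where
  "l1norm c = (\<Sum>\<sigma>\<in>chain_supp c. \<bar>c \<sigma>\<bar>)"

definition l1_seminorm :: "('g, 'm) monoid_scheme \<Rightarrow> ('g \<times> 'g \<Rightarrow> real) \<Rightarrow> real" where
  "l1_seminorm G c = Inf {l1norm c' | c'. is_chain (carrier G \<times> carrier G) c' \<and>
                                        is_boundary2 G (\<lambda>\<sigma>. c' \<sigma> - c \<sigma>)}"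

text \<open>Simplicial volume: l^1-seminorm of the image in H_2(G;R) of a generator of H_2(G;Z)
  (both generators give the same value).\<close>
definition simplicial_volume :: "('g, 'm) monoid_scheme \<Rightarrow> real" where
  "simplicial_volume G =
     l1_seminorm G (\<lambda>\<sigma>. real_of_int ((SOME c. H2_generator G c) \<sigma>))"

text \<open>A represents the coarse kernel of the identity (Y, d') \<rightarrow> (Y, d).\<close>
definition represents_coarse_kernel ::
  "'g set \<Rightarrow> ('g \<Rightarrow> 'g \<Rightarrow> real) \<Rightarrow> ('g \<Rightarrow> 'g \<Rightarrow> real) \<Rightarrow> 'g set \<Rightarrow> bool" where
  "represents_coarse_kernel Y d' d A \<longleftrightarrow>
     (\<exists>C. \<forall>a\<in>A. \<forall>b\<in>A. d a b \<le> C) \<and>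
     (\<forall>B. B \<subseteq> Y \<longrightarrow> (\<exists>C. \<forall>a\<in>B. \<forall>b\<in>B. d a b \<le> C) \<longrightarrow>
          (\<exists>D. \<forall>b\<in>B. \<exists>a\<in>A. d' a b \<le> D))"

text \<open>Psi : (Z,|.|) \<rightarrow> (A, d) is a coarse isomorphism, where A \<subseteq> Y, Y is a group under mul,
  and the inverse is the restriction to A of a pre-coarse homomorphism Y \<rightarrow> Z.\<close>
definition coarse_iso_from_Z ::
  "('g \<Rightarrow> 'g \<Rightarrow> 'g) \<Rightarrow> 'g set \<Rightarrow> ('g \<Rightarrow> 'g \<Rightarrow> real) \<Rightarrow> 'g set \<Rightarrow> (int \<Rightarrow> 'g) \<Rightarrow> bool" where
  "coarse_iso_from_Z mul Y d A \<Psi> \<longleftrightarrow>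
     (\<forall>m. \<Psi> m \<in> A) \<and>
     (\<forall>R. \<exists>S. \<forall>m n. \<bar>m - n\<bar> \<le> R \<longrightarrow> d (\<Psi> m) (\<Psi> n) \<le> S) \<and>
     (\<exists>C. \<forall>m n. d (\<Psi> (m + n)) (mul (\<Psi> m) (\<Psi> n)) \<le> C) \<and>
     (\<exists>\<phi> :: 'g \<Rightarrow> int.
        (\<exists>C. \<forall>x\<in>Y. \<forall>y\<in>Y. \<bar>\<phi> (mul x y) - \<phi> x - \<phi> y\<bar> \<le> C) \<and>
        (\<forall>R. \<exists>S. \<forall>a\<in>A. \<forall>b\<in>A. d a b \<le> R \<longrightarrow> real_of_int \<bar>\<phi> a - \<phi> b\<bar> \<le> S) \<and>
        (\<exists>C. \<forall>m. \<bar>\<phi> (\<Psi> m) - m\<bar> \<le> C) \<and>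
        (\<exists>C. \<forall>a\<in>A. d (\<Psi> (\<phi> a)) a \<le> C))"

definition quasi_isometric_bounds_Z :: "('g \<Rightarrow> 'g \<Rightarrow> real) \<Rightarrow> (int \<Rightarrow> 'g) \<Rightarrow> bool" where
  "quasi_isometric_bounds_Z d \<Psi> \<longleftrightarrow>
     (\<exists>C1 C2 D1 D2. C1 > 0 \<and> (\<forall>m n.
        C1 * real_of_int \<bar>m - n\<bar> - D1 \<le> d (\<Psi> m) (\<Psi> n) \<and>
        d (\<Psi> m) (\<Psi> n) \<le> C2 * real_of_int \<bar>m - n\<bar> + D2))"

end

theory Submission
  imports Defs "HOL-Library.List_Lexorder" "HOL-Library.Function_Algebras"
begin

text \<open>
  Lifting commutator expressions from \<open>G\<close> to the free group reduces the statement to three facts.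

  First, on \<open>\<gamma>\<^sub>q\<^sub>+\<^sub>1(F)\<close> the mixed and the ordinary stable commutator length of a free group \<open>F\<close> are equivalent.
  Modulo boundedly many mixed commutators the bracket \<open>F \<times> \<gamma>\<^sub>j(F) \<rightarrow> \<gamma>\<^sub>j\<^sub>+\<^sub>1(F)\<close> is bilinear, so the
  endomorphism \<open>x \<mapsto> x\<^sup>k\<close> of the generators multiplies a product of \<open>n\<close> brackets by \<open>k\<^sup>j\<^sup>+\<^sup>1\<close> with an error
  \<open>O(n k\<^sup>j\<^sup>+\<^sup>1)\<close>, while it does not increase commutator length; let \<open>k \<rightarrow> \<infinity>\<close>.

  Second, by the Magnus expansion and a Lyndon basis, \<open>\<gamma>\<^sub>q(F)/\<gamma>\<^sub>q\<^sub>+\<^sub>1(F)\<close> is torsion-free, which yields an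
  invariant homomorphism \<open>h\<close> on \<open>\<gamma>\<^sub>q(F)\<close> with \<open>h(r) \<noteq> 0\<close>.

  Third, non-vanishing simplicial volume and the Hahn-Banach theorem give a bounded cocycle on \<open>G\<close>, whose
  primitive over \<open>F\<close> is a quasimorphism \<open>\<phi>\<close> with \<open>\<phi>(r) \<noteq> 0\<close> that is additive on the normal closure of \<open>r\<close>.
  Hence \<open>h/h(r) - \<phi>/\<phi>(r)\<close> descends to an invariant quasimorphism \<open>\<mu>\<close> on \<open>\<gamma>\<^sub>q(G)\<close> with \<open>\<mu>(\<Psi>(m)) = m + O(1)\<close>;
  it provides the coarse inverse of \<open>\<Psi>\<close> and the lower bounds.
\<close>

section \<open>Commutators and the lower central series\<close>

text \<open>An element of \<open>lcs G (Suc q)\<close> of ordinary commutator length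
  \<open>j\<close> has a lift to \<open>F\<close> of commutator length \<open>j\<close> and another
  lift in \<open>lcs F (Suc q)\<close>, but need not have one lift with both properties; this is the
  obstacle. The two lifts differ by an element of \<open>N\<close>, and modulo
  \<open>lcs F (Suc q)\<close> the subgroup \<open>N\<close> is generated by \<open>r\<close>, so
  the discrepancy is an integer \<open>k\<close>. It is removed by a product of brackets in
  \<open>F\<close> congruent to \<open>r [^] k\<close>. Placing the exponent inside the brackets
  keeps their number independent of \<open>k\<close>.

  A bound on stable length controls only high powers of an element \<open>y\<close>, so
  \<open>k\<close> belongs to a power \<open>y [^] n\<close> and must be compared with
  \<open>n\<close> times an integer depending on \<open>y\<close> alone. This comparison is the task
  of \<mu>. Its two summands coincide on \<open>N\<close>, but they ignore different things:
  \<open>h\<close> ignores everything in \<open>lcs F (Suc q)\<close>, however long, while \<phi> is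
  bounded on products of boundedly many commutators, however deep. On the bracket products,
  \<open>h\<close> therefore counts the exponent exactly and \<phi> stays bounded.\<close>

context group
begin

lemma inv_cancel_left:
  assumes "x \<in> carrier G" "y \<in> carrier G"
  shows "x \<otimes> (inv x \<otimes> y) = y" "inv x \<otimes> (x \<otimes> y) = y"
  using assms by (simp_all add: m_assoc[symmetric])

text \<open>Right association, distribution of inverses and cancellation of neighbours bring both
  sides of an identity to the same reduced word, so commutator identities follow by
  simplification.\<close>

lemmas word_simps = commutator_def m_assoc inv_mult_group inv_cancel_left

lemma commutator_closed [simp, intro]:
  "x \<in> carrier G \<Longrightarrow> y \<in> carrier G \<Longrightarrow> commutator G x y \<in> carrier G"
  by (simp add: commutator_def)

lemma commutator_one [simp]:
  assumes "x \<in> carrier G"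
  shows "commutator G x \<one> = \<one>" "commutator G \<one> x = \<one>" "commutator G x x = \<one>"
  using assms by (simp_all add: word_simps)

lemma inv_commutator:
  assumes "x \<in> carrier G" "y \<in> carrier G"
  shows "inv (commutator G x y) = commutator G y x"
  using assms by (simp add: word_simps)

lemma commutator_mult_right:
  assumes "x \<in> carrier G" "y \<in> carrier G" "z \<in> carrier G"
  shows "commutator G x (y \<otimes> z) = commutator G x y \<otimes> (y \<otimes> commutator G x z \<otimes> inv y)"
  using assms by (simp add: word_simps)

lemma commutator_mult_left:
  assumes "x \<in> carrier G" "y \<in> carrier G" "z \<in> carrier G"
  shows "commutator G (x \<otimes> y) z = (x \<otimes> commutator G y z \<otimes> inv x) \<otimes> commutator G x z"
  using assms by (simp add: word_simps)

lemma commutator_conj: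
  assumes "x \<in> carrier G" "y \<in> carrier G" "g \<in> carrier G"
  shows "g \<otimes> commutator G x y \<otimes> inv g = commutator G (g \<otimes> x \<otimes> inv g) (g \<otimes> y \<otimes> inv g)"
  using assms by (simp add: word_simps)

lemma hall_witt:
  assumes "x \<in> carrier G" "y \<in> carrier G" "z \<in> carrier G"
  shows "(y \<otimes> commutator G x (commutator G (inv y) z) \<otimes> inv y) \<otimes>
         (z \<otimes> commutator G y (commutator G (inv z) x) \<otimes> inv z) \<otimes>
         (x \<otimes> commutator G z (commutator G (inv x) y) \<otimes> inv x) = \<one>"
  using assms by (simp add: word_simps)

lemma comm_set_subset: "N \<subseteq> carrier G \<Longrightarrow> comm_set G N \<subseteq> carrier G"
  by (auto simp: comm_set_def)

lemma comm_set_conj: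
  assumes "N \<lhd> G" "c \<in> comm_set G N" "g \<in> carrier G"
  shows "g \<otimes> c \<otimes> inv g \<in> comm_set G N"
proof -
  interpret N: normal N G by fact
  from assms(2) obtain h x where hx: "c = commutator G h x" "h \<in> carrier G" "x \<in> N"
    by (auto simp: comm_set_def)
  then show ?thesis unfolding comm_set_def
    using assms(3) commutator_conj[of h x g] N.inv_op_closed2[of g x] N.mem_carrier by blast
qed

lemma lcs_Suc: "k \<ge> 1 \<Longrightarrow> lcs G (Suc k) = generate G (comm_set G (lcs G k))"
  by (cases k) (simp_all add: comm_set_def)

lemma carrier_normal: "carrier G \<lhd> G"
  by (rule normal_invI) (auto intro: subgroup_self)

lemma lcs_normal: "lcs G k \<lhd> G"
proof (induction k)
  case (Suc k)
  show ?case
  proof (cases k)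
    case (Suc j)
    then have "lcs G (Suc k) = generate G (comm_set G (lcs G k))" by (simp add: comm_set_def)
    moreover have "generate G (comm_set G (lcs G k)) \<lhd> G"
      using Suc.IH comm_set_conj[OF Suc.IH]
      by (intro normal_generateI comm_set_subset) (auto dest: normal_imp_subgroup subgroup.subset)
    ultimately show ?thesis by simp
  qed (simp add: carrier_normal)
qed (simp add: carrier_normal)

lemma lcs_subgroup: "subgroup (lcs G k) G"
  by (rule normal_imp_subgroup[OF lcs_normal])

lemma lcs_carrier [dest]: "x \<in> lcs G k \<Longrightarrow> x \<in> carrier G"
  by (rule subgroup.mem_carrier[OF lcs_subgroup])

lemma lcs_subset: "lcs G k \<subseteq> carrier G"
  by auto

lemma lcs_closed [simp, intro]:
  "\<one> \<in> lcs G k"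
  "x \<in> lcs G k \<Longrightarrow> y \<in> lcs G k \<Longrightarrow> x \<otimes> y \<in> lcs G k"
  "x \<in> lcs G k \<Longrightarrow> inv x \<in> lcs G k"
  by (simp_all add: lcs_subgroup subgroup.one_closed subgroup.m_closed subgroup.m_inv_closed)

lemma lcs_conj [intro]:
  "g \<in> carrier G \<Longrightarrow> x \<in> lcs G k \<Longrightarrow> g \<otimes> x \<otimes> inv g \<in> lcs G k"
  "g \<in> carrier G \<Longrightarrow> x \<in> lcs G k \<Longrightarrow> inv g \<otimes> x \<otimes> g \<in> lcs G k"
  using normal.inv_op_closed2[OF lcs_normal] normal.inv_op_closed1[OF lcs_normal] by auto

lemma lcs_pow [simp, intro]: "x \<in> lcs G k \<Longrightarrow> x [^] (n::nat) \<in> lcs G k"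
  by (induction n) auto

lemma lcs_int_pow [simp, intro]: "x \<in> lcs G k \<Longrightarrow> x [^] (n::int) \<in> lcs G k"
  using lcs_subgroup subgroup_int_pow_closed by blast

lemma commutator_in_lcs:
  assumes "k \<ge> 1" "g \<in> carrier G" "x \<in> lcs G k"
  shows "commutator G g x \<in> lcs G (Suc k)"
  unfolding lcs_Suc[OF assms(1)] using assms by (auto intro!: generate.incl simp: comm_set_def)

lemma lcs_Suc_subset: "lcs G (Suc k) \<subseteq> lcs G k"
proof (cases k)
  case (Suc j)
  have "comm_set G (lcs G k) \<subseteq> lcs G k"
  proof
    fix c assume "c \<in> comm_set G (lcs G k)"
    then obtain g x where "c = commutator G g x" "g \<in> carrier G" "x \<in> lcs G k"
      by (auto simp: comm_set_def)
    then show "c \<in> lcs G k"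
      unfolding commutator_def using lcs_conj(1)[of g x k] lcs_closed by metis
  qed
  then show ?thesis
    using lcs_subgroup Suc by (simp add: lcs_Suc generate_subgroup_incl del: lcs.simps)
qed auto

lemma lcs_antimono: "i \<le> j \<Longrightarrow> lcs G j \<subseteq> lcs G i"
  by (induction rule: dec_induct) (use lcs_Suc_subset in auto)

lemma conj_mem_iff:
  assumes "N \<lhd> G" "g \<in> carrier G" "x \<in> carrier G"
  shows "g \<otimes> x \<otimes> inv g \<in> N \<longleftrightarrow> x \<in> N"
proof
  assume "g \<otimes> x \<otimes> inv g \<in> N"
  then have "inv g \<otimes> (g \<otimes> x \<otimes> inv g) \<otimes> g \<in> N"
    using normal.inv_op_closed1[OF assms(1)] assms by blast
  then show "x \<in> N" using assms by (simp add: m_assoc inv_cancel_left)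
qed (use normal.inv_op_closed2[OF assms(1)] assms in blast)

lemma commutator_inv_left_iff:
  assumes "N \<lhd> G" "x \<in> carrier G" "y \<in> carrier G"
  shows "commutator G (inv x) y \<in> N \<longleftrightarrow> commutator G x y \<in> N"
proof -
  interpret N: normal N G by fact
  have *: "x \<otimes> commutator G (inv x) y \<otimes> inv x = inv (commutator G x y)"
    using assms by (simp add: word_simps)
  have "commutator G (inv x) y \<in> N \<longleftrightarrow> inv (commutator G x y) \<in> N"
    using conj_mem_iff[OF assms(1,2), of "commutator G (inv x) y"] assms * by simp
  also have "\<dots> \<longleftrightarrow> commutator G x y \<in> N"
    using N.m_inv_closed assms by (metis commutator_closed inv_inv)
  finally show ?thesis .
qed

text \<open>An elementwise three subgroups lemma: two factors of the Hall-Witt identity lie in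
  \<open>N\<close>, hence so does the third, and normality disposes of the outer
  conjugations.\<close>

lemma three_subgroup:
  assumes N: "N \<lhd> G" and xyz: "x \<in> carrier G" "y \<in> carrier G" "z \<in> carrier G"
    and 1: "commutator G y (commutator G (inv z) x) \<in> N"
    and 2: "commutator G z (commutator G (inv x) y) \<in> N"
  shows "commutator G x (commutator G (inv y) z) \<in> N"
proof -
  interpret N: normal N G by fact
  let ?a = "y \<otimes> commutator G x (commutator G (inv y) z) \<otimes> inv y"
  let ?b = "z \<otimes> commutator G y (commutator G (inv z) x) \<otimes> inv z"
  let ?c = "x \<otimes> commutator G z (commutator G (inv x) y) \<otimes> inv x"
  have c: "?a \<in> carrier G" "?b \<in> carrier G" "?c \<in> carrier G" using xyz by auto
  have "?a \<otimes> ?b \<otimes> ?c = \<one>" using hall_witt xyz by blast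
  then have "?a \<otimes> (?b \<otimes> ?c) = \<one>" using c by (simp add: m_assoc del: commutator_closed)
  then have "?a = inv (?b \<otimes> ?c)" using c by (simp add: inv_equality)
  moreover have "?b \<in> N" "?c \<in> N" using 1 2 xyz conj_mem_iff[OF N] by simp_all
  ultimately have "?a \<in> N" by (metis N.m_closed N.m_inv_closed)
  then show ?thesis using xyz conj_mem_iff[OF N] by simp
qed

text \<open>The elements that commute with \<open>g\<close> modulo the normal subgroup
  \<open>N\<close> form a subgroup, so generators suffice.\<close>

lemma commutator_generate:
  assumes N: "N \<lhd> G" and g: "g \<in> carrier G" and S: "S \<subseteq> carrier G"
    and *: "\<And>s. s \<in> S \<Longrightarrow> commutator G g s \<in> N" and x: "x \<in> generate G S"
  shows "commutator G g x \<in> N"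
proof -
  interpret N: normal N G by fact
  have gc: "y \<in> carrier G" if "y \<in> generate G S" for y using generate_in_carrier[OF S that] .
  show ?thesis using x
  proof (induction rule: generate.induct)
    case one then show ?case using g by simp
  next
    case (incl h) then show ?case by (rule *)
  next
    case (inv h)
    then have h: "h \<in> carrier G" using S by auto
    have "inv (commutator G (inv h) g) \<in> N \<longleftrightarrow> commutator G (inv h) g \<in> N"
      using N.m_inv_closed g h by (metis commutator_closed inv_closed inv_inv)
    moreover have "commutator G h g \<in> N"
      using *[OF inv] N.m_inv_closed g h inv_commutator by metis
    ultimately show ?case using commutator_inv_left_iff[OF N h g] g h inv_commutator[of "inv h" g] by simp
  next
    case (eng h1 h2)
    then show ?case using gc[of h1] gc[of h2] g conj_mem_iff[OF N]
      by (simp add: commutator_mult_right)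
  qed
qed

lemma commutator_lcs_lcs:
  assumes "i \<ge> 1" "j \<ge> 1" "x \<in> lcs G i" "y \<in> lcs G j"
  shows "commutator G x y \<in> lcs G (i + j)"
  using assms
proof (induction i arbitrary: j x y rule: less_induct)
  case (less i)
  show ?case
  proof (cases "i = 1")
    case True
    then show ?thesis using less.prems commutator_in_lcs[of j x y] by auto
  next
    case False
    then obtain k where k: "i = Suc k" "k \<ge> 1" using less.prems(1) by (cases i) auto
    have y: "y \<in> carrier G" using less.prems by auto
    have "commutator G y s \<in> lcs G (i + j)" if "s \<in> comm_set G (lcs G k)" for s
    proof -
      from that obtain g u where s: "s = commutator G g u" "g \<in> carrier G" "u \<in> lcs G k"
        by (auto simp: comm_set_def)
      have u: "u \<in> carrier G" using s by auto
      \<comment> \<open>The double inverse gives the shape of \<open>three_subgroup\<close>. In both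
        hypotheses the entry \<open>u\<close> has weight \<open>k < i\<close>, so the induction
        hypothesis applies, once with \<open>j\<close> raised by one.\<close>
      have "commutator G y (commutator G (inv (inv g)) u) \<in> lcs G (i + j)"
      proof (rule three_subgroup[OF lcs_normal y _ u])
        have "commutator G (inv u) y \<in> lcs G (k + j)"
          using less.IH[of k j "inv u" y] k s less.prems by auto
        then show "commutator G (inv g) (commutator G (inv u) y) \<in> lcs G (i + j)"
          using commutator_in_lcs[of "k + j"] k s by simp
        have "commutator G (inv y) (inv g) = inv (commutator G (inv g) (inv y))"
          using y s by (simp add: inv_commutator)
        moreover have "commutator G (inv g) (inv y) \<in> lcs G (Suc j)"
          using commutator_in_lcs[of j] less.prems s by auto
        ultimately have "commutator G (inv y) (inv g) \<in> lcs G (Suc j)" by auto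
        then show "commutator G u (commutator G (inv y) (inv g)) \<in> lcs G (i + j)"
          using less.IH[of k "Suc j" u] k s by simp
      qed (use s in auto)
      then show ?thesis using s by simp
    qed
    then have "commutator G y x \<in> lcs G (i + j)"
      using commutator_generate[OF lcs_normal y, of "comm_set G (lcs G k)" "i + j" x] less.prems k
      by (simp add: lcs_Suc comm_set_subset lcs_subset)
    then have "inv (commutator G y x) \<in> lcs G (i + j)" by blast
    then show ?thesis using y less.prems by (simp add: inv_commutator lcs_carrier)
  qed
qed

end

section \<open>Mixed commutator length\<close>

text \<open>Words of length exactly \<open>n\<close> give the whole ball of radius \<open>n\<close>,
  because the identity is a commutator.\<close>

definition mball :: "('g, 'm) monoid_scheme \<Rightarrow> 'g set \<Rightarrow> nat \<Rightarrow> 'g set" where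
  "mball G N n = {mprod G ws | ws. length ws = n \<and>
     set ws \<subseteq> comm_set G N \<union> (\<lambda>c. inv\<^bsub>G\<^esub> c) ` comm_set G N}"

text \<open>Distance at most \<open>n\<close> in the word metric of \<open>cl\<close>. The balls are
  invariant under conjugation, so the metric is bi-invariant: errors add up under products and are
  unchanged by inversion.\<close>

definition approx :: "('g, 'm) monoid_scheme \<Rightarrow> 'g set \<Rightarrow> nat \<Rightarrow> 'g \<Rightarrow> 'g \<Rightarrow> bool" where
  "approx G N n u v \<longleftrightarrow> u \<in> carrier G \<and> v \<in> carrier G \<and> inv\<^bsub>G\<^esub> u \<otimes>\<^bsub>G\<^esub> v \<in> mball G N n"

lemma mprod_simps [simp]: "mprod G [] = \<one>\<^bsub>G\<^esub>" "mprod G (x # xs) = x \<otimes>\<^bsub>G\<^esub> mprod G xs"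
  by (simp_all add: mprod_def)

lemma (in group) mprod_closed [simp, intro]: "set xs \<subseteq> carrier G \<Longrightarrow> mprod G xs \<in> carrier G"
  by (induction xs) auto

lemma (in group) mprod_append:
  "set xs \<subseteq> carrier G \<Longrightarrow> set ys \<subseteq> carrier G \<Longrightarrow> mprod G (xs @ ys) = mprod G xs \<otimes> mprod G ys"
  by (induction xs) (auto simp: m_assoc)

lemma (in group) mprod_conj:
  "set xs \<subseteq> carrier G \<Longrightarrow> g \<in> carrier G \<Longrightarrow>
    g \<otimes> mprod G xs \<otimes> inv g = mprod G (map (\<lambda>x. g \<otimes> x \<otimes> inv g) xs)"
proof (induction xs)
  case (Cons x xs)
  then have "x \<in> carrier G" "mprod G xs \<in> carrier G" by auto
  then have "g \<otimes> mprod G (x # xs) \<otimes> inv g = (g \<otimes> x \<otimes> inv g) \<otimes> (g \<otimes> mprod G xs \<otimes> inv g)"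
    using Cons.prems by (simp add: m_assoc inv_cancel_left)
  then show ?case using Cons by simp
qed auto

lemma (in group) inv_mprod:
  "set xs \<subseteq> carrier G \<Longrightarrow> inv (mprod G xs) = mprod G (rev (map (\<lambda>x. inv x) xs))"
proof (induction xs)
  case (Cons x xs)
  then have "set (rev (map (\<lambda>x. inv x) xs)) \<subseteq> carrier G" by auto
  then show ?case using Cons by (simp add: inv_mult_group mprod_append)
qed auto

lemma (in group) mprod_in_subgroup:
  "subgroup S G \<Longrightarrow> set xs \<subseteq> S \<Longrightarrow> mprod G xs \<in> S"
  by (induction xs) (auto intro: subgroup.m_closed subgroup.one_closed)

context normal
begin

declare mem_carrier [dest]

definition letters where
  "letters = comm_set G H \<union> (\<lambda>c. inv c) ` comm_set G H"

lemma letters_conv: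
  "letters = {commutator G g x | g x. g \<in> carrier G \<and> x \<in> H} \<union>
             {commutator G x g | g x. g \<in> carrier G \<and> x \<in> H}"
  unfolding letters_def comm_set_def
  by (auto simp: inv_commutator image_iff) (metis inv_commutator mem_carrier)

lemma commutator_in_letters:
  assumes "g \<in> carrier G" "x \<in> H"
  shows "commutator G g x \<in> letters" "commutator G x g \<in> letters"
  using assms unfolding letters_conv by blast+

lemma letters_carrier: "letters \<subseteq> carrier G"
  by (auto simp: letters_conv)

lemma letters_inv: "c \<in> letters \<Longrightarrow> inv c \<in> letters"
  unfolding letters_conv by (auto simp: inv_commutator)

lemma letters_conj: "c \<in> letters \<Longrightarrow> g \<in> carrier G \<Longrightarrow> g \<otimes> c \<otimes> inv g \<in> letters"
  unfolding letters_conv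
  by (auto simp: commutator_conj) (metis inv_op_closed2 m_closed inv_closed)+

lemma one_in_letters: "\<one> \<in> letters"
  unfolding letters_conv using commutator_one(3)[of \<one>] one_closed one_closed by (auto intro!: exI[of _ \<one>])

lemma mball_letters: "mball G H n = {mprod G ws | ws. length ws = n \<and> set ws \<subseteq> letters}"
  by (simp add: mball_def letters_def)

lemma mball_carrier: "x \<in> mball G H n \<Longrightarrow> x \<in> carrier G"
  using letters_carrier by (auto simp: mball_letters)

lemma mball_one: "\<one> \<in> mball G H n"
proof -
  have "mprod G (replicate n \<one>) = \<one>" by (induction n) auto
  then show ?thesis unfolding mball_letters using one_in_letters
    by (auto intro!: exI[of _ "replicate n \<one>"])
qed

lemma mball_0: "mball G H 0 = {\<one>}"
  by (auto simp: mball_letters)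

lemma mball_mult: "x \<in> mball G H m \<Longrightarrow> y \<in> mball G H n \<Longrightarrow> x \<otimes> y \<in> mball G H (m + n)"
  unfolding mball_letters using letters_carrier
  by (auto simp: mprod_append[symmetric]) (metis length_append set_append le_sup_iff mprod_append subset_trans)

lemma mball_mono: "m \<le> n \<Longrightarrow> x \<in> mball G H m \<Longrightarrow> x \<in> mball G H n"
  using mball_mult[of x m \<one> "n - m"] mball_one mball_carrier by auto

lemma mball_inv: "x \<in> mball G H n \<Longrightarrow> inv x \<in> mball G H n"
  unfolding mball_letters
proof clarsimp
  fix ws assume ws: "set ws \<subseteq> letters"
  then show "\<exists>ws'. inv (mprod G ws) = mprod G ws' \<and> length ws' = length ws \<and> set ws' \<subseteq> letters"
    using letters_inv letters_carrier inv_mprod[of ws]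
    by (intro exI[of _ "rev (map (\<lambda>x. inv x) ws)"]) auto
qed

lemma mball_conj: "x \<in> mball G H n \<Longrightarrow> g \<in> carrier G \<Longrightarrow> g \<otimes> x \<otimes> inv g \<in> mball G H n"
  unfolding mball_letters
proof clarsimp
  fix ws assume ws: "set ws \<subseteq> letters" and g: "g \<in> carrier G"
  then show "\<exists>ws'. g \<otimes> mprod G ws \<otimes> inv g = mprod G ws' \<and> length ws' = length ws \<and> set ws' \<subseteq> letters"
    using letters_conj[OF _ g] letters_carrier mprod_conj[of ws g]
    by (intro exI[of _ "map (\<lambda>x. g \<otimes> x \<otimes> inv g) ws"]) auto
qed

lemma mball_letter: "x \<in> letters \<Longrightarrow> x \<in> mball G H 1"
  unfolding mball_letters using letters_carrier by (auto intro!: exI[of _ "[x]"])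

lemma mball_commutator:
  assumes "g \<in> carrier G" "x \<in> H"
  shows "commutator G g x \<in> mball G H 1" "commutator G x g \<in> mball G H 1"
  using assms by (blast intro: mball_letter commutator_in_letters)+

lemma mball_pow: "x \<in> mball G H n \<Longrightarrow> x [^] (m::nat) \<in> mball G H (m * n)"
proof (induction m)
  case (Suc m)
  then have "x [^] m \<otimes> x \<in> mball G H (m * n + n)" using mball_mult by blast
  then show ?case by (simp add: add.commute)
qed (simp add: mball_0)

lemma mball_induct [consumes 1, case_names one step]:
  assumes "x \<in> mball G H n" "P 0 \<one>"
    "\<And>k c y. c \<in> letters \<Longrightarrow> y \<in> mball G H k \<Longrightarrow> P k y \<Longrightarrow> P (Suc k) (c \<otimes> y)"
  shows "P n x"
proof -
  have "P (length ws) (mprod G ws)" if "set ws \<subseteq> letters" for ws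
    using that by (induction ws) (auto intro!: assms simp: mball_letters)
  then show ?thesis using assms(1) by (auto simp: mball_letters)
qed

lemma letters_subset_H: "letters \<subseteq> H"
proof -
  have "commutator G g x \<in> H" if "g \<in> carrier G" "x \<in> H" for g x
    unfolding commutator_def using that inv_op_closed2 by blast
  moreover have "commutator G x g \<in> H" if "g \<in> carrier G" "x \<in> H" for g x
    using calculation[OF that] that inv_commutator[of g x] m_inv_closed mem_carrier by metis
  ultimately show ?thesis by (auto simp: letters_conv)
qed

lemma mball_H: "x \<in> mball G H n \<Longrightarrow> x \<in> H"
  using letters_subset_H mprod_in_subgroup[OF subgroup_axioms] by (auto simp: mball_letters)

lemma comm_set_carrier: "comm_set G H \<subseteq> carrier G"
  using letters_carrier by (auto simp: letters_def)

lemma generate_comm_set: "y \<in> generate G (comm_set G H) \<longleftrightarrow> (\<exists>n. y \<in> mball G H n)"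
proof
  show "\<exists>n. y \<in> mball G H n" if "y \<in> generate G (comm_set G H)"
    using that
  proof (induction rule: generate.induct)
    case one then show ?case using mball_one by blast
  next
    case (incl h) then show ?case using mball_letter by (auto simp: letters_def)
  next
    case (inv h)
    then have "inv h \<in> letters" unfolding letters_def by blast
    then show ?case using mball_letter by blast
  next
    case (eng h1 h2) then show ?case using mball_mult by blast
  qed
  assume "\<exists>n. y \<in> mball G H n"
  then obtain ws where "y = mprod G ws" "set ws \<subseteq> letters" by (auto simp: mball_letters)
  then show "y \<in> generate G (comm_set G H)"
    using mprod_in_subgroup[OF generate_is_subgroup[OF comm_set_carrier], of ws]
    by (fastforce simp: letters_def intro: generate.intros)
qed

lemma cl_le: "y \<in> mball G H n \<Longrightarrow> cl G H y \<le> n"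
  unfolding cl_def mball_def by (rule Least_le) auto

lemma mball_cl: "y \<in> generate G (comm_set G H) \<Longrightarrow> y \<in> mball G H (cl G H y)"
  unfolding generate_comm_set cl_def mball_def
  by (smt (verit, del_insts) LeastI_ex mem_Collect_eq)

subsection \<open>Equality up to boundedly many commutators\<close>

lemma approx_refl [simp, intro]: "u \<in> carrier G \<Longrightarrow> approx G H n u u"
  by (simp add: approx_def mball_one)

lemma approx_mono: "approx G H m u v \<Longrightarrow> m \<le> n \<Longrightarrow> approx G H n u v"
  using mball_mono by (auto simp: approx_def)

lemma approx_carrier [dest]: "approx G H n u v \<Longrightarrow> u \<in> carrier G \<and> v \<in> carrier G"
  by (simp add: approx_def)

lemma approx_sym: "approx G H n u v \<Longrightarrow> approx G H n v u"
  using mball_inv[of "inv u \<otimes> v" n] by (auto simp: approx_def inv_mult_group)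

lemma approx_trans: "approx G H m u v \<Longrightarrow> approx G H n v w \<Longrightarrow> approx G H (m + n) u w"
  using mball_mult[of "inv u \<otimes> v" m "inv v \<otimes> w" n]
  by (auto simp: approx_def m_assoc inv_cancel_left)

lemma approx_mult:
  assumes "approx G H m u v" "approx G H n u' v'"
  shows "approx G H (m + n) (u \<otimes> u') (v \<otimes> v')"
proof -
  have c: "u \<in> carrier G" "v \<in> carrier G" "u' \<in> carrier G" "v' \<in> carrier G" using assms by auto
  have "inv u' \<otimes> (inv u \<otimes> v) \<otimes> inv (inv u') \<in> mball G H m"
    using assms c by (intro mball_conj) (auto simp: approx_def)
  then have "(inv u' \<otimes> (inv u \<otimes> v) \<otimes> inv (inv u')) \<otimes> (inv u' \<otimes> v') \<in> mball G H (m + n)"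
    using assms by (intro mball_mult) (auto simp: approx_def)
  then show ?thesis using c by (simp add: approx_def inv_mult_group m_assoc inv_cancel_left)
qed

lemma approx_inv:
  assumes "approx G H n u v"
  shows "approx G H n (inv u) (inv v)"
proof -
  have c: "u \<in> carrier G" "v \<in> carrier G" using assms by auto
  have "u \<otimes> inv (inv u \<otimes> v) \<otimes> inv u \<in> mball G H n"
    using assms c by (intro mball_conj mball_inv) (auto simp: approx_def)
  then show ?thesis using c by (simp add: approx_def inv_mult_group m_assoc inv_cancel_left)
qed

lemma approx_pow: "approx G H n u v \<Longrightarrow> approx G H (m * n) (u [^] (m::nat)) (v [^] m)"
proof (induction m)
  case (Suc m)
  then show ?case using approx_mult[of "m * n" "u [^] m" "v [^] m" n u v]
    by (simp add: add.commute)
qed simp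

lemma approx_commute:
  assumes "u \<in> H" "v \<in> carrier G"
  shows "approx G H 1 (u \<otimes> v) (v \<otimes> u)"
proof -
  have "commutator G (inv v) (inv u) \<in> mball G H 1" using assms by (intro mball_commutator) auto
  moreover have "commutator G (inv v) (inv u) = inv (u \<otimes> v) \<otimes> (v \<otimes> u)"
    using assms mem_carrier by (simp add: word_simps)
  ultimately show ?thesis using assms by (auto simp: approx_def)
qed

lemma approx_conj:
  assumes "u \<in> H" "g \<in> carrier G"
  shows "approx G H 1 (g \<otimes> u \<otimes> inv g) u"
proof -
  have u: "u \<in> carrier G" using assms by auto
  have "approx G H (0 + 1) (inv g \<otimes> (g \<otimes> u)) (g \<otimes> u \<otimes> inv g)"
    using approx_commute[of "g \<otimes> u \<otimes> inv g" g] assms u approx_sym inv_op_closed2[of g u]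
      approx_mult[of 0 "inv g" "inv g" 1 "g \<otimes> u" "g \<otimes> (g \<otimes> u \<otimes> inv g)"]
    by (simp add: m_assoc inv_cancel_left)
  then show ?thesis using assms u approx_sym by (simp add: inv_cancel_left)
qed

text \<open>The new \<open>u\<close> passes the whole power \<open>v [^] m\<close> at the price of
  one letter, as one entry of a mixed commutator is an arbitrary group element. The error is
  therefore linear in \<open>m\<close>.\<close>

lemma approx_mult_pow:
  assumes u: "u \<in> H" and v: "v \<in> carrier G"
  shows "approx G H m ((u \<otimes> v) [^] m) (u [^] m \<otimes> v [^] (m::nat))"
proof (induction m)
  case (Suc m)
  have c: "u \<in> carrier G" using u by auto
  have "approx G H (m + 0) ((u \<otimes> v) [^] m \<otimes> (u \<otimes> v)) (u [^] m \<otimes> v [^] m \<otimes> (u \<otimes> v))"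
    using Suc c v by (intro approx_mult) auto
  moreover have "approx G H (0 + (1 + 0)) (u [^] m \<otimes> ((v [^] m \<otimes> u) \<otimes> v)) (u [^] m \<otimes> ((u \<otimes> v [^] m) \<otimes> v))"
    using c v by (intro approx_mult approx_refl approx_sym[OF approx_commute] u) auto
  ultimately show ?case using approx_trans[of "m + 0" _ _ "0 + (1 + 0)"] c v by (simp add: m_assoc)
qed (use v in auto)

lemma approx_mball: "approx G H n u v \<Longrightarrow> u \<in> mball G H m \<Longrightarrow> v \<in> mball G H (m + n)"
  using mball_mult[of u m "inv u \<otimes> v" n] by (auto simp: approx_def inv_cancel_left)

lemma approx_one_iff: "approx G H n \<one> v \<longleftrightarrow> v \<in> mball G H n"
  using mball_carrier by (auto simp: approx_def)

lemma approx_mem_H: "approx G H n u v \<Longrightarrow> u \<in> H \<Longrightarrow> v \<in> H"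
proof -
  assume a: "approx G H n u v" "u \<in> H"
  then have "inv u \<otimes> v \<in> H" by (auto simp: approx_def mball_H)
  then have "u \<otimes> (inv u \<otimes> v) \<in> H" using a by blast
  then show ?thesis using a by (auto simp: approx_def inv_cancel_left)
qed

end

text \<open>The model is \<open>K = lcs G j\<close> and \<open>H = lcs G (Suc j)\<close>. Up to
  boundedly many commutators with an entry in \<open>H\<close>, the bracket of \<open>G\<close> and
  \<open>K\<close> is bilinear; the lemmas below count these commutators.\<close>

locale comm_pair = normal +
  fixes K
  assumes K: "K \<lhd> G" and comm_in: "g \<in> carrier G \<Longrightarrow> b \<in> K \<Longrightarrow> commutator G g b \<in> H"
begin

sublocale K: normal K G by (rule K)

lemma K_carrier [dest]: "b \<in> K \<Longrightarrow> b \<in> carrier G" by (rule K.mem_carrier)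

lemma approx_comm_right:
  assumes "g \<in> carrier G" "b \<in> K" "b' \<in> K"
  shows "approx G H 1 (commutator G g (b \<otimes> b')) (commutator G g b \<otimes> commutator G g b')"
proof -
  have c: "b \<in> carrier G" "b' \<in> carrier G" using assms by auto
  have "approx G H (0 + 1) (commutator G g b \<otimes> (b \<otimes> commutator G g b' \<otimes> inv b))
      (commutator G g b \<otimes> commutator G g b')"
    using assms c by (intro approx_mult approx_refl approx_conj comm_in) auto
  then show ?thesis using assms c by (simp add: commutator_mult_right)
qed

lemma approx_comm_left:
  assumes "g \<in> carrier G" "g' \<in> carrier G" "b \<in> K"
  shows "approx G H 2 (commutator G (g \<otimes> g') b) (commutator G g b \<otimes> commutator G g' b)"
proof -
  have c: "b \<in> carrier G" using assms by auto
  have "approx G H (1 + 0) ((g \<otimes> commutator G g' b \<otimes> inv g) \<otimes> commutator G g b)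
      (commutator G g' b \<otimes> commutator G g b)"
    using assms c by (intro approx_mult approx_refl approx_conj comm_in) auto
  moreover have "approx G H 1 (commutator G g' b \<otimes> commutator G g b) (commutator G g b \<otimes> commutator G g' b)"
    using assms c by (intro approx_commute comm_in) auto
  ultimately show ?thesis
    using assms c approx_trans[of "1 + 0" _ _ 1] by (simp add: commutator_mult_left numeral_2_eq_2)
qed

text \<open>The commutator length of \<open>c\<close> does not matter: its bracket with
  \<open>g\<close> is conjugated by \<open>b\<close> but remains a single letter.\<close>

lemma approx_comm_right_H:
  assumes "g \<in> carrier G" "b \<in> carrier G" "c \<in> H"
  shows "approx G H 1 (commutator G g (b \<otimes> c)) (commutator G g b)"
proof -
  have c: "c \<in> carrier G" using assms by auto
  have "approx G H (0 + 1) (commutator G g b \<otimes> \<one>) (commutator G g b \<otimes> (b \<otimes> commutator G g c \<otimes> inv b))"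
    using assms c
    by (intro approx_mult approx_refl iffD2[OF approx_one_iff] mball_conj mball_commutator) auto
  then show ?thesis using assms c approx_sym by (simp add: commutator_mult_right)
qed

lemma approx_comm_pow_right:
  assumes "g \<in> carrier G" "b \<in> K"
  shows "approx G H m (commutator G g (b [^] (m::nat))) (commutator G g b [^] m)"
proof (induction m)
  case (Suc m)
  have c: "b \<in> carrier G" using assms by auto
  have bm: "b [^] m \<in> K" by (induction m) (use assms in auto)
  have "approx G H (1 + (m + 0)) (commutator G g (b [^] m \<otimes> b)) (commutator G g b [^] m \<otimes> commutator G g b)"
    using assms c bm Suc by (intro approx_trans[OF approx_comm_right] approx_mult approx_refl) auto
  then show ?case by simp
qed (use assms in auto)

lemma approx_comm_pow_left:
  assumes "g \<in> carrier G" "b \<in> K"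
  shows "approx G H (2 * m) (commutator G (g [^] (m::nat)) b) (commutator G g b [^] m)"
proof (induction m)
  case (Suc m)
  have c: "b \<in> carrier G" using assms by auto
  have "approx G H (2 + (2 * m + 0)) (commutator G (g [^] m \<otimes> g) b) (commutator G g b [^] m \<otimes> commutator G g b)"
    using assms c Suc by (intro approx_trans[OF approx_comm_left] approx_mult approx_refl) auto
  then show ?case by simp
qed (use assms in auto)

lemma approx_comm_inv_left:
  assumes "g \<in> carrier G" "b \<in> K"
  shows "approx G H 2 (commutator G (inv g) b) (inv (commutator G g b))"
proof -
  have c: "b \<in> carrier G" using assms by auto
  have "approx G H 2 \<one> (commutator G g b \<otimes> commutator G (inv g) b)"
    using approx_comm_left[of g "inv g" b] assms c by simp
  then have "approx G H (0 + 2) (inv (commutator G g b) \<otimes> \<one>)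
      (inv (commutator G g b) \<otimes> (commutator G g b \<otimes> commutator G (inv g) b))"
    using assms c by (intro approx_mult approx_refl) auto
  then have "approx G H 2 (inv (commutator G g b)) (commutator G (inv g) b)"
    using assms c by (simp add: inv_cancel_left numeral_2_eq_2)
  then show ?thesis by (rule approx_sym)
qed

text \<open>By bilinearity the bracket becomes the commutator of \<open>[u, b]\<close> and
  \<open>[v, b]\<close>, both in \<open>H\<close>, hence a single letter. The expansion uses three
  products and two inverses at cost 2 each; the resulting 11 is rounded up to 12.\<close>

lemma mball_comm_comm:
  assumes "u \<in> carrier G" "v \<in> carrier G" "b \<in> K"
  shows "commutator G (commutator G u v) b \<in> mball G H 12"
proof -
  have c: "b \<in> carrier G" using assms by auto
  let ?u = "commutator G u b" and ?v = "commutator G v b"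
  have uv: "?u \<in> H" "?v \<in> H" using assms comm_in by auto
  have uvc: "?u \<in> carrier G" "?v \<in> carrier G" using assms c by auto
  have "approx G H (2 + (2 + (2 + 0 + 2) + 2)) (commutator G (u \<otimes> v \<otimes> inv u \<otimes> inv v) b)
      (?u \<otimes> ?v \<otimes> inv ?u \<otimes> inv ?v)"
    using assms c
    by (intro approx_trans[OF approx_comm_left] approx_mult[where u="commutator G (u \<otimes> v \<otimes> inv u) b"]
      approx_mult[where u="commutator G (u \<otimes> v) b"] approx_comm_inv_left
      approx_trans[OF approx_comm_left, where n=0] approx_refl) auto
  moreover have "?u \<otimes> ?v \<otimes> inv ?u \<otimes> inv ?v \<in> mball G H 1"
    using mball_commutator(1)[OF uvc(1) uv(2)] by (simp add: commutator_def)
  ultimately have "commutator G (u \<otimes> v \<otimes> inv u \<otimes> inv v) b \<in> mball G H (1 + (2 + (2 + (2 + 0 + 2) + 2)))"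
    using approx_mball approx_sym by blast
  then show ?thesis unfolding commutator_def[of G u v] by (rule mball_mono[rotated]) simp
qed

text \<open>The point: the bound does not depend on \<open>b\<close>.\<close>
lemma mball_comm_derived:
  assumes "g \<in> mball G (carrier G) n" "b \<in> K"
  shows "commutator G g b \<in> mball G H (14 * n)"
proof -
  interpret A: normal "carrier G" G by (rule carrier_normal)
  have c: "b \<in> carrier G" using assms by auto
  show ?thesis using assms(1)
  proof (induction rule: A.mball_induct)
    case (step k x y)
    then obtain u v where uv: "x = commutator G u v" "u \<in> carrier G" "v \<in> carrier G"
      by (auto simp: A.letters_conv)
    have y: "y \<in> carrier G" using A.mball_carrier step by blast
    have "approx G H 2 (commutator G x b \<otimes> commutator G y b) (commutator G (x \<otimes> y) b)"
      using approx_comm_left[of x y b] uv y assms approx_sym by auto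
    moreover have "commutator G x b \<otimes> commutator G y b \<in> mball G H (12 + 14 * k)"
      using uv mball_comm_comm assms step by (intro mball_mult) auto
    ultimately have "commutator G (x \<otimes> y) b \<in> mball G H (12 + 14 * k + 2)"
      using approx_mball by blast
    then show ?case by (simp add: add.commute)
  qed (use c in \<open>auto simp: mball_one\<close>)
qed

end

lemma (in group_hom) hom_commutator:
  "x \<in> carrier G \<Longrightarrow> y \<in> carrier G \<Longrightarrow> h (commutator G x y) = commutator H (h x) (h y)"
  by (simp add: commutator_def)

lemma (in group_hom) hom_mprod: "set xs \<subseteq> carrier G \<Longrightarrow> h (mprod G xs) = mprod H (map h xs)"
  by (induction xs) auto

lemma (in group_hom) hom_mball:
  assumes "N \<lhd> G" "N' \<lhd> H" "h ` N \<subseteq> N'" "x \<in> mball G N n"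
  shows "h x \<in> mball H N' n"
proof -
  interpret N: normal N G by fact
  interpret N': normal N' H by fact
  from assms(4) obtain ws where ws: "x = mprod G ws" "length ws = n" "set ws \<subseteq> N.letters"
    by (auto simp: N.mball_letters)
  have *: "h w \<in> N'.letters" if w: "w \<in> N.letters" for w
  proof -
    from w consider g y where "w = commutator G g y" "g \<in> carrier G" "y \<in> N"
      | g y where "w = commutator G y g" "g \<in> carrier G" "y \<in> N" by (auto simp: N.letters_conv)
    then show ?thesis
      using assms(3) N.mem_carrier N'.commutator_in_letters by cases (auto simp: hom_commutator image_subset_iff)
  qed
  have "set (map h ws) \<subseteq> N'.letters" using * ws(3) by auto
  then show ?thesis using ws hom_mprod[of ws] N.letters_carrier
    by (auto simp: N'.mball_letters simp del: set_map intro!: exI[of _ "map h ws"])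
qed

lemma (in group_hom) hom_lcs: "h ` lcs G k \<subseteq> lcs H k"
proof (induction k)
  case (Suc k)
  show ?case
  proof (cases k)
    case 0 then show ?thesis by auto
  next
    case (Suc j)
    have "h x \<in> lcs H (Suc k)" if "x \<in> generate G (comm_set G (lcs G k))" for x
      using that
    proof (induction rule: generate.induct)
      case (incl y)
      then obtain g z where "y = commutator G g z" "g \<in> carrier G" "z \<in> lcs G k" by (auto simp: comm_set_def)
      then show ?case using Suc.IH \<open>k = Suc j\<close> H.commutator_in_lcs[of k "h g" "h z"]
        by (auto simp: hom_commutator G.lcs_carrier simp del: lcs.simps)
    next
      case (inv y)
      then obtain g z where "y = commutator G g z" "g \<in> carrier G" "z \<in> lcs G k" by (auto simp: comm_set_def)
      then show ?case using Suc.IH \<open>k = Suc j\<close> H.commutator_in_lcs[of k "h g" "h z"]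
        by (auto simp: hom_commutator G.lcs_carrier simp del: lcs.simps intro!: H.lcs_closed)
    next
      case (eng y z)
      then have "y \<in> carrier G" "z \<in> carrier G"
        using G.generate_in_carrier[OF G.comm_set_subset[OF G.lcs_subset]] by auto
      then show ?case using eng by (simp del: lcs.simps)
    qed (simp del: lcs.simps)
    then show ?thesis using Suc by (auto simp: G.lcs_Suc simp del: lcs.simps)
  qed
qed auto

section \<open>Stable mixed commutator length\<close>

lemma fekete:
  fixes a :: "nat \<Rightarrow> real"
  assumes nn: "\<And>n. a n \<ge> 0" and sub: "\<And>m n. a (m + n) \<le> a m + a n"
  shows "convergent (\<lambda>n. a n / real n)"
proof -
  let ?S = "(\<lambda>n. a n / real n) ` {1..}"
  define L where "L = Inf ?S"
  have bdd: "bdd_below ?S" by (rule bdd_belowI[of _ 0]) (auto simp: nn)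
  have "(\<lambda>n. a n / real n) \<longlonglongrightarrow> L"
  proof (rule LIMSEQ_I)
    fix e :: real assume e: "e > 0"
    then have "Inf ?S < L + e / 2" by (simp add: L_def)
    then obtain m where m: "m \<ge> 1" "a m / m < L + e / 2"
      using cInf_lessD[of ?S "L + e / 2"] by auto
    have mult: "a (q * m) \<le> q * a m + a 0" for q
    proof (induction q)
      case (Suc q)
      have "a (Suc q * m) \<le> a m + a (q * m)" using sub[of m "q * m"] by simp
      then show ?case using Suc by (simp add: algebra_simps)
    qed simp
    define B where "B = Max (a ` {..<m}) + a 0"
    have B: "a n \<le> (n div m) * a m + B" for n
    proof -
      have "a n \<le> a ((n div m) * m) + a (n mod m)"
        using sub[of "(n div m) * m" "n mod m"] by simp
      moreover have "a (n mod m) \<le> Max (a ` {..<m})" using m by (intro Max_ge) auto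
      ultimately show ?thesis using mult[of "n div m"] by (simp add: B_def)
    qed
    have bound: "a n / n \<le> a m / m + B / n" if "n \<ge> 1" for n
    proof -
      have "real (n div m * m) \<le> real n" by (rule of_nat_mono) simp
      then have "real (n div m) \<le> real n / m" using m by (simp add: field_simps)
      then have "real (n div m) * a m \<le> (real n / m) * a m"
        using nn[of m] by (rule mult_right_mono)
      then have "a n \<le> (real n / m) * a m + B" using B[of n] by linarith
      then have "a n / n \<le> ((real n / m) * a m + B) / n" by (rule divide_right_mono) simp
      also have "\<dots> = a m / m + B / n" using that by (simp add: field_simps)
      finally show ?thesis .
    qed
    obtain k where k: "real k > 2 * \<bar>B\<bar> / e" using reals_Archimedean2 by blast
    have "norm (a n / real n - L) < e" if n: "n \<ge> max k 1" for n
    proof -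
      have n1: "n \<ge> 1" "real n \<ge> real k" using n by auto
      have "a n / n \<ge> L" unfolding L_def using bdd n1 by (intro cInf_lower) auto
      moreover have "B / n < e / 2"
      proof -
        have "2 * \<bar>B\<bar> < real k * e" using k e by (simp add: pos_divide_less_eq)
        also have "\<dots> \<le> real n * e" using n1 e by (intro mult_right_mono) auto
        finally have "B < e / 2 * real n" by (simp add: mult.commute)
        then show ?thesis using n1 by (simp add: pos_divide_less_eq)
      qed
      ultimately have "0 \<le> a n / n - L \<and> a n / n - L < e"
        using bound[OF n1(1)] m(2) by linarith
      then show ?thesis by simp
    qed
    then show "\<exists>no. \<forall>n\<ge>no. norm (a n / real n - L) < e" by blast
  qed
  then show ?thesis by (auto simp: convergent_def)
qed

context normal
begin

abbreviation commH where "commH \<equiv> generate G (comm_set G H)"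

lemma commH_subgroup: "subgroup commH G"
  by (rule generate_is_subgroup[OF comm_set_carrier])

lemma commH_closed [intro]:
  "\<one> \<in> commH" "x \<in> commH \<Longrightarrow> y \<in> commH \<Longrightarrow> x \<otimes> y \<in> commH" "x \<in> commH \<Longrightarrow> inv x \<in> commH"
  "x \<in> commH \<Longrightarrow> x [^] (n::nat) \<in> commH"
  using commH_subgroup
  by (auto intro: subgroup.m_closed subgroup.one_closed subgroup.m_inv_closed)
     (induction n, auto intro: subgroup.m_closed subgroup.one_closed)

lemma commH_H: "x \<in> commH \<Longrightarrow> x \<in> H"
  by (auto simp: generate_comm_set mball_H)

lemma commH_carrier: "x \<in> commH \<Longrightarrow> x \<in> carrier G"
  using commH_H by auto

lemma mball_commH: "x \<in> mball G H n \<Longrightarrow> x \<in> commH"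
  by (auto simp: generate_comm_set)

text \<open>\<open>scl\<close> is defined through \<open>lim\<close> and carries information only
  once the limit exists; subadditivity of \<open>cl\<close> on powers and Fekete's lemma provide
  it.\<close>

lemma scl_LIMSEQ:
  assumes "y \<in> commH"
  shows "(\<lambda>n. real (cl G H (y [^] n)) / real n) \<longlonglongrightarrow> scl G H y"
proof -
  have "convergent (\<lambda>n. real (cl G H (y [^] n)) / real n)"
  proof (rule fekete)
    fix m n :: nat
    have "y [^] m \<otimes> y [^] n \<in> mball G H (cl G H (y [^] m) + cl G H (y [^] n))"
      using assms by (intro mball_mult mball_cl) auto
    then have "cl G H (y [^] (m + n)) \<le> cl G H (y [^] m) + cl G H (y [^] n)"
      using assms commH_carrier by (auto simp: nat_pow_mult intro: cl_le)
    then show "real (cl G H (y [^] (m + n))) \<le> real (cl G H (y [^] m)) + real (cl G H (y [^] n))"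
      by linarith
  qed simp
  then show ?thesis unfolding scl_def by (simp add: convergent_LIMSEQ_iff)
qed

lemma scl_LIMSEQ_subseq:
  assumes "y \<in> commH" "filterlim f at_top sequentially"
  shows "(\<lambda>n. real (cl G H (y [^] (f n))) / real (f n)) \<longlonglongrightarrow> scl G H y"
  using filterlim_compose[OF scl_LIMSEQ[OF assms(1)] assms(2)] .

text \<open>An upper bound along one unbounded family of exponents is enough. In the free group only
  the exponents \<open>Suc k ^ Suc j\<close> are accessible.\<close>

lemma scl_le:
  assumes y: "y \<in> commH" and f: "filterlim f at_top sequentially"
    and le: "\<And>n. y [^] (f n) \<in> mball G H (g n)"
    and lim: "(\<lambda>n. real (g n) / real (f n)) \<longlonglongrightarrow> L"
  shows "scl G H y \<le> L"
proof (rule LIMSEQ_le[OF scl_LIMSEQ_subseq[OF y f] lim])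
  show "\<exists>N. \<forall>n\<ge>N. real (cl G H (y [^] f n)) / real (f n) \<le> real (g n) / real (f n)"
    using cl_le[OF le] by (auto intro!: divide_right_mono)
qed

lemma scl_le_mball:
  assumes "y \<in> mball G H n"
  shows "scl G H y \<le> n"
proof (rule scl_le[OF mball_commH[OF assms], where f="\<lambda>k. k" and g="\<lambda>k. k * n"])
  show "y [^] k \<in> mball G H (k * n)" for k using assms by (rule mball_pow)
  show "(\<lambda>k. real (k * n) / real k) \<longlonglongrightarrow> real n"
    by (rule tendsto_eventually) (auto simp: eventually_sequentially intro!: exI[of _ 1])
qed (rule filterlim_ident)

lemma scl_nonneg: "y \<in> commH \<Longrightarrow> scl G H y \<ge> 0"
  by (rule LIMSEQ_le_const[OF scl_LIMSEQ]) auto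

lemma scl_pow:
  assumes y: "y \<in> commH"
  shows "scl G H (y [^] (m::nat)) = m * scl G H y"
proof (cases "m = 0")
  case True
  then show ?thesis using scl_le_mball[of \<one> 0] scl_nonneg[of \<one>] by (auto simp: mball_0)
next
  case False
  then have f: "filterlim (\<lambda>n. m * n) at_top sequentially"
    by (simp add: filterlim_at_top_mult_tendsto_pos mult_nat_left_at_top)
  have "(\<lambda>n. m * (real (cl G H (y [^] (m * n))) / real (m * n))) \<longlonglongrightarrow> m * scl G H y"
    by (intro tendsto_mult_left scl_LIMSEQ_subseq f y)
  also have "(\<lambda>n. m * (real (cl G H (y [^] (m * n))) / real (m * n))) =
      (\<lambda>n. real (cl G H ((y [^] m) [^] n)) / real n)"
    using False y commH_carrier by (auto simp: nat_pow_pow)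
  finally show ?thesis using LIMSEQ_unique scl_LIMSEQ[of "y [^] m"] y by blast
qed

text \<open>The summand 1 is the linear error of \<open>approx_mult_pow\<close> after division by
  the exponent.\<close>

lemma scl_mult:
  assumes x: "x \<in> commH" and y: "y \<in> commH"
  shows "scl G H (x \<otimes> y) \<le> scl G H x + scl G H y + 1"
proof (rule scl_le[where f="\<lambda>n. n" and g="\<lambda>n. cl G H (x [^] n) + cl G H (y [^] n) + n"])
  show "(x \<otimes> y) [^] n \<in> mball G H (cl G H (x [^] n) + cl G H (y [^] n) + n)" for n
  proof (rule approx_mball)
    show "x [^] n \<otimes> y [^] n \<in> mball G H (cl G H (x [^] n) + cl G H (y [^] n))"
      using x y by (intro mball_mult mball_cl) auto
    show "approx G H n (x [^] n \<otimes> y [^] n) ((x \<otimes> y) [^] n)"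
      using approx_sym[OF approx_mult_pow] x y commH_H commH_carrier by auto
  qed
  have "(\<lambda>n. real (cl G H (x [^] n)) / n + real (cl G H (y [^] n)) / n + real n / real n)
     \<longlonglongrightarrow> scl G H x + scl G H y + 1"
    by (intro tendsto_add scl_LIMSEQ x y tendsto_eventually)
       (auto simp: eventually_sequentially intro!: exI[of _ 1])
  then show "(\<lambda>n. real (cl G H (x [^] n) + cl G H (y [^] n) + n) / n) \<longlonglongrightarrow> scl G H x + scl G H y + 1"
    by (simp add: add_divide_distrib)
qed (use x y in \<open>auto intro: filterlim_ident\<close>)

lemma scl_approx:
  assumes "approx G H n u v" "u \<in> commH"
  shows "v \<in> commH" "scl G H v \<le> scl G H u + n + 1"
proof -
  have c: "u \<in> carrier G" "v \<in> carrier G" "inv u \<otimes> v \<in> mball G H n" using assms by (auto simp: approx_def)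
  then have v: "v = u \<otimes> (inv u \<otimes> v)" by (simp add: inv_cancel_left)
  have i: "inv u \<otimes> v \<in> commH" using mball_commH c by auto
  show "v \<in> commH" by (subst v) (use assms i in blast)
  show "scl G H v \<le> scl G H u + n + 1"
    by (subst v) (use scl_mult[OF assms(2) i] scl_le_mball[OF c(3)] in linarith)
qed

end

lemma (in group_hom) hom_scl:
  assumes N: "N \<lhd> G" "N' \<lhd> H" "h ` N \<subseteq> N'" and y: "y \<in> generate G (comm_set G N)"
  shows "h y \<in> generate H (comm_set H N')" "scl H N' (h y) \<le> scl G N y"
proof -
  interpret N: normal N G by fact
  interpret N': normal N' H by fact
  have yc: "y \<in> carrier G" using y N.commH_carrier by blast
  have b: "h y [^]\<^bsub>H\<^esub> n \<in> mball H N' (cl G N (y [^]\<^bsub>G\<^esub> n))" for n :: nat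
    using hom_mball[OF N N.mball_cl[of "y [^]\<^bsub>G\<^esub> n"]] y yc by (auto simp: hom_nat_pow)
  show hy: "h y \<in> N'.commH" using N'.mball_commH[OF b[of 1]] yc by simp
  show "scl H N' (h y) \<le> scl G N y"
    by (rule N'.scl_le[OF hy filterlim_ident b N.scl_LIMSEQ[OF y]])
qed

section \<open>Free groups\<close>

definition word_eval :: "('h, 'm) monoid_scheme \<Rightarrow> ('a \<Rightarrow> 'h) \<Rightarrow> ('a \<times> bool) list \<Rightarrow> 'h" where
  "word_eval H f w = mprod H (map (\<lambda>l. if snd l then f (fst l) else inv\<^bsub>H\<^esub> (f (fst l))) w)"

lemma word_eval_simps [simp]:
  "word_eval H f [] = \<one>\<^bsub>H\<^esub>"
  "word_eval H f (l # w) = (if snd l then f (fst l) else inv\<^bsub>H\<^esub> (f (fst l))) \<otimes>\<^bsub>H\<^esub> word_eval H f w"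
  by (simp_all add: word_eval_def)

lemma not_freely_reducedE:
  assumes "\<not> freely_reduced w"
  obtains u b e v where "w = u @ (b, e) # (b, \<not> e) # v"
proof -
  from assms obtain i where i: "Suc i < length w" "fst (w ! i) = fst (w ! Suc i)" "snd (w ! i) \<noteq> snd (w ! Suc i)"
    by (auto simp: freely_reduced_def)
  have "w = take i w @ w ! i # w ! Suc i # drop (Suc (Suc i)) w"
    using i(1) by (simp add: Cons_nth_drop_Suc)
  moreover have "w ! i = (fst (w ! i), snd (w ! i))" "w ! Suc i = (fst (w ! i), \<not> snd (w ! i))"
    using i by (auto simp: prod_eq_iff)
  ultimately show ?thesis using that by metis
qed

definition inv_word :: "('x \<times> bool) list \<Rightarrow> ('x \<times> bool) list" where
  "inv_word w = rev (map (\<lambda>l. (fst l, \<not> snd l)) w)"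

lemma set_inv_word [simp]: "fst ` set (inv_word w) = fst ` set w"
  by (force simp: inv_word_def image_iff)

context group
begin

lemma word_eval_closed [simp, intro]: "f ` fst ` set w \<subseteq> carrier G \<Longrightarrow> word_eval G f w \<in> carrier G"
  by (induction w) auto

lemma word_eval_append:
  "f ` fst ` set u \<subseteq> carrier G \<Longrightarrow> f ` fst ` set v \<subseteq> carrier G \<Longrightarrow>
   word_eval G f (u @ v) = word_eval G f u \<otimes> word_eval G f v"
  by (induction u) (auto simp: m_assoc)

lemma word_eval_cancel:
  assumes "f ` fst ` set (u @ (b, e) # (b, \<not> e) # v) \<subseteq> carrier G"
  shows "word_eval G f (u @ (b, e) # (b, \<not> e) # v) = word_eval G f (u @ v)"
proof -
  have "word_eval G f v \<in> carrier G" using assms by (intro word_eval_closed) auto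
  then show ?thesis using assms by (subst (1 2) word_eval_append) (auto simp: inv_cancel_left)
qed

lemma word_eval_inv_word:
  "f ` fst ` set w \<subseteq> carrier G \<Longrightarrow> word_eval G f (inv_word w) = inv (word_eval G f w)"
proof (induction w)
  case (Cons l w)
  have "inv_word (l # w) = inv_word w @ [(fst l, \<not> snd l)]" by (simp add: inv_word_def)
  then show ?case using Cons by (auto simp: word_eval_append inv_mult_group image_image[symmetric] simp del: image_image)
qed (simp add: inv_word_def)

end

text \<open>Freeness only excludes nonempty reduced words as relations. Any other word has an
  adjacent inverse pair; deleting it preserves both values and shortens the word, so every relation
  of \<open>F\<close> holds in \<open>H\<close>.\<close>

lemma word_eval_relation:
  assumes F: "free_group_on F B" and H: "group H" "f ` B \<subseteq> carrier H"
  shows "fst ` set w \<subseteq> B \<Longrightarrow> word_eval F (\<lambda>b. b) w = \<one>\<^bsub>F\<^esub> \<Longrightarrow> word_eval H f w = \<one>\<^bsub>H\<^esub>"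
proof (induction "length w" arbitrary: w rule: less_induct)
  case less
  interpret F: group F using F by (simp add: free_group_on_def)
  interpret H: group H by fact
  show ?case
  proof (cases "freely_reduced w")
    case True
    have "letter_val F = (\<lambda>l. if snd l then fst l else inv\<^bsub>F\<^esub> (fst l))"
      by (rule ext) (simp add: letter_val_def)
    then have "mprod F (map (letter_val F) w) = \<one>\<^bsub>F\<^esub>" using less.prems by (simp add: word_eval_def)
    then have "w = []" using True F less.prems(1) unfolding free_group_on_def set_map by blast
    then show ?thesis by simp
  next
    case False
    then obtain u b e v where w: "w = u @ (b, e) # (b, \<not> e) # v" by (rule not_freely_reducedE)
    have BF: "B \<subseteq> carrier F" using F by (simp add: free_group_on_def)
    have "word_eval F (\<lambda>b. b) (u @ v) = \<one>\<^bsub>F\<^esub>"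
      using less.prems w F.word_eval_cancel[of "\<lambda>b. b" u b e v] BF by (simp add: subset_iff)
    moreover have "word_eval H f w = word_eval H f (u @ v)"
      unfolding w by (rule H.word_eval_cancel) (use H(2) less.prems w in auto)
    ultimately show ?thesis using less.hyps[of "u @ v"] less.prems w by auto
  qed
qed

lemma free_group_word:
  assumes F: "free_group_on F B" and x: "x \<in> carrier F"
  shows "\<exists>w. fst ` set w \<subseteq> B \<and> word_eval F (\<lambda>b. b) w = x"
proof -
  interpret F: group F using F by (simp add: free_group_on_def)
  have BF: "B \<subseteq> carrier F" using F by (simp add: free_group_on_def)
  have "x \<in> generate F B" using F x by (simp add: free_group_on_def)
  then show ?thesis
  proof (induction rule: generate.induct)
    case one show ?case by (rule exI[of _ "[]"]) simp
  next
    case (incl h) then show ?case using BF by (intro exI[of _ "[(h, True)]"]) auto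
  next
    case (inv h) then show ?case using BF by (intro exI[of _ "[(h, False)]"]) auto
  next
    case (eng g h)
    then obtain u v where "fst ` set u \<subseteq> B" "word_eval F (\<lambda>b. b) u = g"
      "fst ` set v \<subseteq> B" "word_eval F (\<lambda>b. b) v = h" by auto
    then show ?case using BF F.word_eval_append[of "\<lambda>b. b" u v] by (intro exI[of _ "u @ v"]) auto
  qed
qed

text \<open>The map is evaluated on a chosen word for each element. If \<open>u\<close> and
  \<open>v\<close> have equal value, \<open>u @ inv_word v\<close> is a relation, so the choice is
  immaterial.\<close>

lemma free_group_extend:
  assumes F: "free_group_on F B" and H: "group H" "f ` B \<subseteq> carrier H"
  shows "\<exists>\<theta> \<in> hom F H. \<forall>b\<in>B. \<theta> b = f b"
proof -
  interpret F: group F using F by (simp add: free_group_on_def)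
  interpret H: group H by fact
  have BF: "B \<subseteq> carrier F" using F by (simp add: free_group_on_def)
  define wd where "wd x = (SOME w. fst ` set w \<subseteq> B \<and> word_eval F (\<lambda>b. b) w = x)" for x
  have wd: "fst ` set (wd x) \<subseteq> B \<and> word_eval F (\<lambda>b. b) (wd x) = x" if "x \<in> carrier F" for x
    unfolding wd_def by (rule someI_ex) (rule free_group_word[OF F that])
  define \<theta> where "\<theta> x = word_eval H f (wd x)" for x
  have B1: "(\<lambda>b. b) ` fst ` set w \<subseteq> carrier F" if "fst ` set w \<subseteq> B" for w :: "('a \<times> bool) list"
    using that BF by auto
  have B2: "f ` fst ` set w \<subseteq> carrier H" if "fst ` set w \<subseteq> B" for w using that H(2) by auto
  have eq: "word_eval H f u = word_eval H f v"
    if uv: "fst ` set u \<subseteq> B" "fst ` set v \<subseteq> B" "word_eval F (\<lambda>b. b) u = word_eval F (\<lambda>b. b) v" for u v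
  proof -
    have c: "fst ` set (u @ inv_word v) \<subseteq> B" using uv set_inv_word[of v] by (simp add: image_Un)
    have i: "fst ` set (inv_word v) \<subseteq> B" using uv by simp
    have "word_eval F (\<lambda>b. b) (u @ inv_word v) = \<one>\<^bsub>F\<^esub>"
      using uv(3) F.word_eval_closed[OF B1[OF uv(2)]]
      by (simp only: F.word_eval_append[OF B1[OF uv(1)] B1[OF i]] F.word_eval_inv_word[OF B1[OF uv(2)]] F.r_inv)
    then have "word_eval H f (u @ inv_word v) = \<one>\<^bsub>H\<^esub>" using word_eval_relation[OF F H c] by simp
    then have "word_eval H f u \<otimes>\<^bsub>H\<^esub> inv\<^bsub>H\<^esub> (word_eval H f v) = \<one>\<^bsub>H\<^esub>"
      using H.word_eval_append[OF B2[OF uv(1)] B2[OF i]] H.word_eval_inv_word[OF B2[OF uv(2)]] by simp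
    then show ?thesis using H.word_eval_closed[OF B2[OF uv(1)]] H.word_eval_closed[OF B2[OF uv(2)]]
      by (metis H.inv_equality H.inv_inv H.inv_closed)
  qed
  have "\<theta> \<in> hom F H"
  proof (rule homI)
    fix x y assume x: "x \<in> carrier F" and y: "y \<in> carrier F"
    note wx = wd[OF x, THEN conjunct1] and wy = wd[OF y, THEN conjunct1]
    show "\<theta> x \<in> carrier H" unfolding \<theta>_def using H.word_eval_closed[OF B2[OF wx]] .
    have "\<theta> (x \<otimes>\<^bsub>F\<^esub> y) = word_eval H f (wd x @ wd y)" unfolding \<theta>_def
    proof (rule eq)
      show "fst ` set (wd (x \<otimes>\<^bsub>F\<^esub> y)) \<subseteq> B" using wd x y by blast
      show "fst ` set (wd x @ wd y) \<subseteq> B" using wx wy by auto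
      show "word_eval F (\<lambda>b. b) (wd (x \<otimes>\<^bsub>F\<^esub> y)) = word_eval F (\<lambda>b. b) (wd x @ wd y)"
        using wd x y F.word_eval_append[OF B1[OF wx] B1[OF wy]] by simp
    qed
    then show "\<theta> (x \<otimes>\<^bsub>F\<^esub> y) = \<theta> x \<otimes>\<^bsub>H\<^esub> \<theta> y"
      unfolding \<theta>_def using H.word_eval_append[OF B2[OF wx] B2[OF wy]] by simp
  qed
  moreover have "\<theta> b = f b" if b: "b \<in> B" for b
  proof -
    have "\<theta> b = word_eval H f [(b, True)]" unfolding \<theta>_def
      by (rule eq) (use wd[of b] b BF in auto)
    then show ?thesis using b H(2) by auto
  qed
  ultimately show ?thesis by blast
qed

lemma hom_eq_on_generate:
  assumes "group F" "group H" "\<theta> \<in> hom F H" "\<eta> \<in> hom F H" "B \<subseteq> carrier F"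
    and "\<And>b. b \<in> B \<Longrightarrow> \<theta> b = \<eta> b" and "x \<in> generate F B"
  shows "\<theta> x = \<eta> x"
proof -
  interpret T: group_hom F H \<theta> using assms by (simp add: group_hom_def group_hom_axioms_def)
  interpret E: group_hom F H \<eta> using assms by (simp add: group_hom_def group_hom_axioms_def)
  show ?thesis using assms(7)
  proof (induction rule: generate.induct)
    case (inv h)
    then show ?case using assms(5,6) T.hom_inv[of h] E.hom_inv[of h] by auto
  next
    case (eng x y)
    then show ?case using T.G.generate_in_carrier[OF assms(5)] by simp
  qed (use assms in auto)
qed

section \<open>Power endomorphisms and stable commutator length in free groups\<close>

lemma (in comm_pair) approx_comm_pow:
  assumes a: "approx G (carrier G) l (a [^] (k::nat)) a'" and x: "x \<in> K" and c: "c \<in> H"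
    and that: "a \<in> carrier G"
  shows "approx G H (3 + 14 * l + m + 2 * k * m)
    (commutator G a' (x [^] (m::nat) \<otimes> c)) (commutator G a x [^] (k * m))"
proof -
  interpret A: normal "carrier G" G by (rule carrier_normal)
  have cr: "a' \<in> carrier G" "x \<in> carrier G" "c \<in> carrier G" using a x c by auto
  have xm: "x [^] m \<in> K" by (induction m) (use x in auto)
  define d where "d = inv (a [^] k) \<otimes> a'"
  have d: "d \<in> mball G (carrier G) l" "d \<in> carrier G" "a' = a [^] k \<otimes> d"
    using a that cr by (auto simp: d_def approx_def inv_cancel_left)
  let ?y = "x [^] m"
  have y: "?y \<in> carrier G" using cr by auto
  have s1: "approx G H 1 (commutator G a' (?y \<otimes> c)) (commutator G a' ?y)"
    using cr y c by (intro approx_comm_right_H)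
  have s2: "approx G H 2 (commutator G a' ?y) (commutator G (a [^] k) ?y \<otimes> commutator G d ?y)"
    unfolding d(3) using that xm d by (intro approx_comm_left) auto
  have "approx G H (14 * l) \<one> (commutator G d ?y)"
    using mball_comm_derived[OF d(1) xm] by (simp add: approx_one_iff)
  then have s3: "approx G H (0 + 14 * l) (commutator G (a [^] k) ?y \<otimes> commutator G d ?y) (commutator G (a [^] k) ?y \<otimes> \<one>)"
    using that y by (intro approx_mult approx_refl approx_sym[where u=\<one>]) auto
  have s4: "approx G H m (commutator G (a [^] k) ?y) (commutator G (a [^] k) x [^] m)"
    using that x by (intro approx_comm_pow_right) auto
  have s5: "approx G H (m * (2 * k)) (commutator G (a [^] k) x [^] m) ((commutator G a x [^] k) [^] m)"
    using that x by (intro approx_pow approx_comm_pow_left) auto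
  have "approx G H (1 + (2 + ((0 + 14 * l) + (m + m * (2 * k))))) (commutator G a' (?y \<otimes> c)) ((commutator G a x [^] k) [^] m)"
    by (intro approx_trans[OF s1] approx_trans[OF s2] approx_trans[OF s3] )
       (use approx_trans[OF s4 s5] that y in simp)
  then have "approx G H (3 + 14 * l + m + 2 * k * m) (commutator G a' (?y \<otimes> c)) ((commutator G a x [^] k) [^] m)"
    by (rule approx_mono) simp
  then show ?thesis using that cr by (simp add: nat_pow_pow)
qed

lemma (in group) comm_pair_lcs:
  assumes "j \<ge> 1"
  shows "comm_pair (lcs G (Suc j)) G (lcs G j)"
  by (intro comm_pair.intro comm_pair_axioms.intro lcs_normal commutator_in_lcs assms)

locale power_endos =
  fixes F :: "('a, 'm) monoid_scheme" (structure) and B :: "'a set" and e :: "nat \<Rightarrow> 'a \<Rightarrow> 'a"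
  assumes free: "free_group_on F B"
    and e_hom: "e k \<in> hom F F" and e_B: "b \<in> B \<Longrightarrow> e k b = b [^]\<^bsub>F\<^esub> k"
begin

sublocale group F using free by (simp add: free_group_on_def)

lemma B_carrier: "B \<subseteq> carrier F" and B_generates: "generate F B = carrier F"
  using free by (simp_all add: free_group_on_def)

sublocale e: group_hom F F "e k" for k
  by (simp add: group_hom_def group_hom_axioms_def e_hom group_axioms)

text \<open>On the abelianization \<open>e k\<close> is multiplication by \<open>k\<close>. The
  error is linear in \<open>k\<close> because splitting the power of a product costs
  \<open>k\<close> commutators.\<close>

lemma e_approx_linear:
  assumes "a \<in> carrier F"
  shows "\<exists>L. \<forall>k. approx F (carrier F) (L * k) (a [^] k) (e k a)"
proof -
  interpret A: normal "carrier F" F by (rule carrier_normal)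
  have "a \<in> generate F B" using assms B_generates by simp
  then show ?thesis
  proof (induction rule: generate.induct)
    case one then show ?case by auto
  next
    case (incl b) then show ?case using B_carrier by (intro exI[of _ 0]) (auto simp: e_B)
  next
    case (inv b)
    then have b: "b \<in> carrier F" using B_carrier by auto
    then have "inv b [^] k = e k (inv b)" for k using inv by (simp add: e_B nat_pow_inv)
    then show ?case using b by (metis A.approx_refl e.hom_closed inv_closed)
  next
    case (eng a b)
    then have c: "a \<in> carrier F" "b \<in> carrier F" using B_generates by auto
    from eng obtain L M where L: "\<And>k. approx F (carrier F) (L * k) (a [^] k) (e k a)"
      and M: "\<And>k. approx F (carrier F) (M * k) (b [^] k) (e k b)" by auto
    have "approx F (carrier F) (k + (L * k + M * k)) ((a \<otimes> b) [^] k) (e k (a \<otimes> b))" for k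
      using A.approx_trans[OF A.approx_mult_pow[OF c, of k] A.approx_mult[OF L[of k] M[of k]]] c by simp
    then show ?case by (intro exI[of _ "1 + L + M"]) (simp add: algebra_simps)
  qed
qed

text \<open>The length \<open>n\<close> is absent from the bound: the correction \<open>c\<close>
  only has to lie in \<open>lcs F (Suc j)\<close> to be absorbed by one commutator. Hence the level
  \<open>j\<close> enters without any uniform estimate.\<close>

lemma e_approx_comm:
  assumes "j \<ge> 1" "x \<in> lcs F j" "a \<in> carrier F"
    "approx F (carrier F) l (a [^] k) (e k a)" "approx F (lcs F j) n (x [^] (k ^ j)) (e k x)"
  shows "approx F (lcs F (Suc j)) (3 + 14 * l + 3 * k ^ Suc j) (commutator F a x [^] (k ^ Suc j)) (e k (commutator F a x))"
proof -
  interpret CP: comm_pair "lcs F (Suc j)" F "lcs F j" by (rule comm_pair_lcs[OF assms(1)])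
  define c where "c = inv (x [^] (k ^ j)) \<otimes> e k x"
  have xc: "x \<in> carrier F" using assms by auto
  have "c \<in> mball F (lcs F j) n" using assms by (simp add: c_def approx_def)
  then have "c \<in> lcs F (Suc j)" using CP.K.mball_commH lcs_Suc[OF assms(1)] by simp
  moreover have "e k x = x [^] (k ^ j) \<otimes> c" using xc by (simp add: c_def inv_cancel_left)
  ultimately have "approx F (lcs F (Suc j)) (3 + 14 * l + k ^ j + 2 * k * k ^ j)
      (commutator F (e k a) (e k x)) (commutator F a x [^] (k * k ^ j))"
    using CP.approx_comm_pow[OF assms(4,2) _ assms(3)] by simp
  moreover have "k ^ j \<le> k ^ Suc j" using assms(1) by (cases "k = 0") auto
  then have "3 + 14 * l + k ^ j + 2 * k * k ^ j \<le> 3 + 14 * l + 3 * k ^ Suc j" by simp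
  ultimately have "approx F (lcs F (Suc j)) (3 + 14 * l + 3 * k ^ Suc j)
      (commutator F (e k a) (e k x)) (commutator F a x [^] (k * k ^ j))"
    using CP.approx_mono by blast
  then show ?thesis using CP.approx_sym assms xc by (simp add: e.hom_commutator)
qed

text \<open>Modulo \<open>lcs F (Suc j)\<close>, \<open>e k\<close> acts on \<open>lcs F j\<close>
  as multiplication by \<open>k ^ j\<close>. How \<open>n\<close> depends on \<open>k\<close> is
  irrelevant for \<open>e_approx_comm\<close>.\<close>

lemma e_approx_lcs:
  assumes "j \<ge> 1" "x \<in> lcs F j"
  shows "\<exists>n. approx F (lcs F j) n (x [^] (k ^ j)) (e k x)"
  using assms
proof (induction j arbitrary: x rule: dec_induct)
  case base
  then show ?case using e_approx_linear[of x] by auto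
next
  case (step j)
  interpret N: normal "lcs F (Suc j)" F by (rule lcs_normal)
  have j: "j \<ge> 1" using step by simp
  let ?S = "comm_set F (lcs F j)"
  have S: "?S \<subseteq> carrier F" by (intro comm_set_subset lcs_subset)
  have S2: "generate F ?S = lcs F (Suc j)" by (simp only: lcs_Suc[OF j])
  have gen: "\<exists>n. approx F (lcs F (Suc j)) n (y [^] (k ^ Suc j)) (e k y)" if "y \<in> ?S" for y
  proof -
    from that obtain a b where ab: "y = commutator F a b" "a \<in> carrier F" "b \<in> lcs F j"
      by (auto simp: comm_set_def)
    obtain n where n: "approx F (lcs F j) n (b [^] (k ^ j)) (e k b)" using step.IH ab by blast
    obtain l where l: "approx F (carrier F) l (a [^] k) (e k a)" using e_approx_linear ab by blast
    show ?thesis using e_approx_comm[OF j ab(3,2) l n] ab(1) by blast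
  qed
  have "x \<in> generate F ?S" using step.prems S2 by simp
  then show ?case
  proof (induction rule: generate.induct)
    case one then show ?case by (auto simp del: lcs.simps)
  next
    case (incl y) then show ?case by (rule gen)
  next
    case (inv y)
    then have "y \<in> carrier F" using S by auto
    then show ?case using gen[OF inv] N.approx_inv by (auto simp: nat_pow_inv simp del: lcs.simps)
  next
    case (eng y z)
    then have c: "y \<in> carrier F" "z \<in> carrier F" "y \<in> lcs F (Suc j)"
      using generate_in_carrier[OF S] S2 by auto
    from eng obtain n m where nm: "approx F (lcs F (Suc j)) n (y [^] (k ^ Suc j)) (e k y)"
      "approx F (lcs F (Suc j)) m (z [^] (k ^ Suc j)) (e k z)" by blast
    show ?case
      using N.approx_trans[OF N.approx_mult_pow[OF c(3,2)] N.approx_mult[OF nm]] c by auto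
  qed
qed

text \<open>Each letter costs \<open>3 * k ^ Suc j\<close> by \<open>e_approx_comm\<close>, and
  separating its power from that of the remaining word costs \<open>k ^ Suc j\<close> more; this
  gives the factor 4. The remainder depends on \<open>x\<close> through \<open>A\<close> but is
  linear in \<open>k\<close>, hence of lower order as \<open>j \<ge> 1\<close>.\<close>

lemma e_approx_mball:
  assumes j: "j \<ge> 1" and x: "x \<in> mball F (lcs F j) n"
  shows "\<exists>A. \<forall>k. approx F (lcs F (Suc j)) (4 * n * k ^ Suc j + A * Suc k) (x [^] (k ^ Suc j)) (e k x)"
proof -
  interpret N: normal "lcs F (Suc j)" F by (rule lcs_normal)
  interpret K: normal "lcs F j" F by (rule lcs_normal)
  have letter: "\<exists>A. \<forall>k. approx F (lcs F (Suc j)) (3 * k ^ Suc j + A * Suc k) (c [^] (k ^ Suc j)) (e k c)"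
    if c: "c \<in> comm_set F (lcs F j)" for c
  proof -
    from c obtain a b where ab: "c = commutator F a b" "a \<in> carrier F" "b \<in> lcs F j"
      by (auto simp: comm_set_def)
    obtain L where L: "\<And>k. approx F (carrier F) (L * k) (a [^] k) (e k a)" using e_approx_linear ab by blast
    have "approx F (lcs F (Suc j)) (3 * k ^ Suc j + (3 + 14 * L) * Suc k) (c [^] (k ^ Suc j)) (e k c)" for k
    proof -
      obtain n where n: "approx F (lcs F j) n (b [^] (k ^ j)) (e k b)" using e_approx_lcs[OF j ab(3)] by blast
      show ?thesis
        using N.approx_mono[OF e_approx_comm[OF j ab(3,2) L n]] ab(1) by (simp add: algebra_simps)
    qed
    then show ?thesis by blast
  qed
  show ?thesis using x
  proof (induction rule: K.mball_induct)
    case one then show ?case by (auto simp del: lcs.simps)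
  next
    case (step n c y)
    have cc: "c \<in> carrier F" "y \<in> carrier F" using step K.letters_carrier K.mball_carrier by auto
    have cN: "c \<in> lcs F (Suc j)"
      using K.mball_commH[OF K.mball_letter[OF step(1)]] lcs_Suc[OF j] by simp
    have "\<exists>A. \<forall>k. approx F (lcs F (Suc j)) (3 * k ^ Suc j + A * Suc k) (c [^] (k ^ Suc j)) (e k c)"
    proof (cases "c \<in> comm_set F (lcs F j)")
      case False
      then obtain d where d: "d \<in> comm_set F (lcs F j)" "c = inv d" using step(1) by (auto simp: K.letters_def)
      then have "d \<in> carrier F" using K.comm_set_carrier by auto
      then show ?thesis using letter[OF d(1)] d(2) N.approx_inv by (fastforce simp: nat_pow_inv simp del: lcs.simps)
    qed (rule letter)
    then obtain A1 where A1: "\<And>k. approx F (lcs F (Suc j)) (3 * k ^ Suc j + A1 * Suc k) (c [^] (k ^ Suc j)) (e k c)"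
      by blast
    from step obtain A2 where
      A2: "\<And>k. approx F (lcs F (Suc j)) (4 * n * k ^ Suc j + A2 * Suc k) (y [^] (k ^ Suc j)) (e k y)" by blast
    have "approx F (lcs F (Suc j)) (4 * Suc n * k ^ Suc j + (A1 + A2) * Suc k) ((c \<otimes> y) [^] (k ^ Suc j)) (e k (c \<otimes> y))" for k
    proof -
      have "approx F (lcs F (Suc j)) (k ^ Suc j + ((3 * k ^ Suc j + A1 * Suc k) + (4 * n * k ^ Suc j + A2 * Suc k)))
          ((c \<otimes> y) [^] (k ^ Suc j)) (e k c \<otimes> e k y)"
        by (rule N.approx_trans[OF N.approx_mult_pow[OF cN cc(2)] N.approx_mult[OF A1 A2]])
      then show ?thesis using cc by (simp add: algebra_simps del: lcs.simps)
    qed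
    then show ?case by blast
  qed
qed

text \<open>The endomorphism \<open>e k\<close> does not increase commutator length, but it multiplies elements of
  \<open>lcs F (Suc j)\<close> essentially by \<open>k ^ Suc j\<close>; dividing by this factor removes the dependence on the length
  of \<open>x\<close> with respect to \<open>lcs F (Suc j)\<close>.\<close>
lemma scl_le_mball_lcs:
  assumes j: "j \<ge> 1" and x: "x \<in> mball F (lcs F j) n" "x \<in> lcs F (Suc (Suc j))"
  shows "scl F (lcs F (Suc j)) x \<le> 4 * n"
proof -
  interpret N: normal "lcs F (Suc j)" F by (rule lcs_normal)
  have xN: "x \<in> N.commH" using x lcs_Suc[of "Suc j"] by simp
  obtain A where A: "\<And>k. approx F (lcs F (Suc j)) (4 * n * k ^ Suc j + A * Suc k) (x [^] (k ^ Suc j)) (e k x)"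
    using e_approx_mball[OF j x(1)] by blast
  define c where "c = cl F (lcs F (Suc j)) x"
  \<comment> \<open>Shifting \<open>k\<close> by one keeps the denominators positive.\<close>
  let ?f = "\<lambda>k. Suc k ^ Suc j" and ?g = "\<lambda>k. c + (4 * n * Suc k ^ Suc j + A * Suc (Suc k))"
  have g: "x [^] ?f k \<in> mball F (lcs F (Suc j)) (?g k)" for k
  proof -
    have "e (Suc k) x \<in> mball F (lcs F (Suc j)) c"
      unfolding c_def by (rule e.hom_mball[OF lcs_normal lcs_normal e.hom_lcs N.mball_cl[OF xN]])
    then show ?thesis using N.approx_mball[OF N.approx_sym[OF A]] by blast
  qed
  have "(\<lambda>k. real (?g k) / real (?f k)) \<longlonglongrightarrow> real (4 * n) + 0"
  proof (rule tendsto_sandwich)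
    show "\<forall>\<^sub>F k in sequentially. real (4 * n) \<le> real (?g k) / real (?f k)"
    proof (rule always_eventually, rule allI)
      fix k
      have "real (4 * n) * real (?f k) \<le> real (?g k)" by (simp only: of_nat_mult[symmetric] of_nat_le_iff)
      then show "real (4 * n) \<le> real (?g k) / real (?f k)"
        by (subst pos_le_divide_eq) (simp_all only: of_nat_0_less_iff zero_less_power zero_less_Suc)
    qed
    show "\<forall>\<^sub>F k in sequentially. real (?g k) / real (?f k) \<le> real (4 * n) + real (c + 2 * A) / real (Suc k)"
    proof (rule always_eventually, rule allI)
      fix k
      have kj: "Suc k \<le> Suc k ^ j" using j by (intro self_le_power) auto
      have "c + A * Suc (Suc k) \<le> (c + 2 * A) * Suc k" by (simp add: algebra_simps)
      also have "\<dots> \<le> (c + 2 * A) * Suc k ^ j" using kj by (intro mult_left_mono) auto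
      finally have "?g k \<le> 4 * n * ?f k + (c + 2 * A) * Suc k ^ j" by linarith
      then have "real (?g k) \<le> real (4 * n) * real (?f k) + real (c + 2 * A) * real (Suc k ^ j)"
        by (simp only: of_nat_mult[symmetric] of_nat_add[symmetric] of_nat_le_iff)
      then have "real (?g k) / real (?f k) \<le> (real (4 * n) * real (?f k) + real (c + 2 * A) * real (Suc k ^ j)) / real (?f k)"
        by (rule divide_right_mono) simp
      also have "\<dots> = real (4 * n) + real (c + 2 * A) / real (Suc k)"
      proof -
        have *: "(N * (s * P) + C * P) / (s * P) = N + C / s" if "s > 0" "P > 0" for N s P C :: real
          using that by (simp add: field_simps)
        have "real (?f k) = real (Suc k) * real (Suc k ^ j)" by (simp only: power_Suc of_nat_mult)
        then show ?thesis using *[of "real (Suc k)" "real (Suc k ^ j)"] by (simp only:) simp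
      qed
      finally show "real (?g k) / real (?f k) \<le> real (4 * n) + real (c + 2 * A) / real (Suc k)" .
    qed
    show "(\<lambda>k. real (4 * n) + real (c + 2 * A) / real (Suc k)) \<longlonglongrightarrow> real (4 * n) + 0"
      by (intro tendsto_add tendsto_const LIMSEQ_Suc lim_const_over_n)
  qed auto
  moreover have "filterlim ?f at_top sequentially"
  proof (rule filterlim_at_top_mono[OF filterlim_ident])
    show "\<forall>\<^sub>F k in sequentially. k \<le> ?f k"
    proof (rule always_eventually, rule allI)
      fix k
      have "Suc k \<le> ?f k" by (rule self_le_power) auto
      then show "k \<le> ?f k" by (rule Suc_leD)
    qed
  qed
  ultimately show ?thesis using N.scl_le[OF xN _ g] by simp
qed

text \<open>The bound by \<open>4 * n\<close> is applied to all powers of \<open>x\<close>; division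
  by the exponent and passage to the limit replace \<open>cl\<close> by \<open>scl\<close>.\<close>

lemma scl_lcs_Suc:
  assumes j: "j \<ge> 1" and x: "x \<in> lcs F (Suc (Suc j))"
  shows "scl F (lcs F (Suc j)) x \<le> 4 * scl F (lcs F j) x"
proof -
  interpret N: normal "lcs F (Suc j)" F by (rule lcs_normal)
  interpret K: normal "lcs F j" F by (rule lcs_normal)
  have xN: "x \<in> N.commH" using x lcs_Suc[of "Suc j"] by simp
  have xK: "x \<in> K.commH" using x lcs_Suc[OF j] lcs_Suc_subset[of "Suc j"] by auto
  show ?thesis
  proof (rule LIMSEQ_le_const[OF tendsto_mult_left[OF K.scl_LIMSEQ[OF xK]]], rule exI[of _ 1], intro allI impI)
    fix m :: nat assume m: "1 \<le> m"
    have "scl F (lcs F (Suc j)) (x [^] m) \<le> 4 * cl F (lcs F j) (x [^] m)"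
      by (intro scl_le_mball_lcs j K.mball_cl K.commH_closed xK lcs_pow x)
    then have "m * scl F (lcs F (Suc j)) x \<le> 4 * cl F (lcs F j) (x [^] m)"
      by (simp add: N.scl_pow[OF xN])
    then show "scl F (lcs F (Suc j)) x \<le> 4 * (real (cl F (lcs F j) (x [^] m)) / real m)"
      using m by (simp add: field_simps)
  qed
qed

text \<open>Each step down the series loses a factor 4, until \<open>lcs F 1\<close>, the whole
  group. The base case has a factor 4 to spare.\<close>

lemma scl_lcs_le_scl:
  assumes "j \<ge> 1" "x \<in> lcs F (Suc j)"
  shows "scl F (lcs F j) x \<le> 4 ^ j * scl F (carrier F) x"
  using assms
proof (induction j rule: dec_induct)
  case base
  interpret A: normal "carrier F" F by (rule carrier_normal)
  have "scl F (carrier F) x \<ge> 0" using base lcs_Suc[of 1] by (intro A.scl_nonneg) simp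
  then show ?case by simp
next
  case (step j)
  have "x \<in> lcs F (Suc j)" using step.prems lcs_Suc_subset by blast
  then show ?case using step scl_lcs_Suc[of j x] by (simp del: lcs.simps)
qed

end

theorem free_group_scl_lcs:
  assumes F: "free_group_on F B" and j: "j \<ge> 1" and x: "x \<in> lcs F (Suc j)"
  shows "scl F (lcs F j) x \<le> 4 ^ j * scl F (carrier F) x"
proof -
  interpret group F using F by (simp add: free_group_on_def)
  have "B \<subseteq> carrier F" using F by (simp add: free_group_on_def)
  then have "\<forall>k::nat. \<exists>\<theta>. \<theta> \<in> hom F F \<and> (\<forall>b\<in>B. \<theta> b = b [^]\<^bsub>F\<^esub> k)"
  proof (intro allI)
    fix k :: nat
    have "(\<lambda>b. b [^]\<^bsub>F\<^esub> k) ` B \<subseteq> carrier F" using \<open>B \<subseteq> carrier F\<close> by auto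
    from free_group_extend[OF F group_axioms this]
    show "\<exists>\<theta>. \<theta> \<in> hom F F \<and> (\<forall>b\<in>B. \<theta> b = b [^]\<^bsub>F\<^esub> k)" by (simp only: Bex_def)
  qed
  then obtain e where "\<And>k::nat. e k \<in> hom F F" "\<And>k b. b \<in> B \<Longrightarrow> e k b = b [^]\<^bsub>F\<^esub> k"
    by metis
  then interpret power_endos F B e by unfold_locales (use F in auto)
  show ?thesis by (rule scl_lcs_le_scl[OF j x])
qed

section \<open>The Magnus expansion\<close>

text \<open>Noncommutative power series with integer coefficients are represented by their coefficient
  functions on words; \<open>conv\<close> is their product.\<close>
fun conv :: "(nat list \<Rightarrow> int) \<Rightarrow> (nat list \<Rightarrow> int) \<Rightarrow> nat list \<Rightarrow> int" where
  "conv f g [] = f [] * g []"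
| "conv f g (x # w) = f [] * g (x # w) + conv (\<lambda>u. f (x # u)) g w"

definition unit_series :: "nat list \<Rightarrow> int" where
  "unit_series w = (if w = [] then 1 else 0)"

lemma conv_linear_left: "conv (\<lambda>u. a * f u + f' u) g w = a * conv f g w + conv f' g w"
  by (induction w arbitrary: f f') (simp_all add: algebra_simps)

lemma conv_zero_left: "conv (\<lambda>u. 0) g w = 0"
  by (induction w) simp_all

lemma conv_assoc: "conv (conv f g) h w = conv f (conv g h) w"
proof (induction w arbitrary: f g)
  case (Cons x w)
  have "conv (conv f g) h (x # w) = f [] * g [] * h (x # w) +
      conv (\<lambda>u. f [] * g (x # u) + conv (\<lambda>u. f (x # u)) g u) h w"
    by simp
  also have "\<dots> = f [] * conv g h (x # w) + conv (\<lambda>u. f (x # u)) (conv g h) w"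
    using Cons.IH[of "\<lambda>u. f (x # u)" g] by (simp add: conv_linear_left algebra_simps)
  finally show ?case by simp
qed simp

lemma conv_unit_left: "conv unit_series g = g"
proof
  show "conv unit_series g w = g w" for w
    by (cases w) (simp_all add: unit_series_def conv_zero_left)
qed

lemma conv_sum: "conv f g w = (\<Sum>i\<le>length w. f (take i w) * g (drop i w))"
proof (induction w arbitrary: f)
  case (Cons x w)
  have "(\<Sum>i\<le>length (x # w). f (take i (x # w)) * g (drop i (x # w))) =
      f [] * g (x # w) + (\<Sum>i\<le>length w. f (take (Suc i) (x # w)) * g (drop (Suc i) (x # w)))"
    by (simp only: list.size sum.atMost_Suc_shift add_Suc_right add_0_right take_0 drop_0)
  then show ?case using Cons[of "\<lambda>u. f (x # u)"] by simp
qed simp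

lemma conv_mid:
  assumes "w \<noteq> []" "f [] = 1" "g [] = 1"
  shows "conv f g w = f w + g w + (\<Sum>i\<in>{1..<length w}. f (take i w) * g (drop i w))"
proof -
  obtain n where n: "length w = Suc n" using assms(1) by (cases w) auto
  have "{..length w} = insert 0 (insert (length w) {1..<length w})" using n by auto
  then show ?thesis unfolding conv_sum using assms n by simp
qed

lemma conv_ends:
  assumes "w \<noteq> []" "f [] = 1" "g [] = 1"
    and "\<And>i. 0 < i \<Longrightarrow> i < length w \<Longrightarrow> f (take i w) * g (drop i w) = 0"
  shows "conv f g w = f w + g w"
  unfolding conv_mid[of w f g, OF assms(1-3)] using assms(4) by (subst sum.neutral) auto

function left_inverse :: "(nat list \<Rightarrow> int) \<Rightarrow> nat list \<Rightarrow> int" where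
  "left_inverse f w = (if w = [] then 1 else - (\<Sum>i<length w. left_inverse f (take i w) * f (drop i w)))"
  by pat_completeness auto
termination by (relation "measure (\<lambda>(f, w). length w)") auto

declare left_inverse.simps [simp del]

lemma conv_left_inverse:
  assumes "f [] = 1"
  shows "conv (left_inverse f) f = unit_series"
proof
  fix w
  show "conv (left_inverse f) f w = unit_series w"
  proof (cases "w = []")
    case False
    have "{..length w} = insert (length w) {..<length w}" by auto
    then have "conv (left_inverse f) f w = left_inverse f w + (\<Sum>i<length w. left_inverse f (take i w) * f (drop i w))"
      unfolding conv_sum using assms by simp
    then show ?thesis using False left_inverse.simps[of f w] by (simp add: unit_series_def)
  qed (simp add: assms unit_series_def left_inverse.simps)
qed

definition magnus_group :: "(nat list \<Rightarrow> int) monoid" where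
  "magnus_group = \<lparr>carrier = {f. f [] = 1}, monoid.mult = conv, one = unit_series\<rparr>"

lemma magnus_simps [simp]:
  "f \<in> carrier magnus_group \<longleftrightarrow> f [] = 1"
  "f \<otimes>\<^bsub>magnus_group\<^esub> g = conv f g" "\<one>\<^bsub>magnus_group\<^esub> = unit_series"
  by (simp_all add: magnus_group_def)

lemma group_magnus: "group magnus_group"
proof (rule groupI)
  fix x assume "x \<in> carrier magnus_group"
  then show "\<exists>y\<in>carrier magnus_group. y \<otimes>\<^bsub>magnus_group\<^esub> x = \<one>\<^bsub>magnus_group\<^esub>"
    by (intro bexI[of _ "left_inverse x"]) (auto simp: conv_left_inverse left_inverse.simps)
qed (auto simp: conv_assoc conv_unit_left fun_eq_iff unit_series_def)

interpretation M: group magnus_group by (rule group_magnus)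

text \<open>The congruence subgroup of series that equal 1 up to terms of order at least
  \<open>n\<close>.\<close>

definition low :: "nat \<Rightarrow> (nat list \<Rightarrow> int) set" where
  "low n = {f. f [] = 1 \<and> (\<forall>w. w \<noteq> [] \<longrightarrow> length w < n \<longrightarrow> f w = 0)}"

lemma lowD: "f \<in> low n \<Longrightarrow> f [] = 1" "f \<in> low n \<Longrightarrow> w \<noteq> [] \<Longrightarrow> length w < n \<Longrightarrow> f w = 0"
  by (auto simp: low_def)

lemma low_1: "f \<in> low (Suc 0) \<longleftrightarrow> f [] = 1"
  by (auto simp: low_def)

text \<open>Every mixed term has a left factor of positive degree below \<open>n\<close>, so
  coefficients up to degree \<open>n\<close> add. This makes them homomorphisms on
  \<open>low n\<close>.\<close>

lemma conv_low:
  assumes "f \<in> low n" "g \<in> low n" "w \<noteq> []" "length w \<le> n"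
  shows "conv f g w = f w + g w"
proof -
  have "f (take i w) * g (drop i w) = 0" if "0 < i" "i < length w" for i
    using lowD(2)[OF assms(1), of "take i w"] that assms by auto
  then show ?thesis using lowD(1)[OF assms(1)] lowD(1)[OF assms(2)] assms(3) by (intro conv_ends)
qed

lemma low_closed:
  assumes "f \<in> low n" "g \<in> low n"
  shows "conv f g \<in> low n"
  using assms conv_low[OF assms] by (auto simp: low_def)

lemma inv_low:
  assumes f: "f \<in> low n"
  shows "inv\<^bsub>magnus_group\<^esub> f \<in> low n" "w \<noteq> [] \<Longrightarrow> length w \<le> n \<Longrightarrow> (inv\<^bsub>magnus_group\<^esub> f) w = - f w"
proof -
  let ?g = "inv\<^bsub>magnus_group\<^esub> f"
  have fc: "f \<in> carrier magnus_group" using f lowD by simp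
  then have g1: "?g [] = 1" using M.inv_closed[OF fc] by simp
  have gf: "conv ?g f = unit_series" using M.l_inv[OF fc] by simp
  have main: "?g w = - f w" if "w \<noteq> []" "length w \<le> n" for w
  proof -
    have "?g (take i w) * f (drop i w) = 0" if "0 < i" "i < length w" for i
      using lowD(2)[OF f, of "drop i w"] that \<open>length w \<le> n\<close> by auto
    then have "conv ?g f w = ?g w + f w" using that(1) g1 lowD(1)[OF f] by (intro conv_ends)
    then show ?thesis using gf that by (simp add: unit_series_def)
  qed
  show "?g \<in> low n" using main lowD[OF f] g1 by (auto simp: low_def)
  show "w \<noteq> [] \<Longrightarrow> length w \<le> n \<Longrightarrow> ?g w = - f w" by (rule main)
qed

lemma conv_low_low:
  assumes f: "f \<in> low m" and g: "g \<in> low n" and mn: "m \<ge> 1" "n \<ge> 1" and w: "w \<noteq> []" "length w \<le> m + n"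
  shows "conv f g w = f w + g w + (if length w = m + n then f (take m w) * g (drop m w) else 0)"
proof -
  have "f (take i w) * g (drop i w) = (if i = m then (if length w = m + n then f (take m w) * g (drop m w) else 0) else 0)"
    if "i \<in> {1..<length w}" for i
  proof -
    consider "i < m" | "i = m" "length w < m + n" | "i = m" "length w = m + n" | "i > m" using w by linarith
    then show ?thesis
    proof cases
      case 1 then show ?thesis using lowD(2)[OF f, of "take i w"] that w(1) by auto
    next
      case 2 then show ?thesis using lowD(2)[OF g, of "drop i w"] that by auto
    next
      case 4 then show ?thesis using lowD(2)[OF g, of "drop i w"] that w by auto
    qed simp
  qed
  then have "(\<Sum>i\<in>{1..<length w}. f (take i w) * g (drop i w)) =
    (\<Sum>i\<in>{1..<length w}. if i = m then (if length w = m + n then f (take m w) * g (drop m w) else 0) else 0)"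
    by (rule sum.cong[OF refl])
  also have "\<dots> = (if length w = m + n then f (take m w) * g (drop m w) else 0)"
    using mn by (auto simp: sum.delta)
  finally show ?thesis using conv_mid[of w f g] w lowD f g by simp
qed

text \<open>Coefficients are compared in \<open>[f, g] g f = f g\<close>, which avoids computing
  inverses. The lowest part of a commutator is the Lie bracket of the lowest parts of its
  entries.\<close>

lemma commutator_low:
  assumes f: "f \<in> low m" and g: "g \<in> low n" and mn: "m \<ge> 1" "n \<ge> 1"
  shows "commutator magnus_group f g \<in> low (m + n)"
    and "length w = m + n \<Longrightarrow>
      commutator magnus_group f g w = f (take m w) * g (drop m w) - g (take n w) * f (drop n w)"
proof -
  let ?c = "commutator magnus_group f g"
  define P where "P = conv g f"
  have fg: "f \<in> carrier magnus_group" "g \<in> carrier magnus_group" using f g lowD by auto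
  have c1: "?c [] = 1" using M.commutator_closed[OF fg] by simp
  have P1: "P [] = 1" by (simp add: P_def lowD(1)[OF f] lowD(1)[OF g])
  have "?c \<otimes>\<^bsub>magnus_group\<^esub> (g \<otimes>\<^bsub>magnus_group\<^esub> f) = f \<otimes>\<^bsub>magnus_group\<^esub> g"
    using fg by (simp add: M.word_simps del: magnus_simps)
  then have cP: "conv ?c P = conv f g" by (simp add: P_def)
  have dPQ: "conv f g w - P w = (if length w = m + n then f (take m w) * g (drop m w) - g (take n w) * f (drop n w) else 0)"
    if "w \<noteq> []" "length w \<le> m + n" for w
    unfolding P_def using conv_low_low[OF f g mn that] conv_low_low[OF g f mn(2,1)] that by simp
  have zero: "w \<noteq> [] \<Longrightarrow> length w < m + n \<Longrightarrow> ?c w = 0" for w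
  proof (induction "length w" arbitrary: w rule: less_induct)
    case less
    have "?c (take i w) * P (drop i w) = 0" if "0 < i" "i < length w" for i
      using less.hyps[of "take i w"] less.prems that by auto
    then have "conv ?c P w = ?c w + P w" using less.prems(1) c1 P1 by (intro conv_ends)
    then show ?case using dPQ[of w] less.prems cP by simp
  qed
  then show "?c \<in> low (m + n)" using c1 by (auto simp: low_def)
  assume w: "length w = m + n"
  then have wn: "w \<noteq> []" using mn by auto
  have "?c (take i w) * P (drop i w) = 0" if "0 < i" "i < length w" for i
    using zero[of "take i w"] w wn that by auto
  then have "conv ?c P w = ?c w + P w" using wn c1 P1 by (intro conv_ends)
  then show "?c w = f (take m w) * g (drop m w) - g (take n w) * f (drop n w)"
    using dPQ[of w] w wn cP by simp
qed

lemma subgroup_low: "subgroup (low n) magnus_group"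
proof
  show "low n \<subseteq> carrier magnus_group" by (auto simp: low_def)
  show "\<one>\<^bsub>magnus_group\<^esub> \<in> low n" by (simp add: low_def unit_series_def)
  show "x \<otimes>\<^bsub>magnus_group\<^esub> y \<in> low n" if "x \<in> low n" "y \<in> low n" for x y
    using low_closed[OF that] by simp
  show "inv\<^bsub>magnus_group\<^esub> x \<in> low n" if "x \<in> low n" for x using inv_low(1)[OF that] .
qed

lemma lcs_magnus: "k \<ge> 1 \<Longrightarrow> lcs magnus_group k \<subseteq> low k"
proof (induction k rule: dec_induct)
  case base
  then show ?case by (auto simp: low_1)
next
  case (step k)
  have "comm_set magnus_group (lcs magnus_group k) \<subseteq> low (Suc k)"
  proof
    fix c assume "c \<in> comm_set magnus_group (lcs magnus_group k)"
    then obtain g x where "c = commutator magnus_group g x" "g [] = 1" "x \<in> low k"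
      using step.IH by (auto simp: comm_set_def)
    then show "c \<in> low (Suc k)" using commutator_low(1)[of g 1 x k] step.hyps by (simp add: low_1)
  qed
  then show ?case using M.generate_subgroup_incl[OF _ subgroup_low] step.hyps M.lcs_Suc[of k] by simp
qed

section \<open>Lyndon words\<close>

lemma append_eq_appendE:
  assumes "u @ v = p @ s"
  obtains t where "p = u @ t" "v = t @ s" | t where "u = p @ t" "s = t @ v" "t \<noteq> []"
proof -
  from assms obtain t where "u = p @ t \<and> t @ v = s \<or> u @ t = p \<and> v = t @ s"
    by (auto simp: append_eq_append_conv2)
  then show thesis using that(1)[of t] that(2)[of t] that(1)[of "[]"] by (cases "t = []") auto
qed

text \<open>A comparison decided at a position present in both words. Unlike the lexicographic
  order, where a proper prefix is smaller, it survives appending arbitrary tails.\<close>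

definition diff_less :: "nat list \<Rightarrow> nat list \<Rightarrow> bool" where
  "diff_less u v \<longleftrightarrow> (\<exists>p a b s t. u = p @ a # s \<and> v = p @ b # t \<and> a < b)"

lemma append_less_append [simp]: "(u @ x < u @ y) \<longleftrightarrow> (x < y)" for u x y :: "nat list"
  by (induction u) auto

lemma append_le_append [simp]: "(u @ x \<le> u @ y) \<longleftrightarrow> (x \<le> y)" for u x y :: "nat list"
  by (induction u) auto

lemma le_append [simp]: "u \<le> u @ x" for u x :: "nat list"
  by (induction u) auto

lemma take_le: "take k z \<le> z" for z :: "nat list"
  using le_append[of "take k z" "drop k z"] by simp

lemma diff_less_append: "diff_less u v \<Longrightarrow> u @ s < v @ t"
proof -
  assume "diff_less u v"
  then obtain p a b s' t' where "u = p @ a # s'" "v = p @ b # t'" "a < b" by (auto simp: diff_less_def)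
  then have "u @ s = p @ (a # s' @ s)" "v @ t = p @ (b # t' @ t)" "a # s' @ s < b # t' @ t" by auto
  then show ?thesis by (simp only: append_less_append)
qed

lemma less_cases:
  fixes u v :: "nat list"
  assumes "u < v"
  obtains t where "v = u @ t" "t \<noteq> []" | "diff_less u v"
proof -
  have "(\<exists>t. v = u @ t \<and> t \<noteq> []) \<or> diff_less u v"
    using assms
  proof (induction u arbitrary: v)
    case Nil then show ?case by auto
  next
    case (Cons a u)
    then obtain b v' where v: "v = b # v'" by (cases v) auto
    show ?case
    proof (cases "a < b")
      case True
      then show ?thesis unfolding diff_less_def v by (metis append_Nil)
    next
      case False
      then have "a = b" "u < v'" using Cons.prems v by auto
      with Cons.IH[of v'] show ?thesis unfolding diff_less_def v by (metis append_Cons)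
    qed
  qed
  then show thesis using that by blast
qed

lemma less_diff: "u < v \<Longrightarrow> length v \<le> length u \<Longrightarrow> diff_less u v"
  by (erule less_cases) auto

lemma le_append_mono:
  fixes u x :: "nat list"
  assumes "length x = length u" "u \<le> x" "v \<le> y"
  shows "u @ v \<le> x @ y"
proof (cases "u = x")
  case False
  then have "diff_less u x" using assms by (intro less_diff) auto
  then show ?thesis using diff_less_append[of u x v y] by simp
qed (use assms in simp)

definition lyndon :: "nat list \<Rightarrow> bool" where
  "lyndon w \<longleftrightarrow> w \<noteq> [] \<and> (\<forall>p s. w = p @ s \<longrightarrow> p \<noteq> [] \<longrightarrow> s \<noteq> [] \<longrightarrow> w < s)"

lemma lyndonD: "lyndon w \<Longrightarrow> w = p @ s \<Longrightarrow> p \<noteq> [] \<Longrightarrow> s \<noteq> [] \<Longrightarrow> w < s"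
  by (simp add: lyndon_def)

lemma lyndon_letter: "lyndon [i]"
  by (auto simp: lyndon_def Cons_eq_append_conv)

lemma lyndon_nonempty: "lyndon w \<Longrightarrow> w \<noteq> []"
  by (simp add: lyndon_def)

lemma lyndon_append:
  assumes u: "lyndon u" and v: "lyndon v" and uv: "u < v"
  shows "lyndon (u @ v)"
proof -
  have uv_v: "u @ v < v"
    using uv
  proof (cases rule: less_cases)
    case (1 t)
    \<comment> \<open>With \<open>u\<close> a prefix of \<open>v\<close>, the claim reduces to
      comparing the tails \<open>v\<close> and \<open>t\<close>.\<close>
    have "v < t" using lyndonD[OF v 1(1)] u 1 lyndon_nonempty by auto
    then show ?thesis using 1 by (metis append_less_append)
  next
    case 2 then show ?thesis using diff_less_append[of u v v "[]"] by simp
  qed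
  have "u @ v < s" if ps: "u @ v = p @ s" "p \<noteq> []" "s \<noteq> []" for p s
  proof -
    from ps(1) show ?thesis
    proof (cases rule: append_eq_appendE)
      case (1 t)
      show ?thesis
      proof (cases "t = []")
        case False
        then show ?thesis using lyndonD[OF v 1(2)] ps uv_v by auto
      qed (use 1 uv_v in simp)
    next
      case (2 t)
      then have "u < t" using lyndonD[OF u 2(1)] ps by simp
      then have "diff_less u t" using 2 by (intro less_diff) auto
      then show ?thesis using diff_less_append 2 by blast
    qed
  qed
  then show ?thesis using lyndon_nonempty[OF u] by (auto simp: lyndon_def)
qed

definition suffixes_of :: "nat list \<Rightarrow> nat list set" where
  "suffixes_of w = {s. \<exists>p. p \<noteq> [] \<and> s \<noteq> [] \<and> w = p @ s}"

text \<open>For a Lyndon word the least proper suffix is also its longest proper Lyndon suffix, so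
  this is the right factor of the standard factorization.\<close>

definition std_right :: "nat list \<Rightarrow> nat list" where
  "std_right w = Min (suffixes_of w)"

definition std_left :: "nat list \<Rightarrow> nat list" where
  "std_left w = take (length w - length (std_right w)) w"

lemma finite_suffixes_of: "finite (suffixes_of w)"
proof (rule finite_subset)
  show "suffixes_of w \<subseteq> (\<lambda>i. drop i w) ` {..length w}"
  proof
    fix s assume "s \<in> suffixes_of w"
    then obtain p where "w = p @ s" by (auto simp: suffixes_of_def)
    then show "s \<in> (\<lambda>i. drop i w) ` {..length w}" by (intro image_eqI[of _ _ "length p"]) auto
  qed
qed simp

lemma suffixes_of_nonempty: "length w \<ge> 2 \<Longrightarrow> suffixes_of w \<noteq> {}"
proof -
  assume "length w \<ge> 2"
  then obtain a b t where "w = a # b # t" by (metis Suc_le_length_iff numeral_2_eq_2)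
  then have "b # t \<in> suffixes_of w" by (auto simp: suffixes_of_def intro!: exI[of _ "[a]"])
  then show ?thesis by blast
qed

lemma std_factor:
  assumes "length w \<ge> 2"
  shows "w = std_left w @ std_right w" "std_left w \<noteq> []" "std_right w \<noteq> []"
proof -
  have "std_right w \<in> suffixes_of w"
    unfolding std_right_def by (intro Min_in finite_suffixes_of suffixes_of_nonempty assms)
  then obtain p where "p \<noteq> []" "std_right w \<noteq> []" "w = p @ std_right w" by (auto simp: suffixes_of_def)
  moreover from this have "std_left w = p" unfolding std_left_def by (metis append_eq_conv_conj diff_add_inverse2 length_append)
  ultimately show "w = std_left w @ std_right w" "std_left w \<noteq> []" "std_right w \<noteq> []" by auto
qed

lemma std_right_le: "w = p @ s \<Longrightarrow> p \<noteq> [] \<Longrightarrow> s \<noteq> [] \<Longrightarrow> std_right w \<le> s"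
  unfolding std_right_def by (intro Min_le finite_suffixes_of) (auto simp: suffixes_of_def)

lemma std_length:
  assumes "length w \<ge> 2"
  shows "length (std_left w) < length w" "length (std_right w) < length w"
    "length (std_left w) + length (std_right w) = length w"
proof -
  show "length (std_left w) + length (std_right w) = length w"
    using arg_cong[OF std_factor(1)[OF assms], of length] by simp
  then show "length (std_left w) < length w" "length (std_right w) < length w"
    using std_factor(2,3)[OF assms] by (auto simp: neq_Nil_conv)
qed

text \<open>For the left factor \<open>u\<close>, suppose a proper suffix \<open>s\<close> is
  smaller than \<open>u\<close>. If \<open>s\<close> is a prefix of \<open>u\<close>, cancelling it
  contradicts the minimality of the right factor; otherwise \<open>s @ v\<close> is a suffix of
  \<open>w\<close> smaller than \<open>w\<close>.\<close>

lemma lyndon_std: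
  assumes w: "lyndon w" and len: "length w \<ge> 2"
  shows "lyndon (std_left w)" "lyndon (std_right w)" "std_left w < std_right w"
proof -
  define u v where "u = std_left w" and "v = std_right w"
  have uv: "w = u @ v" "u \<noteq> []" "v \<noteq> []" using std_factor[OF len] by (simp_all add: u_def v_def)
  have min: "v \<le> s" if "w = p @ s" "p \<noteq> []" "s \<noteq> []" for p s
    unfolding v_def using std_right_le that .
  have "v < s" if "v = p @ s" "p \<noteq> []" "s \<noteq> []" for p s
  proof -
    have "v \<le> s" using min[of "u @ p" s] that uv by simp
    moreover have "v \<noteq> s" using that by auto
    ultimately show ?thesis by simp
  qed
  then have "lyndon v" using uv(3) unfolding lyndon_def by blast
  then show "lyndon (std_right w)" by (simp only: v_def)
  have "u < s" if ps: "u = p @ s" "p \<noteq> []" "s \<noteq> []" for p s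
  proof (rule ccontr)
    assume "\<not> u < s"
    moreover have "u \<noteq> s" using ps by auto
    ultimately have "s < u" by simp
    have ws: "w < s @ v" using lyndonD[OF w, of p "s @ v"] ps uv by simp
    from \<open>s < u\<close> show False
    proof (cases rule: less_cases)
      case (1 z)
      then have "z @ v < v" using ws uv(1) by simp
      moreover have "v \<le> z @ v" using min[of s "z @ v"] uv 1 ps by simp
      ultimately show False by simp
    next
      case 2
      then have "s @ v < u @ v" by (rule diff_less_append)
      then show False using ws uv(1) by simp
    qed
  qed
  then have "lyndon u" using uv(2) unfolding lyndon_def by blast
  then show "lyndon (std_left w)" by (simp only: u_def)
  have "w < v" using lyndonD[OF w uv] .
  moreover have "u \<le> w" using uv(1) by simp
  ultimately show "std_left w < std_right w" by (simp add: u_def[symmetric] v_def[symmetric])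
qed

text \<open>A criterion for \<open>(u, v)\<close> to be the standard factorization of
  \<open>u @ v\<close>. Where the condition fails, \<open>bracket_sp\<close> has to rewrite.\<close>

lemma std_right_append:
  assumes u: "lyndon u" and v: "lyndon v" and uv: "length u = 1 \<or> v \<le> std_right u"
  shows "std_right (u @ v) = v" "std_left (u @ v) = u"
proof -
  have ne: "u \<noteq> []" "v \<noteq> []" using u v lyndon_nonempty by auto
  have "v \<le> s" if s: "s \<in> suffixes_of (u @ v)" for s
  proof -
    from s obtain p where ps: "u @ v = p @ s" "p \<noteq> []" "s \<noteq> []" by (auto simp: suffixes_of_def)
    from ps(1) show ?thesis
    proof (cases rule: append_eq_appendE)
      case (1 t)
      then show ?thesis using lyndonD[OF v 1(2)] ps by (cases "t = []") auto
    next
      case (2 t)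
      then have "length u \<noteq> 1" using ps by (cases p; cases t) auto
      then have "v \<le> std_right u" using uv by simp
      also have "\<dots> \<le> t" using std_right_le 2 ps by blast
      also have "\<dots> \<le> s" using 2 by simp
      finally show ?thesis .
    qed
  qed
  moreover have "v \<in> suffixes_of (u @ v)" using ne by (auto simp: suffixes_of_def)
  ultimately show r: "std_right (u @ v) = v"
    unfolding std_right_def by (intro Min_eqI finite_suffixes_of)
  show "std_left (u @ v) = u" by (simp add: std_left_def r)
qed

section \<open>Lyndon bases of the lower central quotients of a free group\<close>

context group
begin

text \<open>Such a subgroup is central modulo \<open>lcs G (Suc n)\<close>, hence normal. Subgroups
  of the quotient of \<open>lcs G n\<close> by \<open>lcs G (Suc n)\<close> can thus be handled
  inside \<open>G\<close>.\<close>

lemma normal_between: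
  assumes S: "subgroup S G" and n: "n \<ge> 1" and le: "lcs G (Suc n) \<subseteq> S" "S \<subseteq> lcs G n"
  shows "S \<lhd> G"
proof (rule normal_invI[OF S])
  fix g s assume gs: "g \<in> carrier G" "s \<in> S"
  then have s: "s \<in> carrier G" using subgroup.mem_carrier[OF S] by blast
  have "commutator G g s \<in> S" using commutator_in_lcs[OF n gs(1)] gs(2) le by blast
  then have "commutator G g s \<otimes> s \<in> S" using subgroup.m_closed[OF S] gs by blast
  moreover have "commutator G g s \<otimes> s = g \<otimes> s \<otimes> inv g" using gs s by (simp add: word_simps)
  ultimately show "g \<otimes> s \<otimes> inv g \<in> S" by simp
qed

lemma commutator_mem_sym:
  assumes "N \<lhd> G" "x \<in> carrier G" "y \<in> carrier G" "commutator G x y \<in> N"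
  shows "commutator G y x \<in> N"
  using subgroup.m_inv_closed[OF normal_imp_subgroup[OF assms(1)] assms(4)] assms
  by (simp add: inv_commutator)

lemma commutator_mem_conj:
  assumes N: "N \<lhd> G" and le: "lcs G (Suc (i + j)) \<subseteq> N" and ij: "i \<ge> 1" "j \<ge> 1"
    and a: "a \<in> lcs G i" and y: "y \<in> lcs G j" and g: "g \<in> carrier G" and ay: "commutator G a y \<in> N"
  shows "commutator G a (g \<otimes> y \<otimes> inv g) \<in> N"
proof -
  have c: "a \<in> carrier G" "y \<in> carrier G" using a y by (auto intro: lcs_carrier)
  have gy: "commutator G g y \<in> lcs G (Suc j)" by (rule commutator_in_lcs[OF ij(2) g y])
  have "g \<otimes> y \<otimes> inv g = commutator G g y \<otimes> y" using c g by (simp add: word_simps)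
  then have "commutator G a (g \<otimes> y \<otimes> inv g) =
      commutator G a (commutator G g y) \<otimes> (commutator G g y \<otimes> commutator G a y \<otimes> inv (commutator G g y))"
    using commutator_mult_right[OF c(1) commutator_closed[OF g c(2)] c(2)] by simp
  moreover have "commutator G a (commutator G g y) \<in> N"
    using commutator_lcs_lcs[OF ij(1) _ a gy] le by auto
  moreover have "commutator G g y \<otimes> commutator G a y \<otimes> inv (commutator G g y) \<in> N"
    by (rule normal.inv_op_closed2[OF N commutator_closed[OF g c(2)] ay])
  ultimately show ?thesis using subgroup.m_closed[OF normal_imp_subgroup[OF N]] by simp
qed

lemma commutator_mem_inv:
  assumes N: "N \<lhd> G" and c: "a \<in> carrier G" "y \<in> carrier G" and ay: "commutator G a y \<in> N"
  shows "commutator G a (inv y) \<in> N"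
  by (rule commutator_mem_sym[OF N])
     (use c commutator_inv_left_iff[OF N c(2,1)] commutator_mem_sym[OF N c ay] in auto)

text \<open>The graded Jacobi identity. The inverses and conjugations in the Hall-Witt identity
  alter the brackets only modulo \<open>lcs G (Suc (i + j + k))\<close> or by inversion and
  conjugation, which is harmless for membership in \<open>N\<close>.\<close>

lemma jacobi_mem:
  assumes N: "N \<lhd> G" and le: "lcs G (Suc (i + j + k)) \<subseteq> N" and ijk: "i \<ge> 1" "j \<ge> 1" "k \<ge> 1"
    and a: "a \<in> lcs G i" and b: "b \<in> lcs G j" and c: "c \<in> lcs G k"
    and 1: "commutator G a (commutator G b c) \<in> N" and 2: "commutator G b (commutator G a c) \<in> N"
  shows "commutator G (commutator G a b) c \<in> N"
proof -
  have cr: "a \<in> carrier G" "b \<in> carrier G" "c \<in> carrier G" using a b c by (auto intro: lcs_carrier)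
  have bc: "inv (commutator G b c) \<in> lcs G (j + k)" and ac: "inv (commutator G a c) \<in> lcs G (i + k)"
    using commutator_lcs_lcs[OF _ _ b c] commutator_lcs_lcs[OF _ _ a c] ijk by (auto simp del: lcs.simps)
  have "commutator G c (commutator G (inv (inv a)) b) \<in> N"
  proof (rule three_subgroup[OF N])
    have e: "commutator G (inv b) c = inv b \<otimes> inv (commutator G b c) \<otimes> inv (inv b)"
      using cr by (simp add: word_simps)
    have "commutator G a (inv b \<otimes> inv (commutator G b c) \<otimes> inv (inv b)) \<in> N"
      by (rule commutator_mem_conj[OF N _ ijk(1) _ a bc _
            commutator_mem_inv[OF N cr(1) commutator_closed[OF cr(2,3)] 1]])
         (use le ijk cr in \<open>simp_all add: add.assoc del: lcs.simps\<close>)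
    then have "commutator G a (commutator G (inv b) c) \<in> N" unfolding e .
    then show "commutator G (inv a) (commutator G (inv b) c) \<in> N"
      by (rule iffD2[OF commutator_inv_left_iff[OF N cr(1) commutator_closed[OF inv_closed[OF cr(2)] cr(3)]]])
    have e: "commutator G (inv c) (inv a) = inv (a \<otimes> c) \<otimes> inv (commutator G a c) \<otimes> inv (inv (a \<otimes> c))"
      using cr by (simp add: word_simps)
    have "commutator G b (inv (a \<otimes> c) \<otimes> inv (commutator G a c) \<otimes> inv (inv (a \<otimes> c))) \<in> N"
      by (rule commutator_mem_conj[OF N _ ijk(2) _ b ac _
            commutator_mem_inv[OF N cr(2) commutator_closed[OF cr(1,3)] 2]])
         (use le ijk cr in \<open>simp_all add: add_ac del: lcs.simps\<close>)
    then show "commutator G b (commutator G (inv c) (inv a)) \<in> N" unfolding e .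
  qed (use cr in auto)
  then have "commutator G c (commutator G a b) \<in> N" using cr by simp
  then show ?thesis by (rule commutator_mem_sym[OF N cr(3) commutator_closed[OF cr(1,2)]])
qed

end

section \<open>Standard bracketings of Lyndon words span the lower central quotients\<close>

locale lettered_group = group F for F :: "('a, 'm) monoid_scheme" (structure) +
  fixes b :: "nat \<Rightarrow> 'a" and d :: nat
  assumes b_carrier: "b i \<in> carrier F" and b_generates: "generate F (b ` {..<d}) = carrier F"
begin

text \<open>The standard bracketing of a Lyndon word; the value \<open>b (hd [])\<close> on the
  empty word is a placeholder.\<close>

function br :: "nat list \<Rightarrow> 'a" where
  "br w = (if length w < 2 then b (hd w) else commutator F (br (std_left w)) (br (std_right w)))"
  by pat_completeness auto
termination by (relation "measure length") (auto simp: std_length)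

declare br.simps [simp del]

lemma br_letter: "br [i] = b i"
  by (simp add: br.simps)

lemma br_std: "length w \<ge> 2 \<Longrightarrow> br w = commutator F (br (std_left w)) (br (std_right w))"
  by (simp add: br.simps[of w])

lemma br_lcs: "w \<noteq> [] \<Longrightarrow> br w \<in> lcs F (length w)"
proof (induction "length w" arbitrary: w rule: less_induct)
  case less
  show ?case
  proof (cases "length w \<ge> 2")
    case False
    then obtain i where "w = [i]" using less.prems by (cases w) (auto simp: Suc_le_eq)
    then show ?thesis using b_carrier by (simp add: br_letter)
  next
    case True
    note f = std_factor[OF True] and l = std_length[OF True]
    have "commutator F (br (std_left w)) (br (std_right w)) \<in> lcs F (length (std_left w) + length (std_right w))"
      using less.hyps[OF l(1) f(2)] less.hyps[OF l(2) f(3)] f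
      by (intro commutator_lcs_lcs) (auto simp: Suc_le_eq)
    then show ?thesis using l br_std[OF True] by simp
  qed
qed

lemma br_carrier: "w \<noteq> [] \<Longrightarrow> br w \<in> carrier F"
  using br_lcs by (rule lcs_carrier)

definition ly :: "nat \<Rightarrow> nat list set" where
  "ly n = {w. lyndon w \<and> length w = n \<and> set w \<subseteq> {..<d}}"

text \<open>The span of the brackets in the quotient of \<open>lcs F n\<close> by
  \<open>lcs F (Suc n)\<close>, encoded as its preimage in \<open>F\<close>.\<close>

definition sp :: "nat \<Rightarrow> nat list set \<Rightarrow> 'a set" where
  "sp n A = generate F (br ` (ly n \<inter> A) \<union> lcs F (Suc n))"

lemma ly_nonempty: "w \<in> ly n \<Longrightarrow> w \<noteq> []"
  by (auto simp: ly_def lyndon_nonempty)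

lemma br_ly: "w \<in> ly n \<Longrightarrow> br w \<in> lcs F n"
  using br_lcs[of w] ly_nonempty[of w n] by (simp add: ly_def)

lemma sp_gens_lcs: "br ` (ly n \<inter> A) \<union> lcs F (Suc n) \<subseteq> lcs F n"
  by (intro Un_least image_subsetI lcs_Suc_subset) (blast intro: br_ly)

lemma sp_gens_carrier: "br ` (ly n \<inter> A) \<union> lcs F (Suc n) \<subseteq> carrier F"
  using sp_gens_lcs lcs_subset by (rule subset_trans)

lemma sp_subgroup: "subgroup (sp n A) F"
  unfolding sp_def by (rule generate_is_subgroup[OF sp_gens_carrier])

lemma sp_lcs: "sp n A \<subseteq> lcs F n"
  unfolding sp_def by (rule generate_subgroup_incl[OF sp_gens_lcs lcs_subgroup])

lemma lcs_sp: "lcs F (Suc n) \<subseteq> sp n A"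
  unfolding sp_def by (intro subsetI generate.incl) blast

lemma br_sp: "w \<in> ly n \<Longrightarrow> w \<in> A \<Longrightarrow> br w \<in> sp n A"
  unfolding sp_def by (rule generate.incl) auto

lemma sp_normal: "n \<ge> 1 \<Longrightarrow> sp n A \<lhd> F"
  by (rule normal_between[OF sp_subgroup _ lcs_sp sp_lcs])

lemma sp_mono: "A \<subseteq> A' \<Longrightarrow> sp n A \<subseteq> sp n A'"
  unfolding sp_def by (intro mono_generate) auto

lemma finite_words: "finite {z. set z \<subseteq> {..<d} \<and> length z \<le> n}"
  by (rule finite_lists_length_le) simp

text \<open>If \<open>(u, v)\<close> is not the standard factorization of \<open>u @ v\<close>, then \<open>u\<close> is split and the Jacobi
  identity is applied. This reduces the total length or makes the right factor smaller.\<close>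
lemma bracket_sp:
  assumes "u \<in> ly m" "v \<in> ly k" "u < v"
  shows "commutator F (br u) (br v) \<in> sp (m + k) {w. u @ v \<le> w \<and> w < v}"
proof -
  \<comment> \<open>The lexicographic order on words is not well founded. Among words of bounded
    length over \<open>d\<close> letters, counting the smaller ones gives a rank, which measures the
    right factor in the inner induction.\<close>
  define rk where "rk n v = card {z. (set z \<subseteq> {..<d} \<and> length z \<le> n) \<and> z < v}" for n and v :: "nat list"
  have rk: "rk n w < rk n v" if "w < v" "set w \<subseteq> {..<d}" "length w \<le> n" for n w v
    unfolding rk_def using that
    by (intro psubset_card_mono finite_subset[OF _ finite_words[of n]]) (auto simp: psubset_eq set_eq_iff)
  have "\<forall>u v m k. n = m + k \<longrightarrow> u \<in> ly m \<longrightarrow> v \<in> ly k \<longrightarrow> u < v \<longrightarrow>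
      commutator F (br u) (br v) \<in> sp n {w. u @ v \<le> w \<and> w < v}" for n
  proof (induction n rule: less_induct)
    case (less n)
    note shorter = less[rule_format]
    show ?case
    proof (intro allI impI)
      fix u v m k
      assume "n = m + k" "u \<in> ly m" "v \<in> ly k" "u < v"
      then show "commutator F (br u) (br v) \<in> sp n {w. u @ v \<le> w \<and> w < v}"
      proof (induction "rk n v" arbitrary: u v m k rule: less_induct)
        case less
        note inner = less.hyps
        note n = less.prems(1) and u = less.prems(2) and v = less.prems(3) and uv = less.prems(4)
        have lu: "lyndon u" "length u = m" "set u \<subseteq> {..<d}" and lv: "lyndon v" "length v = k" "set v \<subseteq> {..<d}"
          using u v by (auto simp: ly_def)
        have mk: "m \<ge> 1" "k \<ge> 1" using ly_nonempty[OF u] ly_nonempty[OF v] lu lv by (auto simp: Suc_le_eq)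
        have n1: "n \<ge> 1" using n mk by simp
        \<comment> \<open>Both ends of the window serve the induction: the upper end lowers the rank
          of the next right factor, the lower end controls the order of the next factors and leads
          back into the window.\<close>
        let ?S = "sp n {w. u @ v \<le> w \<and> w < v}"
        have S: "?S \<lhd> F" by (rule sp_normal[OF n1])
        show ?case
        proof (cases "m = 1 \<or> v \<le> std_right u")
          case True
          then have st: "std_right (u @ v) = v" "std_left (u @ v) = u" using std_right_append[OF lu(1) lv(1)] lu by auto
          have luv: "lyndon (u @ v)" by (rule lyndon_append[OF lu(1) lv(1) uv])
          then have "u @ v < v" using lyndonD[of "u @ v" u v] lyndon_nonempty lu lv by auto
          moreover have "u @ v \<in> ly n" using luv lu lv n by (simp add: ly_def)
          moreover have "br (u @ v) = commutator F (br u) (br v)" using br_std[of "u @ v"] st lu lv mk by simp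
          ultimately show ?thesis using br_sp[of "u @ v" n "{w. u @ v \<le> w \<and> w < v}"] by simp
        next
          case False
          then have m2: "length u \<ge> 2" using lu mk by simp
          define u1 u2 where "u1 = std_left u" and "u2 = std_right u"
          have u12: "u = u1 @ u2" "u1 \<noteq> []" "u2 \<noteq> []" using std_factor[OF m2] by (simp_all add: u1_def u2_def)
          have l12: "lyndon u1" "lyndon u2" "u1 < u2" using lyndon_std[OF lu(1) m2] by (simp_all add: u1_def u2_def)
          define i j where "i = length u1" and "j = length u2"
          have ij: "m = i + j" "i \<ge> 1" "j \<ge> 1" using u12 lu by (auto simp: i_def j_def Suc_le_eq)
          have u1: "u1 \<in> ly i" and u2: "u2 \<in> ly j" using l12 u12 lu by (auto simp: ly_def i_def j_def)
          have u2v: "u2 < v" using False by (simp add: u2_def not_le)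
          then have u1v: "u1 < v" using l12 by simp
          have bru: "br u = commutator F (br u1) (br u2)" using br_std[OF m2] by (simp add: u1_def u2_def)
          have L: "br u1 \<in> lcs F i" "br u2 \<in> lcs F j" "br v \<in> lcs F k"
            by (rule br_ly[OF u1], rule br_ly[OF u2], rule br_ly[OF v])
          have C: "br u1 \<in> carrier F" "br u2 \<in> carrier F" "br v \<in> carrier F" using L by (auto intro: lcs_carrier)
          have low: "lcs F (Suc n) \<subseteq> ?S" by (rule lcs_sp)
          \<comment> \<open>The inner bracket is shorter and expands into brackets of words
            \<open>w < v\<close>, so the outer bracket has a right factor of smaller rank.\<close>
          have first: "commutator F (br u1) (commutator F (br u2) (br v)) \<in> ?S"
          proof (rule commutator_generate[OF S C(1) sp_gens_carrier])
            show "commutator F (br u2) (br v) \<in> generate F (br ` (ly (j + k) \<inter> {w. u2 @ v \<le> w \<and> w < v}) \<union> lcs F (Suc (j + k)))"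
              using shorter[of "j + k" j k u2 v] n ij u2 v u2v by (simp add: sp_def)
            fix s assume "s \<in> br ` (ly (j + k) \<inter> {w. u2 @ v \<le> w \<and> w < v}) \<union> lcs F (Suc (j + k))"
            then show "commutator F (br u1) s \<in> ?S"
            proof
              assume "s \<in> lcs F (Suc (j + k))"
              then have "commutator F (br u1) s \<in> lcs F (i + Suc (j + k))"
                by (intro commutator_lcs_lcs[OF ij(2) _ L(1)]) simp_all
              then show ?thesis using low n ij by (auto simp: add.assoc simp del: lcs.simps)
            next
              assume "s \<in> br ` (ly (j + k) \<inter> {w. u2 @ v \<le> w \<and> w < v})"
              then obtain w where w: "s = br w" "w \<in> ly (j + k)" "u2 @ v \<le> w" "w < v" by auto
              have "u2 \<le> u2 @ v" by simp
              then have "u1 < w" using l12(3) w(3) by (meson order_less_le_trans order_trans)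
              moreover have "rk n w < rk n v" using w n ij by (intro rk) (auto simp: ly_def)
              ultimately have "commutator F (br u1) (br w) \<in> sp n {z. u1 @ w \<le> z \<and> z < w}"
                using inner[of w i "j + k" u1] n ij u1 w by simp
              moreover have "u @ v \<le> u1 @ w" using w(3) u12(1) by simp
              ultimately show ?thesis using w sp_mono[of "{z. u1 @ w \<le> z \<and> z < w}" "{w. u @ v \<le> w \<and> w < v}" n]
                by (auto dest: order_trans order_less_trans)
            qed
          qed
          have second: "commutator F (br u2) (commutator F (br u1) (br v)) \<in> ?S"
          proof (rule commutator_generate[OF S C(2) sp_gens_carrier])
            show "commutator F (br u1) (br v) \<in> generate F (br ` (ly (i + k) \<inter> {w. u1 @ v \<le> w \<and> w < v}) \<union> lcs F (Suc (i + k)))"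
              using shorter[of "i + k" i k u1 v] n ij u1 v u1v by (simp add: sp_def)
            fix s assume "s \<in> br ` (ly (i + k) \<inter> {w. u1 @ v \<le> w \<and> w < v}) \<union> lcs F (Suc (i + k))"
            then show "commutator F (br u2) s \<in> ?S"
            proof
              assume "s \<in> lcs F (Suc (i + k))"
              then have "commutator F (br u2) s \<in> lcs F (j + Suc (i + k))"
                by (intro commutator_lcs_lcs[OF ij(3) _ L(2)]) simp_all
              then show ?thesis using low n ij by (auto simp: add_ac simp del: lcs.simps)
            next
              assume "s \<in> br ` (ly (i + k) \<inter> {w. u1 @ v \<le> w \<and> w < v})"
              then obtain w where w: "s = br w" "w \<in> ly (i + k)" "u1 @ v \<le> w" "w < v" by auto
              have wc: "br w \<in> carrier F" using br_carrier w(2) ly_nonempty by blast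
              have wl: "length w = length (u1 @ v)" using w(2) lv by (simp add: ly_def i_def)
              \<comment> \<open>Here the order of \<open>u2\<close> and \<open>w\<close> is not
                determined. The larger one becomes the right factor, and both are below
                \<open>v\<close>.\<close>
              consider "w < u2" | "w = u2" | "u2 < w" by fastforce
              then show ?thesis
              proof cases
                case 1
                have "rk n u2 < rk n v" using u2v u2 n ij by (intro rk) (auto simp: ly_def)
                then have "commutator F (br w) (br u2) \<in> sp n {z. w @ u2 \<le> z \<and> z < u2}"
                  using inner[of u2 "i + k" j w] n ij u2 w 1 by simp
                moreover have "u @ v \<le> w @ u2"
                proof -
                  have "u2 @ v < v" using lyndonD[OF lyndon_append[OF l12(2) lv(1) u2v] refl u12(3) lyndon_nonempty[OF lv(1)]] .
                  then have "u2 @ v < v @ u2" by (rule order_less_le_trans) simp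
                  then have "u @ v \<le> (u1 @ v) @ u2" using u12(1) by simp
                  also have "\<dots> \<le> w @ u2" using le_append_mono[OF wl w(3)] by simp
                  finally show ?thesis .
                qed
                ultimately have "commutator F (br w) (br u2) \<in> ?S"
                  using u2v sp_mono[of "{z. w @ u2 \<le> z \<and> z < u2}" "{w. u @ v \<le> w \<and> w < v}" n]
                  by (auto dest: order_trans order_less_trans)
                then show ?thesis unfolding w(1) by (rule commutator_mem_sym[OF S wc C(2)])
              next
                case 2
                then show ?thesis unfolding w(1) using C(2) subgroup.one_closed[OF sp_subgroup] by simp
              next
                case 3
                have "rk n w < rk n v" using w n ij by (intro rk) (auto simp: ly_def)
                then have "commutator F (br u2) (br w) \<in> sp n {z. u2 @ w \<le> z \<and> z < w}"
                  using inner[of w j "i + k" u2] n ij u2 w 3 by simp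
                moreover have "u @ v \<le> u2 @ w"
                proof -
                  have "u < u2" using lyndonD[OF lu(1) u12] .
                  then have "diff_less u u2" using u12(1) by (intro less_diff) auto
                  then show ?thesis using diff_less_append[of u u2 v w] by simp
                qed
                ultimately show ?thesis
                  unfolding w(1) using w(4) sp_mono[of "{z. u2 @ w \<le> z \<and> z < w}" "{w. u @ v \<le> w \<and> w < v}" n]
                  by (auto dest: order_trans order_less_trans)
              qed
            qed
          qed
          show ?thesis unfolding bru
            by (rule jacobi_mem[OF S _ ij(2,3) mk(2) L first second]) (use low n ij in simp)
        qed
      qed
    qed
  qed
  then show ?thesis using assms by blast
qed

text \<open>\<open>commutator_generate\<close> reduces brackets with arbitrary group elements to
  brackets with letters. Letters are Lyndon words, so \<open>bracket_sp\<close> applies in either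
  order.\<close>

lemma lcs_eq_sp:
  assumes "n \<ge> 1"
  shows "lcs F n \<subseteq> sp n UNIV"
  using assms
proof (induction n rule: dec_induct)
  case base
  have "b ` {..<d} \<subseteq> sp 1 UNIV"
    using br_sp[of "[_]" 1 UNIV] by (auto simp: ly_def lyndon_letter br_letter)
  from generate_subgroup_incl[OF this sp_subgroup] show ?case unfolding b_generates by simp
next
  case (step n)
  let ?S = "sp (Suc n) UNIV"
  have S: "?S \<lhd> F" by (rule sp_normal) simp
  have bb: "b ` {..<d} \<subseteq> carrier F" using b_carrier by auto
  have letter: "commutator F (br w) s \<in> ?S" if w: "w \<in> ly n" and s: "s \<in> b ` {..<d}" for w s
  proof -
    from s obtain i where i: "s = br [i]" "[i] \<in> ly 1" by (auto simp: ly_def lyndon_letter br_letter)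
    have c: "br w \<in> carrier F" "br [i] \<in> carrier F" using br_carrier w ly_nonempty by auto
    have mono: "sp (Suc n) A \<subseteq> ?S" for A by (rule sp_mono) simp
    consider "w < [i]" | "w = [i]" | "[i] < w" by fastforce
    then show ?thesis
    proof cases
      case 1 then show ?thesis using bracket_sp[OF w i(2)] mono i(1) by auto
    next
      case 2 then show ?thesis using c i(1) subgroup.one_closed[OF sp_subgroup] by simp
    next
      case 3 then show ?thesis using bracket_sp[OF i(2) w] mono i(1) commutator_mem_sym[OF S c(2,1)] by auto
    qed
  qed
  have gen: "commutator F g s \<in> ?S" if g: "g \<in> carrier F" and s: "s \<in> br ` (ly n \<inter> UNIV) \<union> lcs F (Suc n)" for g s
  proof (cases "s \<in> lcs F (Suc n)")
    case True
    then show ?thesis using commutator_in_lcs[of "Suc n" g s] g lcs_sp[of "Suc n" UNIV] by (auto simp del: lcs.simps)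
  next
    case False
    then obtain w where w: "w \<in> ly n" "s = br w" using s by auto
    have c: "br w \<in> carrier F" using br_carrier w ly_nonempty by auto
    have "commutator F (br w) g \<in> ?S"
      by (rule commutator_generate[OF S c bb letter[OF w(1)]]) (use g b_generates in auto)
    then show ?thesis unfolding w(2) by (rule commutator_mem_sym[OF S c g])
  qed
  have "comm_set F (lcs F n) \<subseteq> ?S"
  proof
    fix c assume "c \<in> comm_set F (lcs F n)"
    then obtain g x where c: "c = commutator F g x" "g \<in> carrier F" "x \<in> lcs F n" by (auto simp: comm_set_def)
    have "x \<in> generate F (br ` (ly n \<inter> UNIV) \<union> lcs F (Suc n))" using c step.IH by (auto simp: sp_def)
    note x = this
    show "c \<in> ?S" unfolding c(1)
      by (rule commutator_generate[OF S c(2) sp_gens_carrier _ x]) (rule gen[OF c(2)])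
  qed
  then show ?case unfolding lcs_Suc[OF step.hyps(1)] by (rule generate_subgroup_incl[OF _ sp_subgroup])
qed

end

section \<open>Triangularity of Magnus coefficients on standard brackets\<close>

definition letter_series :: "nat \<Rightarrow> nat list \<Rightarrow> int" where
  "letter_series i w = (if w = [] \<or> w = [i] then 1 else 0)"

locale magnus_letters = lettered_group +
  fixes M :: "'a \<Rightarrow> nat list \<Rightarrow> int"
  assumes M_hom: "M \<in> hom F magnus_group" and M_letter: "i < d \<Longrightarrow> M (b i) = letter_series i"
begin

sublocale mh: group_hom F magnus_group M
  by (simp add: group_hom_def group_hom_axioms_def M_hom group_axioms group_magnus)

lemma M_lcs: "n \<ge> 1 \<Longrightarrow> x \<in> lcs F n \<Longrightarrow> M x \<in> low n"
  using mh.hom_lcs[of n] lcs_magnus[of n] by blast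

lemma length_nonempty: "n \<ge> 1 \<Longrightarrow> length w = n \<Longrightarrow> w \<noteq> []"
  by auto

lemma coeff_mult:
  assumes "n \<ge> 1" "length w = n" "x \<in> lcs F n" "y \<in> lcs F n"
  shows "M (x \<otimes> y) w = M x w + M y w"
proof -
  have "M (x \<otimes> y) = conv (M x) (M y)" using assms mh.hom_mult[of x y] by (simp add: lcs_carrier)
  then show ?thesis
    using conv_low[OF M_lcs[OF assms(1,3)] M_lcs[OF assms(1,4)] length_nonempty[OF assms(1,2)]] assms(2) by simp
qed

lemma coeff_inv:
  assumes "n \<ge> 1" "length w = n" "x \<in> lcs F n"
  shows "M (inv x) w = - M x w"
proof -
  have "M (inv x) = inv\<^bsub>magnus_group\<^esub> (M x)" using assms mh.hom_inv[of x] lcs_carrier by blast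
  then show ?thesis
    using inv_low(2)[OF M_lcs[OF assms(1,3)] length_nonempty[OF assms(1,2)]] assms(2) by simp
qed

lemma coeff_one: "n \<ge> 1 \<Longrightarrow> length w = n \<Longrightarrow> M \<one> w = 0"
  using mh.hom_one by (auto simp: unit_series_def)

lemma coeff_nat_pow:
  assumes "n \<ge> 1" "length w = n" "x \<in> lcs F n"
  shows "M (x [^] (k::nat)) w = int k * M x w"
proof (induction k)
  case 0 then show ?case using coeff_one[OF assms(1,2)] by simp
next
  case (Suc k)
  have "M (x [^] k \<otimes> x) w = M (x [^] k) w + M x w" by (rule coeff_mult[OF assms(1,2) lcs_pow[OF assms(3)] assms(3)])
  then show ?case using Suc by (simp add: algebra_simps)
qed

lemma coeff_int_pow:
  assumes "n \<ge> 1" "length w = n" "x \<in> lcs F n"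
  shows "M (x [^] (k::int)) w = k * M x w"
proof (cases k)
  case (nonneg m)
  then show ?thesis using coeff_nat_pow[OF assms] by (simp add: int_pow_int)
next
  case (neg m)
  have "x [^] k = inv (x [^] Suc m)"
    using neg assms(3) lcs_carrier by (metis int_pow_neg_int)
  then have "M (x [^] k) w = - M (x [^] Suc m) w"
    using coeff_inv[OF assms(1,2) lcs_pow[OF assms(3), of "Suc m"]] by (simp only:)
  then show ?thesis using coeff_nat_pow[OF assms, of "Suc m"] neg by (simp only: mult_minus_left)
qed

lemma coeff_lcs_Suc:
  assumes "n \<ge> 1" "length w = n" "x \<in> lcs F (Suc n)"
  shows "M x w = 0"
  using lowD(2)[OF M_lcs[OF _ assms(3)] length_nonempty[OF assms(1,2)]] assms(2) by simp

text \<open>For \<open>w = u @ v\<close>, the product in the order \<open>u\<close>,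
  \<open>v\<close> has least word \<open>w\<close>. The product in the reverse order contributes
  nothing at words up to \<open>w\<close>: their prefixes of length \<open>k\<close> are at most
  \<open>w\<close>, hence below \<open>v\<close>.\<close>

lemma coeff_br:
  "w \<in> ly n \<Longrightarrow> M (br w) w = 1 \<and> (\<forall>z. length z = n \<longrightarrow> z < w \<longrightarrow> M (br w) z = 0)"
proof (induction n arbitrary: w rule: less_induct)
  case (less n)
  have w: "lyndon w" "length w = n" "set w \<subseteq> {..<d}" using less.prems by (auto simp: ly_def)
  show ?case
  proof (cases "n \<ge> 2")
    case False
    then have "length w = 1" using w lyndon_nonempty[OF w(1)] by (cases w) auto
    then obtain i where i: "w = [i]" by (auto simp: length_Suc_conv)
    have "z = [] \<or> z = [i] \<Longrightarrow> length z = n \<Longrightarrow> \<not> z < w" for z using i w by auto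
    then show ?thesis using i w M_letter[of i] by (auto simp: br_letter letter_series_def)
  next
    case True
    then have n2: "length w \<ge> 2" using w by simp
    define u v where "u = std_left w" and "v = std_right w"
    have uv: "w = u @ v" "u \<noteq> []" "v \<noteq> []" using std_factor[OF n2] by (simp_all add: u_def v_def)
    define m k where "m = length u" and "k = length v"
    have mk: "n = m + k" "m \<ge> 1" "k \<ge> 1" using uv w by (auto simp: m_def k_def Suc_le_eq)
    have "lyndon u" "lyndon v" using lyndon_std[OF w(1) n2] by (simp_all add: u_def v_def)
    moreover have "set u \<subseteq> {..<d}" "set v \<subseteq> {..<d}" using w(3) unfolding uv(1) by auto
    ultimately have u: "u \<in> ly m" and v: "v \<in> ly k" by (simp_all add: ly_def m_def k_def)
    have IHu: "M (br u) u = 1" "\<And>z. length z = m \<Longrightarrow> z < u \<Longrightarrow> M (br u) z = 0"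
      using less.IH[OF _ u] mk by auto
    have IHv: "M (br v) v = 1" "\<And>z. length z = k \<Longrightarrow> z < v \<Longrightarrow> M (br v) z = 0"
      using less.IH[OF _ v] mk by auto
    have bu: "br u \<in> lcs F m" and bv: "br v \<in> lcs F k" using br_ly u v by auto
    have "M (br w) = commutator magnus_group (M (br u)) (M (br v))"
      using br_std[OF n2] mh.hom_commutator[of "br u" "br v"] bu bv
      by (simp add: u_def v_def lcs_carrier)
    then have coeff: "M (br w) z = M (br u) (take m z) * M (br v) (drop m z) - M (br v) (take k z) * M (br u) (drop k z)"
      if "length z = n" for z
      using commutator_low(2)[OF M_lcs[OF mk(2) bu] M_lcs[OF mk(3) bv] mk(2,3)] that mk(1) by simp
    have wv: "w < v" by (rule lyndonD[OF w(1) uv])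
    have swap: "M (br v) (take k z) = 0" if "length z = n" "z \<le> w" for z
    proof (rule IHv(2))
      have "take k z \<le> w" using take_le that(2) by (rule order_trans)
      then show "take k z < v" using wv by simp
    qed (use that mk in auto)
    have "M (br w) w = 1" using coeff[of w] swap[of w] IHu(1) IHv(1) uv w by (simp add: m_def)
    moreover have "M (br w) z = 0" if z: "length z = n" "z < w" for z
    proof -
      have "M (br u) (take m z) * M (br v) (drop m z) = 0"
      proof (rule ccontr)
        assume "M (br u) (take m z) * M (br v) (drop m z) \<noteq> 0"
        then have "\<not> take m z < u" "\<not> drop m z < v"
          using IHu(2)[of "take m z"] IHv(2)[of "drop m z"] z mk by auto
        then have "u \<le> take m z" "v \<le> drop m z" by (simp_all add: not_less)
        then have "u @ v \<le> take m z @ drop m z" using z mk by (intro le_append_mono) (auto simp: m_def)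
        then show False using z uv(1) by simp
      qed
      then show ?thesis using coeff[OF z(1)] swap[OF z(1)] z(2) by simp
    qed
    ultimately show ?thesis by blast
  qed
qed

lemma coeff_sp:
  assumes n: "n \<ge> 1" "length a = n" and lt: "\<And>w. w \<in> A \<Longrightarrow> a < w" and y: "y \<in> sp n A"
  shows "M y a = 0"
proof -
  let ?S = "br ` (ly n \<inter> A) \<union> lcs F (Suc n)"
  have S0: "M s a = 0" if "s \<in> ?S" for s
    using that coeff_br lt coeff_lcs_Suc[OF n] n by auto
  have SL: "x \<in> lcs F n" if "x \<in> generate F ?S" for x
    using that sp_lcs by (auto simp: sp_def)
  have "y \<in> generate F ?S" using y by (simp add: sp_def)
  then show ?thesis
  proof (induction rule: generate.induct)
    case one then show ?case by (rule coeff_one[OF n])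
  next
    case (incl h) then show ?case by (rule S0)
  next
    case (inv h)
    then have "h \<in> lcs F n" using sp_gens_lcs by blast
    then show ?case using coeff_inv[OF n] S0[OF inv] by simp
  next
    case (eng g h)
    then show ?case using coeff_mult[OF n SL[OF eng(1)] SL[OF eng(2)]] by simp
  qed
qed

lemma sp_insert:
  assumes n: "n \<ge> 1" and a: "a \<in> ly n" and x: "x \<in> sp n (insert a A)"
  shows "\<exists>k::int. \<exists>y\<in>sp n A. x = br a [^] k \<otimes> y"
proof -
  let ?S = "br ` (ly n \<inter> insert a A) \<union> lcs F (Suc n)"
  interpret N: normal "sp n A" F by (rule sp_normal[OF n])
  have ba: "br a \<in> carrier F" using br_ly[OF a] by (rule lcs_carrier)
  have gen: "\<exists>k::int. \<exists>y\<in>sp n A. s = br a [^] k \<otimes> y" if "s \<in> ?S" for s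
  proof (cases "s = br a")
    case True
    then have "s = br a [^] (1::int) \<otimes> \<one>" using ba by (simp add: int_pow_1)
    then show ?thesis using N.one_closed by blast
  next
    case False
    then have "s \<in> sp n A" using that br_sp[of _ n A] lcs_sp[of n A] by auto
    then have "s = br a [^] (0::int) \<otimes> s" using N.mem_carrier by simp
    then show ?thesis using \<open>s \<in> sp n A\<close> by blast
  qed
  have mult: "\<exists>k::int. \<exists>y\<in>sp n A. g \<otimes> h = br a [^] k \<otimes> y"
    if gh: "\<exists>k::int. \<exists>y\<in>sp n A. g = br a [^] k \<otimes> y" "\<exists>k::int. \<exists>y\<in>sp n A. h = br a [^] k \<otimes> y" for g h
  proof -
    from gh obtain k l :: int and y z where kl: "y \<in> sp n A" "z \<in> sp n A" "g = br a [^] k \<otimes> y" "h = br a [^] l \<otimes> z"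
      by blast
    have c: "y \<in> carrier F" "z \<in> carrier F" "br a [^] k \<in> carrier F" "br a [^] l \<in> carrier F"
      using kl N.mem_carrier ba by auto
    let ?q = "br a [^] l"
    have "inv ?q \<otimes> y \<otimes> ?q \<otimes> z \<in> sp n A"
      by (intro N.m_closed N.inv_op_closed1 kl c)
    moreover have "g \<otimes> h = br a [^] (k + l) \<otimes> (inv ?q \<otimes> y \<otimes> ?q \<otimes> z)"
      using kl(3,4) c ba by (simp add: int_pow_mult m_assoc inv_cancel_left)
    ultimately show ?thesis by blast
  qed
  have "x \<in> generate F ?S" using x by (simp add: sp_def)
  then show ?thesis
  proof (induction rule: generate.induct)
    case one
    have "\<one> = br a [^] (0::int) \<otimes> \<one>" by simp
    then show ?case using N.one_closed by blast
  next
    case (incl h) then show ?case by (rule gen)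
  next
    case (inv h)
    then obtain k :: int and y where ky: "y \<in> sp n A" "h = br a [^] k \<otimes> y" using gen by blast
    have c: "y \<in> carrier F" "br a [^] k \<in> carrier F" using ky N.mem_carrier ba by auto
    have "inv h = inv y \<otimes> br a [^] (- k)" using ky c ba by (simp add: inv_mult_group int_pow_neg)
    moreover have "inv y = br a [^] (0::int) \<otimes> inv y" "br a [^] (- k) = br a [^] (- k) \<otimes> \<one>" using c ba by auto
    ultimately show ?case using mult[of "inv y" "br a [^] (- k)"] N.one_closed N.m_inv_closed[OF ky(1)] by metis
  next
    case (eng g h) then show ?case using mult by blast
  qed
qed

text \<open>The coefficient at the least word \<open>a\<close> of \<open>A\<close> reads off the
  exponent of \<open>br a\<close>, since all other generators vanish there. The exponent is thus
  zero and \<open>a\<close> can be removed.\<close>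

lemma coeff_zero_imp_lcs:
  assumes n: "n \<ge> 1" and A: "finite A" "A \<subseteq> ly n" and x: "x \<in> sp n A"
    and zero: "\<And>w. length w = n \<Longrightarrow> M x w = 0"
  shows "x \<in> lcs F (Suc n)"
  using A x
proof (induction "card A" arbitrary: A)
  case 0
  then have "x \<in> generate F (lcs F (Suc n))" by (simp add: sp_def)
  then show ?case using generate_subgroup_incl[OF subset_refl lcs_subgroup] by blast
next
  case (Suc k)
  then have ne: "A \<noteq> {}" by auto
  define a where "a = Min A"
  have a: "a \<in> A" "\<And>w. w \<in> A - {a} \<Longrightarrow> a < w"
    using Min_in[OF Suc.prems(1) ne] Min_le[OF Suc.prems(1)] by (auto simp: a_def order_less_le)
  have aly: "a \<in> ly n" and al: "length a = n" using a Suc.prems(2) by (auto simp: ly_def)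
  have "x \<in> sp n (insert a (A - {a}))" using Suc.prems(3) a(1) by (simp add: insert_absorb)
  then obtain k' :: int and y where y: "y \<in> sp n (A - {a})" "x = br a [^] k' \<otimes> y"
    using sp_insert[OF n aly] by blast
  have yL: "y \<in> lcs F n" using y(1) sp_lcs by blast
  have "M x a = k' * 1 + 0"
    using coeff_mult[OF n al lcs_int_pow[OF br_ly[OF aly]] yL, of k'] coeff_int_pow[OF n al br_ly[OF aly], of k']
      coeff_br[OF aly] coeff_sp[OF n al a(2) y(1)] y(2) by simp
  then have "k' = 0" using zero[OF al] by simp
  then have "x = y" using y(2) yL by (simp add: lcs_carrier)
  moreover have "k = card (A - {a})" using Suc.hyps(2) a(1) Suc.prems(1) by simp
  ultimately show ?case using Suc.hyps(1)[of "A - {a}"] Suc.prems y(1) by auto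
qed

theorem magnus_detects:
  assumes n: "n \<ge> 1" and x: "x \<in> lcs F n" "x \<notin> lcs F (Suc n)"
  shows "\<exists>w. length w = n \<and> M x w \<noteq> 0"
proof (rule ccontr)
  assume "\<not> (\<exists>w. length w = n \<and> M x w \<noteq> 0)"
  moreover have "finite (ly n)" by (rule finite_subset[OF _ finite_words[of n]]) (auto simp: ly_def)
  moreover have "x \<in> sp n (ly n)" using lcs_eq_sp[OF n] x(1) by (auto simp: sp_def)
  ultimately have "x \<in> lcs F (Suc n)" by (intro coeff_zero_imp_lcs[OF n, of "ly n"]) auto
  then show False using x(2) by simp
qed

end

text \<open>The functional is one Magnus coefficient of degree \<open>n\<close> that does not vanish
  at \<open>r\<close>.\<close>

theorem free_group_lcs_functional:
  assumes F: "free_group_on F B" "finite B" and n: "n \<ge> 1" and r: "r \<in> lcs F n" "r \<notin> lcs F (Suc n)"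
  shows "\<exists>h :: 'a \<Rightarrow> real. (\<forall>x\<in>lcs F n. \<forall>y\<in>lcs F n. h (x \<otimes>\<^bsub>F\<^esub> y) = h x + h y) \<and>
    (\<forall>x\<in>lcs F (Suc n). h x = 0) \<and> h r \<noteq> 0"
proof -
  interpret group F using F(1) by (simp add: free_group_on_def)
  have BF: "B \<subseteq> carrier F" "generate F B = carrier F" using F(1) by (simp_all add: free_group_on_def)
  obtain d f where f: "B = f ` {i::nat. i < d}" "inj_on f {i. i < d}"
    using finite_imp_nat_seg_image_inj_on[OF F(2)] by blast
  define b where "b i = (if i < d then f i else \<one>\<^bsub>F\<^esub>)" for i
  have bB: "b ` {..<d} = B" using f(1) by (auto simp: b_def)
  define g where "g x = letter_series (inv_into {i. i < d} f x)" for x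
  have "g ` B \<subseteq> carrier magnus_group" by (auto simp: g_def letter_series_def)
  then obtain M where M: "M \<in> hom F magnus_group" "\<And>x. x \<in> B \<Longrightarrow> M x = g x"
    using free_group_extend[OF F(1) group_magnus, of g] by blast
  interpret magnus_letters F b d M
  proof
    show "b i \<in> carrier F" for i using f(1) BF(1) by (auto simp: b_def)
    show "generate F (b ` {..<d}) = carrier F" by (simp add: bB BF)
    show "M \<in> hom F magnus_group" by (rule M(1))
    show "M (b i) = letter_series i" if "i < d" for i
      using M(2)[of "b i"] that f by (auto simp: b_def g_def inv_into_f_f)
  qed
  obtain w where w: "length w = n" "M r w \<noteq> 0" using magnus_detects[OF n r] by blast
  show ?thesis
    using coeff_mult[OF n w(1)] coeff_lcs_Suc[OF n w(1)] w(2)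
    by (intro exI[of _ "\<lambda>x. real_of_int (M x w)"]) (auto simp del: lcs.simps)
qed

section \<open>Bounded cocycles from non-vanishing simplicial volume\<close>

definition subadd_on :: "'v::ab_group_add set \<Rightarrow> ('v \<Rightarrow> real) \<Rightarrow> bool" where
  "subadd_on D p \<longleftrightarrow> (\<forall>x\<in>D. \<forall>y\<in>D. p (x + y) \<le> p x + p y)"

definition nmul :: "nat \<Rightarrow> 'v::ab_group_add \<Rightarrow> 'v" where
  "nmul n x = (\<Sum>i<n. x)"

lemma nmul_simps [simp]: "nmul 0 x = 0" "nmul (Suc n) x = nmul n x + x"
  by (simp_all add: nmul_def add.commute)

lemma nmul_add: "nmul (m + n) x = nmul m x + nmul n x"
  by (induction n) (simp_all add: add.assoc)

lemma nmul_distrib: "nmul n (x + y) = nmul n x + nmul n y"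
  by (simp add: nmul_def sum.distrib)

locale add_subgroup =
  fixes D :: "'v::ab_group_add set"
  assumes zero: "0 \<in> D" and add: "x \<in> D \<Longrightarrow> y \<in> D \<Longrightarrow> x + y \<in> D" and minus: "x \<in> D \<Longrightarrow> - x \<in> D"
begin

lemma nmul_D: "x \<in> D \<Longrightarrow> nmul n x \<in> D"
  by (induction n) (auto intro: zero add)

lemma subaddD: "subadd_on D p \<Longrightarrow> x \<in> D \<Longrightarrow> y \<in> D \<Longrightarrow> p (x + y) \<le> p x + p y"
  by (auto simp: subadd_on_def)

lemma subadd_minus: "subadd_on D p \<Longrightarrow> x \<in> D \<Longrightarrow> p x \<ge> - p (- x)"
  using subaddD[of p x "- x"] subaddD[of p 0 0] zero minus by fastforce

text \<open>The auxiliary function of the Hahn-Banach argument. For homogeneous \<open>p\<close>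
  along \<open>x\<close> it lies below \<open>p\<close> and is at most \<open>- p x\<close> at
  \<open>- x\<close>, which forces an additive function below it to agree with \<open>p\<close> at
  \<open>x\<close>.\<close>

definition tilt :: "('v \<Rightarrow> real) \<Rightarrow> 'v \<Rightarrow> 'v \<Rightarrow> real" where
  "tilt p x y = (if y \<in> D then INF n. p (y + nmul n x) - real n * p x else 0)"

context
  fixes p x
  assumes p: "subadd_on D p" and x: "x \<in> D" and hom: "\<And>n. p (nmul n x) = real n * p x"
begin

lemma tilt_bdd:
  assumes "y \<in> D"
  shows "bdd_below (range (\<lambda>n. p (y + nmul n x) - real n * p x))"
proof (rule bdd_belowI2)
  fix n
  have "p (nmul n x) \<le> p (y + nmul n x) + p (- y)"
    using subaddD[OF p add[OF assms nmul_D[OF x]] minus[OF assms], of n] by (simp add: algebra_simps)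
  then show "- p (- y) \<le> p (y + nmul n x) - real n * p x" using hom by simp
qed

lemma tilt_le: "y \<in> D \<Longrightarrow> tilt p x y \<le> p (y + nmul n x) - real n * p x"
  unfolding tilt_def using cINF_lower[OF tilt_bdd] by auto

lemma subadd_tilt: "subadd_on D (tilt p x)"
  unfolding subadd_on_def
proof (intro ballI)
  fix y z assume y: "y \<in> D" and z: "z \<in> D"
  have *: "tilt p x (y + z) \<le> (p (y + nmul m x) - real m * p x) + (p (z + nmul n x) - real n * p x)" for m n
  proof -
    have "tilt p x (y + z) \<le> p (y + z + nmul (m + n) x) - real (m + n) * p x"
      by (rule tilt_le) (use add y z in auto)
    also have "p (y + z + nmul (m + n) x) \<le> p (y + nmul m x) + p (z + nmul n x)"
      using subaddD[OF p, of "y + nmul m x" "z + nmul n x"] y z add nmul_D[OF x]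
      by (simp add: nmul_add algebra_simps)
    finally show ?thesis by (simp add: algebra_simps)
  qed
  have "tilt p x (y + z) - (p (y + nmul m x) - real m * p x) \<le> tilt p x z" for m
    unfolding tilt_def[of p x z] using z *[of m] by (simp, intro cINF_greatest) (auto simp: algebra_simps)
  then have "tilt p x (y + z) - tilt p x z \<le> tilt p x y"
    unfolding tilt_def[of p x y] using y by (simp, intro cINF_greatest) (auto simp: algebra_simps)
  then show "tilt p x (y + z) \<le> tilt p x y + tilt p x z" by simp
qed

end

text \<open>The core of the Hahn-Banach theorem: a minimal subadditive function cannot be lowered by tilting it
  in the direction of \<open>x\<close>, and this forces additivity.\<close>
lemma minimal_subadd_additive:
  assumes m: "subadd_on D m" and off: "\<And>x. x \<notin> D \<Longrightarrow> m x = 0"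
    and min: "\<And>p. subadd_on D p \<Longrightarrow> (\<And>x. x \<notin> D \<Longrightarrow> p x = 0) \<Longrightarrow> (\<And>x. p x \<le> m x) \<Longrightarrow> p = m"
    and x: "x \<in> D" and y: "y \<in> D"
  shows "m (x + y) = m x + m y"
proof -
  have m0: "m 0 \<ge> 0" using subaddD[OF m zero zero] by simp
  have mult: "m (nmul n z) \<le> real n * m z" if "z \<in> D" "n \<ge> 1" for n z
    using that(2)
  proof (induction n rule: dec_induct)
    case (step n)
    then show ?case using subaddD[OF m nmul_D[OF that(1)] that(1), of n] by (simp add: algebra_simps)
  qed simp
  have hom1: "m (nmul n z) = real n * m z" if n: "n \<ge> 1" and z: "z \<in> D" for n z
  proof -
    \<comment> \<open>Averaging over multiples gives a subadditive function below \<open>m\<close>.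
      Minimality then yields the homogeneity of \<open>m\<close> that \<open>tilt\<close>
      requires.\<close>
    let ?p = "\<lambda>z. if z \<in> D then m (nmul n z) / real n else 0"
    have "?p = m"
    proof (rule min)
      show "subadd_on D ?p" unfolding subadd_on_def
      proof (intro ballI)
        fix u v assume uv: "u \<in> D" "v \<in> D"
        have "m (nmul n (u + v)) \<le> m (nmul n u) + m (nmul n v)"
          using subaddD[OF m nmul_D[OF uv(1)] nmul_D[OF uv(2)]] by (simp add: nmul_distrib)
        then show "?p (u + v) \<le> ?p u + ?p v"
          using uv add n by (simp add: add_divide_distrib[symmetric] divide_right_mono)
      qed
      show "?p z \<le> m z" for z using mult[of z n] n off by (simp add: field_simps)
    qed auto
    then have "?p z = m z" by (rule fun_cong)
    then show ?thesis using z n by (simp add: field_simps)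
  qed
  have "m 0 = 0" using hom1[of 2 0] zero by (simp add: nmul_def)
  then have hom: "m (nmul n x) = real n * m x" for n using hom1[of n x] x by (cases n) auto
  have "tilt m x = m"
  proof (rule min[OF subadd_tilt[OF m x hom]])
    show "tilt m x z \<le> m z" for z
      using tilt_le[OF m x hom, of z 0] off by (cases "z \<in> D") (auto simp: tilt_def)
  qed (simp add: tilt_def)
  then have "m y \<le> m (y + x) - m x" using tilt_le[OF m x hom y, of 1] by simp
  then show ?thesis using subaddD[OF m x y] by (simp add: add.commute)
qed

text \<open>Zorn's lemma for the reversed order. The infimum over a chain is finite because every
  subadditive \<open>q\<close> below \<open>p\<close> satisfies \<open>q x \<ge> - p (- x)\<close>;
  fixing the values outside \<open>D\<close> makes minimality an equality of functions.\<close>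

lemma exists_minimal_subadd:
  assumes p: "subadd_on D p" "\<And>x. x \<notin> D \<Longrightarrow> p x = 0"
  shows "\<exists>m. subadd_on D m \<and> (\<forall>x. x \<notin> D \<longrightarrow> m x = 0) \<and> (\<forall>x. m x \<le> p x) \<and>
    (\<forall>p'. subadd_on D p' \<longrightarrow> (\<forall>x. x \<notin> D \<longrightarrow> p' x = 0) \<longrightarrow> (\<forall>x. p' x \<le> m x) \<longrightarrow> p' = m)"
proof -
  define A where "A = {q. subadd_on D q \<and> (\<forall>x. x \<notin> D \<longrightarrow> q x = 0) \<and> (\<forall>x. q x \<le> p x)}"
  define R where "R = (\<lambda>a b :: 'v \<Rightarrow> real. \<forall>x. b x \<le> a x)"
  have lower: "q x \<ge> - p (- x)" if "q \<in> A" "x \<in> D" for q x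
    using subadd_minus[of q x] that by (auto simp: A_def) (meson neg_le_iff_le order_trans)
  have "\<exists>m\<in>A. \<forall>a\<in>A. R m a \<longrightarrow> a = m"
  proof (rule predicate_Zorn)
    show "partial_order_on A (relation_of R A)"
      unfolding partial_order_on_def preorder_on_def refl_on_def trans_def antisym_def relation_of_def R_def
      by (auto intro: order_trans intro!: ext antisym)
    fix C assume C: "C \<in> Chains (relation_of R A)"
    then have CA: "C \<subseteq> A" by (auto simp: Chains_def relation_of_def)
    show "\<exists>u\<in>A. \<forall>a\<in>C. R a u"
    proof (cases "C = {}")
      case True
      then show ?thesis using p by (auto simp: A_def)
    next
      case False
      define u where "u x = (if x \<in> D then INF q\<in>C. q x else 0)" for x
      have bdd: "bdd_below ((\<lambda>q. q x) ` C)" if "x \<in> D" for x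
        using lower that CA by (intro bdd_belowI2[of _ "- p (- x)"]) auto
      have le: "u x \<le> q x" if "q \<in> C" for q x
        using that CA cINF_lower[OF bdd, of x q] by (auto simp: u_def A_def)
      have "subadd_on D u" unfolding subadd_on_def
      proof (intro ballI)
        fix x y assume xy: "x \<in> D" "y \<in> D"
        have *: "u (x + y) \<le> q x + q' y" if q: "q \<in> C" "q' \<in> C" for q q'
        proof -
          have "(\<forall>z. q z \<le> q' z) \<or> (\<forall>z. q' z \<le> q z)"
            using C q by (auto simp: Chains_def relation_of_def R_def)
          then show ?thesis
          proof
            assume h: "\<forall>z. q z \<le> q' z"
            have "u (x + y) \<le> q x + q y" using le[OF q(1), of "x + y"] q CA xy subaddD[of q x y]
              by (auto simp: A_def intro: order_trans)
            then show ?thesis using h by (meson add_left_mono order_trans)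
          next
            assume h: "\<forall>z. q' z \<le> q z"
            have "u (x + y) \<le> q' x + q' y" using le[OF q(2), of "x + y"] q CA xy subaddD[of q' x y]
              by (auto simp: A_def intro: order_trans)
            then show ?thesis using h by (meson add_right_mono order_trans)
          qed
        qed
        have "u (x + y) - q x \<le> u y" if "q \<in> C" for q
          unfolding u_def[of y] using xy *[OF that] False by (simp, intro cINF_greatest) (auto simp: algebra_simps)
        then have "u (x + y) - u y \<le> u x"
          unfolding u_def[of x] using xy False by (simp, intro cINF_greatest) (auto simp: algebra_simps)
        then show "u (x + y) \<le> u x + u y" by simp
      qed
      moreover have "u x \<le> p x" for x
      proof -
        obtain q where q: "q \<in> C" using False by blast
        then have "q x \<le> p x" using CA by (auto simp: A_def)
        then show ?thesis using le[OF q, of x] by simp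
      qed
      ultimately have "u \<in> A" by (auto simp: A_def u_def)
      then show ?thesis using le by (auto simp: R_def)
    qed
  qed
  then obtain m where m: "m \<in> A" "\<And>a. a \<in> A \<Longrightarrow> R m a \<Longrightarrow> a = m" by blast
  have "p' = m" if "subadd_on D p'" "\<forall>x. x \<notin> D \<longrightarrow> p' x = 0" "\<forall>x. p' x \<le> m x" for p'
    using m that by (intro m(2)) (auto simp: A_def R_def intro: order_trans)
  then show ?thesis using m(1) by (auto simp: A_def)
qed

text \<open>Additivity can replace real linearity because the cycle to be paired with has integer
  coefficients.\<close>

theorem additive_minorant:
  assumes p: "subadd_on D p" and x: "x \<in> D" and hom: "\<And>n. p (nmul n x) = real n * p x"
  shows "\<exists>f. (\<forall>y\<in>D. \<forall>z\<in>D. f (y + z) = f y + f z) \<and> (\<forall>y\<in>D. f y \<le> p y) \<and> f x = p x"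
proof -
  from exists_minimal_subadd[OF subadd_tilt[OF p x hom]] obtain f where f: "subadd_on D f"
    "\<And>x. x \<notin> D \<Longrightarrow> f x = 0" "\<And>y. f y \<le> tilt p x y"
    "\<And>p'. subadd_on D p' \<Longrightarrow> (\<And>x. x \<notin> D \<Longrightarrow> p' x = 0) \<Longrightarrow> (\<And>x. p' x \<le> f x) \<Longrightarrow> p' = f"
    unfolding tilt_def by (auto simp: tilt_def)
  have add: "f (y + z) = f y + f z" if "y \<in> D" "z \<in> D" for y z
    by (rule minimal_subadd_additive[OF f(1,2,4) that])
  have le: "f y \<le> p y" if "y \<in> D" for y using f(3)[of y] tilt_le[OF p x hom that, of 0] by simp
  have "f (- x) \<le> - p x"
    using f(3)[of "- x"] tilt_le[OF p x hom minus[OF x], of 1] hom[of 0] by simp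
  moreover have "f x + f (- x) = 0" using add[OF x minus[OF x]] add[OF zero zero] by simp
  ultimately have "f x = p x" using le[OF x] by simp
  then show ?thesis using add le by blast
qed

lemma additive_int:
  assumes f: "\<forall>y\<in>D. \<forall>z\<in>D. f (y + z) = (f y + f z :: real)" and x: "x \<in> D"
  shows "f 0 = 0" "f (- x) = - f x" "f (nmul n x) = real n * f x"
proof -
  show f0: "f 0 = 0" using f zero by (metis add.right_neutral add_cancel_left_left)
  have "f (x + - x) = f x + f (- x)" using f x minus[OF x] by blast
  then show "f (- x) = - f x" using f0 by simp
  show "f (nmul n x) = real n * f x"
    by (induction n) (simp_all add: f0 f nmul_D x algebra_simps)
qed

end

section \<open>Duality between the l1-seminorm and bounded cocycles\<close>

definition single :: "'c \<Rightarrow> 'r::zero \<Rightarrow> 'c \<Rightarrow> 'r" where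
  "single \<sigma> a = (\<lambda>\<tau>. if \<tau> = \<sigma> then a else 0)"

lemma chain_supp_single: "chain_supp (single \<sigma> a) \<subseteq> {\<sigma>}"
  by (auto simp: chain_supp_def single_def)

lemma is_chain_single: "\<sigma> \<in> S \<Longrightarrow> is_chain S (single \<sigma> a)"
  using chain_supp_single[of \<sigma> a] by (auto simp: is_chain_def intro: finite_subset)

lemma chain_supp_add: "chain_supp (x + y :: 'c \<Rightarrow> real) \<subseteq> chain_supp x \<union> chain_supp y"
  by (auto simp: chain_supp_def)

lemma is_chain_add: "is_chain S x \<Longrightarrow> is_chain S y \<Longrightarrow> is_chain S (x + y :: 'c \<Rightarrow> real)"
  using chain_supp_add[of x y] by (auto simp: is_chain_def intro: finite_subset)

lemma is_chain_scale: "is_chain S x \<Longrightarrow> is_chain S (\<lambda>\<sigma>. a * x \<sigma> :: real)"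
  by (auto simp: is_chain_def chain_supp_def intro: finite_subset[of _ "chain_supp x"])

lemma is_chain_zero: "is_chain S (0 :: 'c \<Rightarrow> real)"
  by (simp add: is_chain_def chain_supp_def)

lemma add_subgroup_chains: "add_subgroup {c :: 'c \<Rightarrow> real. is_chain S c}"
proof
  fix x :: "'c \<Rightarrow> real" assume "x \<in> {c. is_chain S c}"
  then show "- x \<in> {c. is_chain S c}" using is_chain_scale[of S x "-1"] by (simp add: fun_Compl_def)
qed (auto intro: is_chain_zero is_chain_add)

lemma l1norm_superset:
  "finite A \<Longrightarrow> chain_supp c \<subseteq> A \<Longrightarrow> l1norm c = (\<Sum>\<sigma>\<in>A. \<bar>c \<sigma>\<bar>)"
  unfolding l1norm_def by (rule sum.mono_neutral_left) (auto simp: chain_supp_def)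

lemma l1norm_add:
  assumes "is_chain S x" "is_chain S y"
  shows "l1norm (x + y) \<le> l1norm x + l1norm y"
proof -
  let ?A = "chain_supp x \<union> chain_supp y"
  have A: "finite ?A" using assms by (simp add: is_chain_def)
  have "l1norm (x + y) = (\<Sum>\<sigma>\<in>?A. \<bar>x \<sigma> + y \<sigma>\<bar>)"
    using l1norm_superset[OF A chain_supp_add] by simp
  also have "\<dots> \<le> (\<Sum>\<sigma>\<in>?A. \<bar>x \<sigma>\<bar> + \<bar>y \<sigma>\<bar>)" by (intro sum_mono abs_triangle_ineq)
  also have "\<dots> = l1norm x + l1norm y"
    using l1norm_superset[OF A, of x] l1norm_superset[OF A, of y] by (simp add: sum.distrib)
  finally show ?thesis .
qed

lemma l1norm_scale:
  assumes "is_chain S x"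
  shows "l1norm (\<lambda>\<sigma>. a * x \<sigma>) = \<bar>a\<bar> * l1norm x"
proof -
  have "l1norm (\<lambda>\<sigma>. a * x \<sigma>) = (\<Sum>\<sigma>\<in>chain_supp x. \<bar>a * x \<sigma>\<bar>)"
    using assms by (intro l1norm_superset) (auto simp: is_chain_def chain_supp_def)
  then show ?thesis by (simp add: l1norm_def sum_distrib_left abs_mult)
qed

lemma l1norm_nonneg: "l1norm c \<ge> 0"
  by (simp add: l1norm_def sum_nonneg)

definition wt3 :: "('g, 'm) monoid_scheme \<Rightarrow> 'g \<times> 'g \<times> 'g \<Rightarrow> 'g \<times> 'g \<Rightarrow> real" where
  "wt3 G \<sigma> p = (case \<sigma> of (x, y, w) \<Rightarrow>
      (if (y, w) = p then 1 else 0) - (if (x \<otimes>\<^bsub>G\<^esub> y, w) = p then 1 else 0)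
       + (if (x, y \<otimes>\<^bsub>G\<^esub> w) = p then 1 else 0) - (if (x, y) = p then 1 else 0))"

lemma bd3_superset:
  assumes "finite A" "chain_supp z \<subseteq> A"
  shows "bd3 G z p = (\<Sum>\<sigma>\<in>A. z \<sigma> * wt3 G \<sigma> p)"
proof -
  have "bd3 G z p = (\<Sum>\<sigma>\<in>chain_supp z. z \<sigma> * wt3 G \<sigma> p)"
    unfolding bd3_def wt3_def by (intro sum.cong) (auto split: prod.splits)
  also have "\<dots> = (\<Sum>\<sigma>\<in>A. z \<sigma> * wt3 G \<sigma> p)"
    by (rule sum.mono_neutral_left) (use assms in \<open>auto simp: chain_supp_def\<close>)
  finally show ?thesis .
qed

lemma bd3_add:
  assumes "is_chain S x" "is_chain S y"
  shows "bd3 G (x + y :: _ \<Rightarrow> real) = bd3 G x + bd3 G y"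
proof
  fix p
  let ?A = "chain_supp x \<union> chain_supp y"
  have A: "finite ?A" using assms by (simp add: is_chain_def)
  show "bd3 G (x + y) p = (bd3 G x + bd3 G y) p"
    using bd3_superset[OF A, of "x + y" G p] bd3_superset[OF A, of x G p] bd3_superset[OF A, of y G p]
      chain_supp_add[of x y] by (simp add: sum.distrib algebra_simps)
qed

lemma bd3_scale:
  assumes "is_chain S x"
  shows "bd3 G (\<lambda>\<sigma>. a * x \<sigma> :: real) = (\<lambda>p. a * bd3 G x p)"
proof
  fix p
  have A: "finite (chain_supp x)" using assms by (simp add: is_chain_def)
  show "bd3 G (\<lambda>\<sigma>. a * x \<sigma>) p = a * bd3 G x p"
    using bd3_superset[OF A, of "\<lambda>\<sigma>. a * x \<sigma>" G p] bd3_superset[OF A, of x G p]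
    by (simp add: sum_distrib_left chain_supp_def Collect_mono mult.assoc)
qed

lemma bd3_single:
  "bd3 G (single (x, y, w) 1) = (\<lambda>p. single (y, w) 1 p - single (x \<otimes>\<^bsub>G\<^esub> y, w) 1 p
     + single (x, y \<otimes>\<^bsub>G\<^esub> w) 1 p - single (x, y) 1 p :: real)"
proof
  fix p
  show "bd3 G (single (x, y, w) 1) p = (single (y, w) 1 p - single (x \<otimes>\<^bsub>G\<^esub> y, w) 1 p
     + single (x, y \<otimes>\<^bsub>G\<^esub> w) 1 p - single (x, y) 1 p :: real)"
    by (subst bd3_superset[OF _ chain_supp_single]) (auto simp: single_def wt3_def)
qed

lemma is_boundary2_add:
  "is_boundary2 G x \<Longrightarrow> is_boundary2 G y \<Longrightarrow> is_boundary2 G (x + y :: _ \<Rightarrow> real)"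
  unfolding is_boundary2_def using is_chain_add bd3_add by metis

lemma is_boundary2_scale:
  "is_boundary2 G x \<Longrightarrow> is_boundary2 G (\<lambda>\<sigma>. a * x \<sigma> :: real)"
proof -
  assume "is_boundary2 G x"
  then obtain z where "is_chain (carrier G \<times> carrier G \<times> carrier G) z" "x = bd3 G z"
    by (auto simp: is_boundary2_def)
  then show ?thesis using is_chain_scale[of _ z a] bd3_scale[of _ z G a]
    by (auto simp: is_boundary2_def intro!: exI[of _ "\<lambda>\<sigma>. a * z \<sigma>"])
qed

lemma is_boundary2_zero: "is_boundary2 G (0 :: _ \<Rightarrow> real)"
  unfolding is_boundary2_def by (intro exI[of _ 0]) (auto simp: is_chain_zero bd3_def chain_supp_def)

definition hom_class :: "('g, 'm) monoid_scheme \<Rightarrow> ('g \<times> 'g \<Rightarrow> real) \<Rightarrow> ('g \<times> 'g \<Rightarrow> real) set" where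
  "hom_class G c = {c'. is_chain (carrier G \<times> carrier G) c' \<and> is_boundary2 G (\<lambda>\<sigma>. c' \<sigma> - c \<sigma>)}"

lemma l1_seminorm_hom_class: "l1_seminorm G c = (INF c'\<in>hom_class G c. l1norm c')"
  unfolding l1_seminorm_def hom_class_def by (simp add: setcompr_eq_image)

lemma hom_class_bdd: "bdd_below (l1norm ` hom_class G c)"
  by (rule bdd_belowI2[of _ 0]) (rule l1norm_nonneg)

lemma hom_class_self: "is_chain (carrier G \<times> carrier G) c \<Longrightarrow> c \<in> hom_class G c"
  using is_boundary2_zero[of G] by (simp add: hom_class_def zero_fun_def)

lemma l1_seminorm_le: "c' \<in> hom_class G c \<Longrightarrow> l1_seminorm G c \<le> l1norm c'"
  unfolding l1_seminorm_hom_class by (rule cINF_lower[OF hom_class_bdd])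

lemma l1_seminorm_ge:
  assumes "is_chain (carrier G \<times> carrier G) c" "\<And>c'. c' \<in> hom_class G c \<Longrightarrow> m \<le> l1norm c'"
  shows "m \<le> l1_seminorm G c"
  unfolding l1_seminorm_hom_class using hom_class_self[OF assms(1)] assms(2)
  by (intro cINF_greatest) auto

lemma l1_seminorm_subadd: "subadd_on {c. is_chain (carrier G \<times> carrier G) c} (l1_seminorm G)"
  unfolding subadd_on_def
proof (intro ballI)
  let ?S = "carrier G \<times> carrier G"
  fix x y :: "_ \<Rightarrow> real" assume "x \<in> {c. is_chain ?S c}" "y \<in> {c. is_chain ?S c}"
  then have xy: "is_chain ?S x" "is_chain ?S y" by auto
  have *: "l1_seminorm G (x + y) \<le> l1norm x' + l1norm y'" if "x' \<in> hom_class G x" "y' \<in> hom_class G y" for x' y'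
  proof -
    have "(\<lambda>\<sigma>. (x' + y') \<sigma> - (x + y) \<sigma>) = (\<lambda>\<sigma>. x' \<sigma> - x \<sigma>) + (\<lambda>\<sigma>. y' \<sigma> - y \<sigma>)" by (rule ext) simp
    then have "x' + y' \<in> hom_class G (x + y)"
      using that is_boundary2_add is_chain_add unfolding hom_class_def by fastforce
    then have "l1_seminorm G (x + y) \<le> l1norm (x' + y')" by (rule l1_seminorm_le)
    also have "\<dots> \<le> l1norm x' + l1norm y'" using that by (intro l1norm_add) (auto simp: hom_class_def)
    finally show ?thesis .
  qed
  have "l1_seminorm G (x + y) - l1norm x' \<le> l1_seminorm G y" if "x' \<in> hom_class G x" for x'
    using *[OF that] by (intro l1_seminorm_ge[OF xy(2)]) (auto simp: algebra_simps)
  then have "l1_seminorm G (x + y) - l1_seminorm G y \<le> l1_seminorm G x"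
    by (intro l1_seminorm_ge[OF xy(1)]) (auto simp: algebra_simps)
  then show "l1_seminorm G (x + y) \<le> l1_seminorm G x + l1_seminorm G y" by simp
qed

lemma nmul_fun: "nmul n x = (\<lambda>\<sigma>. real n * x \<sigma>)"
  by (induction n) (auto simp: fun_eq_iff algebra_simps)

lemma l1_seminorm_zero: "l1_seminorm G 0 = 0"
proof (rule antisym)
  show "l1_seminorm G 0 \<le> 0"
    using l1_seminorm_le[OF hom_class_self[OF is_chain_zero]] by (simp add: l1norm_def chain_supp_def)
  show "0 \<le> l1_seminorm G 0" by (rule l1_seminorm_ge[OF is_chain_zero l1norm_nonneg])
qed

lemma l1_seminorm_nmul:
  assumes c: "is_chain (carrier G \<times> carrier G) c"
  shows "l1_seminorm G (nmul n c) = real n * l1_seminorm G c"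
proof (cases "n = 0")
  case False
  interpret add_subgroup "{c :: _ \<Rightarrow> real. is_chain (carrier G \<times> carrier G) c}" by (rule add_subgroup_chains)
  show ?thesis
  proof (rule antisym)
    show "l1_seminorm G (nmul n c) \<le> real n * l1_seminorm G c"
    proof (induction n)
      case (Suc n)
      have "l1_seminorm G (nmul n c + c) \<le> l1_seminorm G (nmul n c) + l1_seminorm G c"
        using nmul_D[of c n] c by (intro subaddD[OF l1_seminorm_subadd]) auto
      then show ?case unfolding nmul_simps using Suc by (simp only: of_nat_Suc distrib_right)
    qed (simp only: nmul_simps l1_seminorm_zero of_nat_0 mult_zero_left order_refl)
    show "real n * l1_seminorm G c \<le> l1_seminorm G (nmul n c)"
    proof (rule l1_seminorm_ge)
      show "is_chain (carrier G \<times> carrier G) (nmul n c)" using nmul_D c by auto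
      fix c' assume c': "c' \<in> hom_class G (nmul n c)"
      define d where "d = (\<lambda>\<sigma>. (1 / real n) * c' \<sigma>)"
      have "(\<lambda>\<sigma>. d \<sigma> - c \<sigma>) = (\<lambda>\<sigma>. (1 / real n) * (c' \<sigma> - nmul n c \<sigma>))"
        using False by (auto simp: d_def nmul_fun field_simps)
      then have "d \<in> hom_class G c"
        using c' is_boundary2_scale[of G "\<lambda>\<sigma>. c' \<sigma> - nmul n c \<sigma>" "1 / real n"]
          is_chain_scale[of _ c' "1 / real n"]
        unfolding hom_class_def d_def[symmetric] by simp
      then have "l1_seminorm G c \<le> l1norm d" by (rule l1_seminorm_le)
      also have "l1norm d = l1norm c' / real n"
        using c' l1norm_scale[of _ c' "1 / real n"] by (auto simp: hom_class_def d_def)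
      finally show "real n * l1_seminorm G c \<le> l1norm c'" using False by (simp add: field_simps)
    qed
  qed
qed (simp add: l1_seminorm_zero)

lemma sum_single:
  assumes "finite (chain_supp c)"
  shows "c = (\<Sum>\<sigma>\<in>chain_supp c. single \<sigma> (c \<sigma> :: real))"
proof
  fix \<tau>
  have "(\<Sum>\<sigma>\<in>A. single \<sigma> (c \<sigma>)) \<tau> = (\<Sum>\<sigma>\<in>A. single \<sigma> (c \<sigma>) \<tau>)" if "finite A" for A
    using that by (induction rule: finite_induct) auto
  then have "(\<Sum>\<sigma>\<in>chain_supp c. single \<sigma> (c \<sigma>)) \<tau> = (\<Sum>\<sigma>\<in>chain_supp c. if \<tau> = \<sigma> then c \<sigma> else 0)"
    using assms by (simp add: single_def)
  also have "\<dots> = c \<tau>" using assms by (simp add: chain_supp_def)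
  finally show "c \<tau> = (\<Sum>\<sigma>\<in>chain_supp c. single \<sigma> (c \<sigma>)) \<tau>" ..
qed

text \<open>Let \<open>f\<close> be additive below the l1-seminorm, with equality at
  \<open>c\<close>. It is bounded by 1 on simplices, which have norm 1, and it kills boundaries,
  which have seminorm zero; so its values on simplices form a cocycle.\<close>

theorem bounded_cocycle:
  fixes c :: "'g \<times> 'g \<Rightarrow> int" and G :: "('g, 'm) monoid_scheme"
  assumes G: "group G" and c: "is_chain (carrier G \<times> carrier G) c"
    and nz: "l1_seminorm G (\<lambda>\<sigma>. real_of_int (c \<sigma>)) \<noteq> 0"
  obtains \<kappa> where "\<And>x y. x \<in> carrier G \<Longrightarrow> y \<in> carrier G \<Longrightarrow> \<bar>\<kappa> (x, y)\<bar> \<le> (1::real)"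
    "\<And>x y w. x \<in> carrier G \<Longrightarrow> y \<in> carrier G \<Longrightarrow> w \<in> carrier G \<Longrightarrow>
       \<kappa> (y, w) - \<kappa> (x \<otimes>\<^bsub>G\<^esub> y, w) + \<kappa> (x, y \<otimes>\<^bsub>G\<^esub> w) - \<kappa> (x, y) = 0"
    "(\<Sum>\<sigma>\<in>chain_supp c. real_of_int (c \<sigma>) * \<kappa> \<sigma>) \<noteq> 0"
proof -
  interpret G: group G by fact
  let ?S = "carrier G \<times> carrier G" and ?c = "\<lambda>\<sigma>. real_of_int (c \<sigma>)"
  let ?D = "{c :: 'g \<times> 'g \<Rightarrow> real. is_chain ?S c}"
  interpret add_subgroup ?D by (rule add_subgroup_chains)
  have supp: "chain_supp ?c = chain_supp c" by (simp add: chain_supp_def)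
  have cr: "is_chain ?S ?c" using c by (simp add: is_chain_def supp)
  then have "?c \<in> ?D" by simp
  then obtain f where f0: "\<forall>y\<in>?D. \<forall>z\<in>?D. f (y + z) = f y + f z"
    and f2: "\<forall>y\<in>?D. f y \<le> l1_seminorm G y" and f3: "f ?c = l1_seminorm G ?c"
    using additive_minorant[OF l1_seminorm_subadd, of ?c] l1_seminorm_nmul[OF cr] by blast
  have f1: "f (y + z) = f y + f z" if "y \<in> ?D" "z \<in> ?D" for y z using f0 that by blast
  note f = f1 f2[rule_format] f3
  note fi = additive_int[OF f0]
  define \<kappa> where "\<kappa> \<sigma> = f (single \<sigma> 1)" for \<sigma>
  have sD: "single \<sigma> a \<in> ?D" if "\<sigma> \<in> ?S" for \<sigma> and a :: real using is_chain_single[OF that] by simp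
  have bound: "f y \<le> l1norm y" if "y \<in> ?D" for y
    using f(2)[OF that] l1_seminorm_le[OF hom_class_self, of G y] that by auto
  have l1: "l1norm (single \<sigma> a) = \<bar>a\<bar>" for \<sigma> :: "'g \<times> 'g" and a
    by (subst l1norm_superset[OF _ chain_supp_single]) (auto simp: single_def)
  show thesis
  proof
    fix x y assume xy: "x \<in> carrier G" "y \<in> carrier G"
    have "- single (x, y) 1 = single (x, y) (- 1 :: real)" by (auto simp: single_def fun_eq_iff)
    then have "- \<kappa> (x, y) = f (single (x, y) (-1))" using fi(2)[OF sD[of "(x, y)" 1]] xy by (simp add: \<kappa>_def)
    then show "\<bar>\<kappa> (x, y)\<bar> \<le> 1"
      using bound[OF sD[of "(x, y)" 1]] bound[OF sD[of "(x, y)" "-1"]] xy by (simp add: l1 \<kappa>_def)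
  next
    \<comment> \<open>The seminorm bounds \<open>f\<close> only from above; using this for a
      boundary and for its negative gives equality.\<close>
    have bd: "f (bd3 G z) \<le> 0" if z: "is_chain (carrier G \<times> carrier G \<times> carrier G) z" "bd3 G z \<in> ?D" for z
    proof -
      have "is_boundary2 G (\<lambda>\<sigma>. 0 \<sigma> - bd3 G z \<sigma>)"
        using is_boundary2_scale[of G "bd3 G z" "-1"] z(1) by (auto simp: is_boundary2_def)
      then have "l1_seminorm G (bd3 G z) \<le> l1norm (0 :: 'g \<times> 'g \<Rightarrow> real)"
        by (intro l1_seminorm_le) (simp add: hom_class_def is_chain_zero)
      then show ?thesis using f(2)[OF z(2)] by (simp add: l1norm_def chain_supp_def)
    qed
    fix x y w assume xyw: "x \<in> carrier G" "y \<in> carrier G" "w \<in> carrier G"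
    let ?z = "single (x, y, w) (1::real)"
    let ?b = "single (y, w) 1 + (single (x, y \<otimes>\<^bsub>G\<^esub> w) 1 + (- single (x \<otimes>\<^bsub>G\<^esub> y, w) 1 + - single (x, y) (1::real)))"
    have zc: "is_chain (carrier G \<times> carrier G \<times> carrier G) ?z" using xyw by (intro is_chain_single) auto
    have b: "bd3 G ?z = ?b" unfolding bd3_single by (rule ext) simp
    have D: "single (y, w) (1::real) \<in> ?D" "single (x, y \<otimes>\<^bsub>G\<^esub> w) (1::real) \<in> ?D"
      "single (x \<otimes>\<^bsub>G\<^esub> y, w) (1::real) \<in> ?D" "single (x, y) (1::real) \<in> ?D"
      using xyw by (auto intro!: is_chain_single)
    have bD: "?b \<in> ?D" using D by (intro add minus)
    have fb: "f ?b = \<kappa> (y, w) + (\<kappa> (x, y \<otimes>\<^bsub>G\<^esub> w) + (- \<kappa> (x \<otimes>\<^bsub>G\<^esub> y, w) + - \<kappa> (x, y)))"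
      by (simp only: f(1) D add minus fi(2) \<kappa>_def)
    have "f ?b \<le> 0" using bd[OF zc] b bD by simp
    moreover have "- f ?b \<le> 0"
    proof -
      have "bd3 G (\<lambda>\<sigma>. -1 * ?z \<sigma>) = - ?b" unfolding bd3_scale[OF zc] b by (rule ext) simp
      then have "f (- ?b) \<le> 0" using bd[OF is_chain_scale[OF zc, of "-1"]] minus[OF bD] by simp
      then show ?thesis unfolding fi(2)[OF bD] .
    qed
    ultimately show "\<kappa> (y, w) - \<kappa> (x \<otimes>\<^bsub>G\<^esub> y, w) + \<kappa> (x, y \<otimes>\<^bsub>G\<^esub> w) - \<kappa> (x, y) = 0"
      unfolding fb by simp
  next
    have fk: "f (single \<sigma> (real_of_int k)) = real_of_int k * \<kappa> \<sigma>" if "\<sigma> \<in> ?S" for \<sigma> k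
    proof -
      have n: "f (single \<sigma> (real n)) = real n * \<kappa> \<sigma>" for n
      proof -
        have "single \<sigma> (real n) = nmul n (single \<sigma> 1)" by (auto simp: nmul_fun single_def)
        then show ?thesis using fi(3)[OF sD[OF that, of 1]] by (simp add: \<kappa>_def)
      qed
      show ?thesis
      proof (cases k)
        case (nonneg n) then show ?thesis using n by simp
      next
        case (neg n)
        have k: "real_of_int k = - real (Suc n)" using neg by simp
        have "single \<sigma> (real_of_int k) = - single \<sigma> (real (Suc n))"
          unfolding k by (auto simp: single_def fun_eq_iff)
        then have "f (single \<sigma> (real_of_int k)) = - (real (Suc n) * \<kappa> \<sigma>)" using fi(2)[OF sD[OF that]] n by metis
        then show ?thesis unfolding k by (simp only: mult_minus_left)
      qed
    qed
    have "f (\<Sum>\<sigma>\<in>A. single \<sigma> (?c \<sigma>)) = (\<Sum>\<sigma>\<in>A. ?c \<sigma> * \<kappa> \<sigma>) \<and> (\<Sum>\<sigma>\<in>A. single \<sigma> (?c \<sigma>)) \<in> ?D"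
      if "finite A" "A \<subseteq> ?S" for A
      using that
    proof (induction rule: finite_induct)
      case empty
      then show ?case using fi(1)[OF zero] zero by (simp add: zero_fun_def)
    next
      case (insert \<sigma> A)
      then have "single \<sigma> (?c \<sigma>) \<in> ?D" "(\<Sum>\<sigma>\<in>A. single \<sigma> (?c \<sigma>)) \<in> ?D" "\<sigma> \<in> ?S" using sD by auto
      moreover have "f (\<Sum>\<sigma>\<in>A. single \<sigma> (?c \<sigma>)) = (\<Sum>\<sigma>\<in>A. ?c \<sigma> * \<kappa> \<sigma>)" using insert by simp
      ultimately show ?case by (simp only: sum.insert[OF insert.hyps] f(1) fk add)
    qed
    from this[of "chain_supp ?c"] have "f ?c = (\<Sum>\<sigma>\<in>chain_supp c. ?c \<sigma> * \<kappa> \<sigma>)"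
      using cr sum_single[of ?c] by (simp add: is_chain_def supp)
    then show "(\<Sum>\<sigma>\<in>chain_supp c. ?c \<sigma> * \<kappa> \<sigma>) \<noteq> 0" using nz f(3) by simp
  qed
qed

section \<open>The central extension of \<open>G\<close> by the reals given by a cocycle, and its
  splitting over \<open>F\<close>\<close>

definition twisted_product :: "('g, 'm) monoid_scheme \<Rightarrow> ('g \<times> 'g \<Rightarrow> real) \<Rightarrow> ('g \<times> real) monoid" where
  "twisted_product G \<kappa> = \<lparr>carrier = carrier G \<times> UNIV,
     monoid.mult = (\<lambda>x y. (fst x \<otimes>\<^bsub>G\<^esub> fst y, snd x + snd y + \<kappa> (fst x, fst y))), one = (\<one>\<^bsub>G\<^esub>, 0)\<rparr>"

lemma group_twisted_product:
  assumes "group G"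
    and cocycle: "\<And>x y w. x \<in> carrier G \<Longrightarrow> y \<in> carrier G \<Longrightarrow> w \<in> carrier G \<Longrightarrow>
       \<kappa> (y, w) - \<kappa> (x \<otimes>\<^bsub>G\<^esub> y, w) + \<kappa> (x, y \<otimes>\<^bsub>G\<^esub> w) - \<kappa> (x, y) = 0"
    and one: "\<And>x. x \<in> carrier G \<Longrightarrow> \<kappa> (\<one>\<^bsub>G\<^esub>, x) = 0" "\<And>x. x \<in> carrier G \<Longrightarrow> \<kappa> (x, \<one>\<^bsub>G\<^esub>) = 0"
  shows "group (twisted_product G \<kappa>)"
proof -
  interpret G: group G by fact
  show ?thesis
  proof (rule groupI)
    fix x y z
    assume "x \<in> carrier (twisted_product G \<kappa>)" "y \<in> carrier (twisted_product G \<kappa>)" "z \<in> carrier (twisted_product G \<kappa>)"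
    then have c: "fst x \<in> carrier G" "fst y \<in> carrier G" "fst z \<in> carrier G"
      by (auto simp: twisted_product_def)
    then show "x \<otimes>\<^bsub>twisted_product G \<kappa>\<^esub> y \<otimes>\<^bsub>twisted_product G \<kappa>\<^esub> z =
      x \<otimes>\<^bsub>twisted_product G \<kappa>\<^esub> (y \<otimes>\<^bsub>twisted_product G \<kappa>\<^esub> z)"
      using cocycle[OF c] by (simp add: twisted_product_def G.m_assoc)
  next
    fix x assume "x \<in> carrier (twisted_product G \<kappa>)"
    then have c: "fst x \<in> carrier G" by (auto simp: twisted_product_def)
    then show "\<exists>y\<in>carrier (twisted_product G \<kappa>). y \<otimes>\<^bsub>twisted_product G \<kappa>\<^esub> x = \<one>\<^bsub>twisted_product G \<kappa>\<^esub>"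
      by (intro bexI[of _ "(inv\<^bsub>G\<^esub> (fst x), - snd x - \<kappa> (inv\<^bsub>G\<^esub> (fst x), fst x))"])
         (auto simp: twisted_product_def)
  qed (auto simp: twisted_product_def one)
qed

lemma (in group) normal_closure_normal:
  assumes "S \<subseteq> carrier G"
  shows "normal_closure G S \<lhd> G"
  unfolding normal_closure_def
proof (rule normal_generateI)
  fix h g assume "h \<in> {g \<otimes> s \<otimes> inv g | g s. g \<in> carrier G \<and> s \<in> S}" and g: "g \<in> carrier G"
  then obtain k s where ks: "h = k \<otimes> s \<otimes> inv k" "k \<in> carrier G" "s \<in> S" by auto
  then have "g \<otimes> h \<otimes> inv g = (g \<otimes> k) \<otimes> s \<otimes> inv (g \<otimes> k)"
    using g assms by (simp add: m_assoc inv_mult_group subset_iff)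
  then show "g \<otimes> h \<otimes> inv g \<in> {g \<otimes> s \<otimes> inv g | g s. g \<in> carrier G \<and> s \<in> S}"
    using ks g by blast
qed (use assms in auto)

lemma (in group) normal_closure_incl: "S \<subseteq> carrier G \<Longrightarrow> S \<subseteq> normal_closure G S"
proof
  fix x assume "S \<subseteq> carrier G" "x \<in> S"
  then have "x = \<one> \<otimes> x \<otimes> inv \<one>" by auto
  then show "x \<in> normal_closure G S"
    unfolding normal_closure_def using \<open>x \<in> S\<close> by (blast intro: generate.incl)
qed

text \<open>The bounded cocycle becomes a coboundary over the free group; its primitive is a quasimorphism
  that is additive on \<open>N\<close>. If it vanished at \<open>r\<close>, it would descend to \<open>G\<close> and the cocycle would be
  trivial there as well.\<close>
theorem quasimorphism_of_simplicial_volume: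
  assumes F: "free_group_on F B" and r: "r \<in> carrier F"
    and N: "N = normal_closure F {r}" and G: "G = F Mod N"
    and H2: "H2_infinite_cyclic G" and sv: "simplicial_volume G \<noteq> 0"
  obtains \<phi> :: "'a \<Rightarrow> real"
  where "\<And>x y. x \<in> carrier F \<Longrightarrow> y \<in> carrier F \<Longrightarrow> \<bar>\<phi> (x \<otimes>\<^bsub>F\<^esub> y) - \<phi> x - \<phi> y\<bar> \<le> 2"
    "\<And>x n. x \<in> carrier F \<Longrightarrow> n \<in> N \<Longrightarrow> \<phi> (x \<otimes>\<^bsub>F\<^esub> n) = \<phi> x + \<phi> n"
    "\<And>x n. x \<in> carrier F \<Longrightarrow> n \<in> N \<Longrightarrow> \<phi> (x \<otimes>\<^bsub>F\<^esub> n \<otimes>\<^bsub>F\<^esub> inv\<^bsub>F\<^esub> x) = \<phi> n"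
    "\<phi> r \<noteq> 0"
proof -
  interpret F: group F using F by (simp add: free_group_on_def)
  have BF: "B \<subseteq> carrier F" "generate F B = carrier F" using F by (simp_all add: free_group_on_def)
  have "N \<lhd> F" unfolding N using r by (intro F.normal_closure_normal) auto
  then interpret N: normal N F .
  define \<pi> where "\<pi> x = N #>\<^bsub>F\<^esub> x" for x
  interpret G: group G unfolding G by (rule N.factorgroup_is_group)
  have "\<pi> \<in> hom F G" unfolding \<pi>_def G by (rule N.r_coset_hom_Mod)
  then interpret p: group_hom F G \<pi> by (simp add: group_hom_def group_hom_axioms_def F.group_axioms G.group_axioms)
  have surj: "\<exists>x\<in>carrier F. g = \<pi> x" if "g \<in> carrier G" for g
    using that by (auto simp: G FactGroup_def RCOSETS_def \<pi>_def)
  have ker: "\<pi> n = \<one>\<^bsub>G\<^esub>" if "n \<in> N" for n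
    using that N.rcos_const by (simp add: \<pi>_def G FactGroup_def)
  define c where "c = (SOME c. H2_generator G c)"
  have "H2_generator G c" unfolding c_def using H2 by (metis H2_infinite_cyclic_def someI_ex)
  then have cyc: "is_chain (carrier G \<times> carrier G) c" "bd2 G c = (\<lambda>_. 0)"
    by (auto simp: H2_generator_def is_cycle2_def)
  have c_nz: "l1_seminorm G (\<lambda>\<sigma>. real_of_int (c \<sigma>)) \<noteq> 0" using sv by (simp add: simplicial_volume_def c_def)
  obtain \<kappa>0 where
    \<kappa>0: "\<And>x y. x \<in> carrier G \<Longrightarrow> y \<in> carrier G \<Longrightarrow> \<bar>\<kappa>0 (x, y)\<bar> \<le> (1::real)"
    "\<And>x y w. x \<in> carrier G \<Longrightarrow> y \<in> carrier G \<Longrightarrow> w \<in> carrier G \<Longrightarrow>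
       \<kappa>0 (y, w) - \<kappa>0 (x \<otimes>\<^bsub>G\<^esub> y, w) + \<kappa>0 (x, y \<otimes>\<^bsub>G\<^esub> w) - \<kappa>0 (x, y) = 0"
    "(\<Sum>\<sigma>\<in>chain_supp c. real_of_int (c \<sigma>) * \<kappa>0 \<sigma>) \<noteq> 0"
  proof (rule bounded_cocycle[OF G.group_axioms cyc(1) c_nz], goal_cases)
    case (1 \<kappa>)
    show ?case by (rule 1(1); fact 1)
  qed
  \<comment> \<open>Subtracting the value at the identity normalizes the cocycle, as the unit
    \<open>(\<one>, 0)\<close> of the extension requires; the bound 1 becomes 2.\<close>
  define t where "t = \<kappa>0 (\<one>\<^bsub>G\<^esub>, \<one>\<^bsub>G\<^esub>)"
  define \<kappa> where "\<kappa> \<sigma> = \<kappa>0 \<sigma> - t" for \<sigma>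
  have \<kappa>: "\<bar>\<kappa> (x, y)\<bar> \<le> 2" if "x \<in> carrier G" "y \<in> carrier G" for x y
    using \<kappa>0(1)[OF that] \<kappa>0(1)[OF G.one_closed G.one_closed] by (simp add: \<kappa>_def t_def)
  have cocycle: "\<kappa> (y, w) - \<kappa> (x \<otimes>\<^bsub>G\<^esub> y, w) + \<kappa> (x, y \<otimes>\<^bsub>G\<^esub> w) - \<kappa> (x, y) = 0"
    if "x \<in> carrier G" "y \<in> carrier G" "w \<in> carrier G" for x y w
    using \<kappa>0(2)[OF that] by (simp add: \<kappa>_def)
  have \<kappa>1: "\<kappa> (\<one>\<^bsub>G\<^esub>, g) = 0" "\<kappa> (g, \<one>\<^bsub>G\<^esub>) = 0" if "g \<in> carrier G" for g
    using \<kappa>0(2)[of "\<one>\<^bsub>G\<^esub>" "\<one>\<^bsub>G\<^esub>" g] \<kappa>0(2)[of g "\<one>\<^bsub>G\<^esub>" "\<one>\<^bsub>G\<^esub>"] that by (simp_all add: \<kappa>_def t_def)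
  let ?E = "twisted_product G \<kappa>"
  interpret E: group ?E by (rule group_twisted_product[OF G.group_axioms cocycle \<kappa>1])
  have "(\<lambda>b. (\<pi> b, 0)) ` B \<subseteq> carrier ?E" using BF by (auto simp: twisted_product_def)
  \<comment> \<open>Freeness lifts \<open>\<pi>\<close> to the extension. The second coordinate of
    the lift is the primitive of the cocycle pulled back to \<open>F\<close>.\<close>
  then obtain \<theta> where \<theta>: "\<theta> \<in> hom F ?E" "\<And>b. b \<in> B \<Longrightarrow> \<theta> b = (\<pi> b, 0)"
    using free_group_extend[OF F E.group_axioms, of "\<lambda>b. (\<pi> b, 0)"] by blast
  have "(\<lambda>x. fst (\<theta> x)) \<in> hom F G"
    using \<theta>(1) by (auto simp: hom_def twisted_product_def Pi_iff)
  then have fst: "fst (\<theta> x) = \<pi> x" if "x \<in> carrier F" for x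
    using hom_eq_on_generate[OF F.group_axioms G.group_axioms _ p.homh BF(1), of "\<lambda>x. fst (\<theta> x)" x] \<theta>(2) that BF(2)
    by auto
  define \<phi> where "\<phi> x = snd (\<theta> x)" for x
  have mult: "\<phi> (x \<otimes>\<^bsub>F\<^esub> y) = \<phi> x + \<phi> y + \<kappa> (\<pi> x, \<pi> y)" if "x \<in> carrier F" "y \<in> carrier F" for x y
    using hom_mult[OF \<theta>(1) that] fst that by (simp add: \<phi>_def twisted_product_def)
  have right: "\<phi> (x \<otimes>\<^bsub>F\<^esub> n) = \<phi> x + \<phi> n" if "x \<in> carrier F" "n \<in> N" for x n
    using mult[of x n] that ker[OF that(2)] \<kappa>1 N.mem_carrier by simp
  have left: "\<phi> (n \<otimes>\<^bsub>F\<^esub> x) = \<phi> n + \<phi> x" if "x \<in> carrier F" "n \<in> N" for x n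
    using mult[of n x] that ker[OF that(2)] \<kappa>1 N.mem_carrier by simp
  have conj: "\<phi> (x \<otimes>\<^bsub>F\<^esub> n \<otimes>\<^bsub>F\<^esub> inv\<^bsub>F\<^esub> x) = \<phi> n" if x: "x \<in> carrier F" and n: "n \<in> N" for x n
  proof -
    have "\<phi> (x \<otimes>\<^bsub>F\<^esub> n \<otimes>\<^bsub>F\<^esub> inv\<^bsub>F\<^esub> x \<otimes>\<^bsub>F\<^esub> x) = \<phi> (x \<otimes>\<^bsub>F\<^esub> n \<otimes>\<^bsub>F\<^esub> inv\<^bsub>F\<^esub> x) + \<phi> x"
      by (intro left x N.inv_op_closed2 n)
    moreover have "x \<otimes>\<^bsub>F\<^esub> n \<otimes>\<^bsub>F\<^esub> inv\<^bsub>F\<^esub> x \<otimes>\<^bsub>F\<^esub> x = x \<otimes>\<^bsub>F\<^esub> n" using x n N.mem_carrier by (simp add: F.m_assoc)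
    ultimately show ?thesis using right[OF x n] by simp
  qed
  have "\<phi> r \<noteq> 0"
  proof
    assume r0: "\<phi> r = 0"
    have rN: "r \<in> N" unfolding N using F.normal_closure_incl[of "{r}"] r by auto
    have one: "\<phi> \<one>\<^bsub>F\<^esub> = 0" using right[of "\<one>\<^bsub>F\<^esub>" "\<one>\<^bsub>F\<^esub>"] N.one_closed by simp
    have inv: "\<phi> (inv\<^bsub>F\<^esub> n) = - \<phi> n" if "n \<in> N" for n
      using right[of "inv\<^bsub>F\<^esub> n" n] that N.mem_carrier one by simp
    have zero: "\<phi> n = 0" if n: "n \<in> N" for n
    proof -
      let ?S = "{g \<otimes>\<^bsub>F\<^esub> s \<otimes>\<^bsub>F\<^esub> inv\<^bsub>F\<^esub> g | g s. g \<in> carrier F \<and> s \<in> {r}}"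
      have SN: "?S \<subseteq> N" using N.inv_op_closed2 rN by auto
      have S0: "\<phi> s = 0" if "s \<in> ?S" for s using that conj rN r0 by auto
      have NS: "N = generate F ?S" by (simp only: N normal_closure_def)
      then have gN: "y \<in> N" if "y \<in> generate F ?S" for y using that by (simp only:)
      have "n \<in> generate F ?S" using n NS by (simp only:)
      then show ?thesis
      proof (induction rule: generate.induct)
        case (incl h) then show ?case by (rule S0)
      next
        case (inv h)
        then show ?case using \<open>\<And>n. n \<in> N \<Longrightarrow> \<phi> (inv\<^bsub>F\<^esub> n) = - \<phi> n\<close>[of h] S0[of h] SN by auto
      next
        case (eng x y)
        have xy: "x \<in> N" "y \<in> N" by (rule gN[OF eng(1)], rule gN[OF eng(2)])
        show ?case unfolding right[OF N.mem_carrier[OF xy(1)] xy(2)] eng(3,4) by simp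
      qed (rule one)
    qed
    \<comment> \<open>The shift by \<open>t\<close> undoes the normalization, so that up to sign the
      coboundary of \<open>\<psi>\<close> is the original \<open>\<kappa>0\<close>.\<close>
    define \<psi> where "\<psi> g = \<phi> (SOME x. x \<in> carrier F \<and> g = \<pi> x) - t" for g
    have \<psi>: "\<psi> (\<pi> x) = \<phi> x - t" if x: "x \<in> carrier F" for x
    proof -
      define y where "y = (SOME y. y \<in> carrier F \<and> \<pi> x = \<pi> y)"
      have y: "y \<in> carrier F" "\<pi> x = \<pi> y"
        using someI[of "\<lambda>y. y \<in> carrier F \<and> \<pi> x = \<pi> y" x] x by (auto simp: y_def)
      have "x \<in> N #>\<^bsub>F\<^esub> y" using F.rcos_self[OF x N.subgroup_axioms] y by (simp add: \<pi>_def)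
      then obtain n where n: "n \<in> N" "x = n \<otimes>\<^bsub>F\<^esub> y" by (auto simp: r_coset_def)
      have "\<phi> x = \<phi> y" using left[OF y(1) n(1)] n zero[OF n(1)] by simp
      then show ?thesis by (simp add: \<psi>_def y_def)
    qed
    have \<kappa>\<psi>: "\<kappa>0 (g, h) = \<psi> (g \<otimes>\<^bsub>G\<^esub> h) - \<psi> g - \<psi> h" if gh: "g \<in> carrier G" "h \<in> carrier G" for g h
    proof -
      obtain x y where xy: "x \<in> carrier F" "y \<in> carrier F" "g = \<pi> x" "h = \<pi> y" using surj gh by metis
      then have "\<psi> (g \<otimes>\<^bsub>G\<^esub> h) = \<phi> (x \<otimes>\<^bsub>F\<^esub> y) - t" using \<psi>[of "x \<otimes>\<^bsub>F\<^esub> y"] by simp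
      then show ?thesis using mult[OF xy(1,2)] \<psi>[OF xy(1)] \<psi>[OF xy(2)] xy by (simp add: \<kappa>_def)
    qed
    define T where "T = chain_supp c"
    \<comment> \<open>All faces of simplices in the support of \<open>c\<close>. Exchanging the
      finite sums turns the pairing of \<open>c\<close> with the coboundary of \<open>\<psi>\<close>
      into that of \<open>\<psi>\<close> with the boundary of \<open>c\<close>, which is
      zero.\<close>
    define U where "U = snd ` T \<union> fst ` T \<union> (\<lambda>\<sigma>. fst \<sigma> \<otimes>\<^bsub>G\<^esub> snd \<sigma>) ` T"
    have fin: "finite T" "finite U" and TG: "T \<subseteq> carrier G \<times> carrier G"
      using cyc(1) by (auto simp: T_def U_def is_chain_def)
    have pick: "(\<Sum>h\<in>U. \<psi> h * (if g = h then 1 else 0)) = \<psi> g" if "g \<in> U" for g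
      using that fin by (simp add: sum.delta' if_distrib cong: if_cong)
    have "(\<Sum>\<sigma>\<in>T. real_of_int (c \<sigma>) * (\<psi> (snd \<sigma>) - \<psi> (fst \<sigma> \<otimes>\<^bsub>G\<^esub> snd \<sigma>) + \<psi> (fst \<sigma>))) =
      (\<Sum>\<sigma>\<in>T. \<Sum>h\<in>U. \<psi> h * (real_of_int (c \<sigma>) * ((if snd \<sigma> = h then 1 else 0)
          - (if fst \<sigma> \<otimes>\<^bsub>G\<^esub> snd \<sigma> = h then 1 else 0) + (if fst \<sigma> = h then 1 else 0))))"
    proof (rule sum.cong[OF refl])
      fix \<sigma> assume \<sigma>: "\<sigma> \<in> T"
      then have "snd \<sigma> \<in> U" "fst \<sigma> \<in> U" "fst \<sigma> \<otimes>\<^bsub>G\<^esub> snd \<sigma> \<in> U" by (auto simp: U_def)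
      note [symmetric] = pick[OF this(1)] pick[OF this(2)] pick[OF this(3)]
      note pk = this
      have "\<psi> (snd \<sigma>) - \<psi> (fst \<sigma> \<otimes>\<^bsub>G\<^esub> snd \<sigma>) + \<psi> (fst \<sigma>) =
        (\<Sum>h\<in>U. \<psi> h * (if snd \<sigma> = h then 1 else 0)) - (\<Sum>h\<in>U. \<psi> h * (if fst \<sigma> \<otimes>\<^bsub>G\<^esub> snd \<sigma> = h then 1 else 0))
         + (\<Sum>h\<in>U. \<psi> h * (if fst \<sigma> = h then 1 else 0))" using pk by simp
      then show "real_of_int (c \<sigma>) * (\<psi> (snd \<sigma>) - \<psi> (fst \<sigma> \<otimes>\<^bsub>G\<^esub> snd \<sigma>) + \<psi> (fst \<sigma>)) =
        (\<Sum>h\<in>U. \<psi> h * (real_of_int (c \<sigma>) * ((if snd \<sigma> = h then 1 else 0)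
          - (if fst \<sigma> \<otimes>\<^bsub>G\<^esub> snd \<sigma> = h then 1 else 0) + (if fst \<sigma> = h then 1 else 0))))"
        by (simp only: sum_distrib_left sum_subtractf[symmetric] sum.distrib[symmetric]) (rule sum.cong[OF refl], simp add: algebra_simps)
    qed
    also have "\<dots> = (\<Sum>h\<in>U. \<psi> h * real_of_int (bd2 G c h))"
      by (subst sum.swap) (simp add: bd2_def T_def sum_distrib_left of_int_sum if_distrib[of real_of_int] cong: if_cong)
    also have "\<dots> = 0" by (simp add: cyc(2))
    finally have 0: "(\<Sum>\<sigma>\<in>T. real_of_int (c \<sigma>) * (\<psi> (snd \<sigma>) - \<psi> (fst \<sigma> \<otimes>\<^bsub>G\<^esub> snd \<sigma>) + \<psi> (fst \<sigma>))) = 0" .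
    have "(\<Sum>\<sigma>\<in>T. real_of_int (c \<sigma>) * \<kappa>0 \<sigma>) =
      (\<Sum>\<sigma>\<in>T. - (real_of_int (c \<sigma>) * (\<psi> (snd \<sigma>) - \<psi> (fst \<sigma> \<otimes>\<^bsub>G\<^esub> snd \<sigma>) + \<psi> (fst \<sigma>))))"
    proof (rule sum.cong[OF refl])
      fix \<sigma> assume "\<sigma> \<in> T"
      then have "fst \<sigma> \<in> carrier G" "snd \<sigma> \<in> carrier G" using TG by auto
      then have k: "\<kappa>0 \<sigma> = \<psi> (fst \<sigma> \<otimes>\<^bsub>G\<^esub> snd \<sigma>) - \<psi> (fst \<sigma>) - \<psi> (snd \<sigma>)"
        using \<kappa>\<psi> by fastforce
      show "real_of_int (c \<sigma>) * \<kappa>0 \<sigma> =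
         - (real_of_int (c \<sigma>) * (\<psi> (snd \<sigma>) - \<psi> (fst \<sigma> \<otimes>\<^bsub>G\<^esub> snd \<sigma>) + \<psi> (fst \<sigma>)))"
        unfolding k by (simp add: algebra_simps)
    qed
    then show False using 0 \<kappa>0(3) by (simp add: sum_negf T_def)
  qed
  moreover have "\<bar>\<phi> (x \<otimes>\<^bsub>F\<^esub> y) - \<phi> x - \<phi> y\<bar> \<le> 2" if "x \<in> carrier F" "y \<in> carrier F" for x y
    using mult[OF that] \<kappa>[of "\<pi> x" "\<pi> y"] that by simp
  ultimately show thesis using that right conj by blast
qed

section \<open>Products of commutators depending on an exponent\<close>

context normal
begin

lemma approx_int_pow:
  assumes "approx G H n u v"
  shows "\<exists>k. approx G H k (u [^] (m::int)) (v [^] m)"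
proof (cases m)
  case (nonneg j)
  then show ?thesis using approx_pow[OF assms, of j] by (auto simp: int_pow_int)
next
  case (neg j)
  then show ?thesis using approx_inv[OF approx_pow[OF assms, of "Suc j"]] approx_carrier[OF assms]
    by (metis int_pow_neg_int)
qed

lemma approx_commH: "approx G H n u v \<Longrightarrow> inv u \<otimes> v \<in> commH"
  by (auto simp: approx_def mball_commH)

lemma commH_approx: "u \<in> carrier G \<Longrightarrow> v \<in> carrier G \<Longrightarrow> inv u \<otimes> v \<in> commH \<Longrightarrow> \<exists>n. approx G H n u v"
  by (auto simp: approx_def generate_comm_set)

end

definition comm_word :: "('g, 'm) monoid_scheme \<Rightarrow> 'g list \<Rightarrow> 'g list \<Rightarrow> int \<Rightarrow> 'g" where
  "comm_word G fs fs' m = mprod G (map2 (\<lambda>f f'. commutator G f (f' [^]\<^bsub>G\<^esub> m)) fs fs')"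

lemma comm_word_simps [simp]:
  "comm_word G [] [] m = \<one>\<^bsub>G\<^esub>"
  "comm_word G (f # fs) (f' # fs') m = commutator G f (f' [^]\<^bsub>G\<^esub> m) \<otimes>\<^bsub>G\<^esub> comm_word G fs fs' m"
  by (simp_all add: comm_word_def)

context group
begin

lemma comm_word_closed:
  "length fs' = length fs \<Longrightarrow> set fs \<subseteq> carrier G \<Longrightarrow> set fs' \<subseteq> carrier G \<Longrightarrow> comm_word G fs fs' m \<in> carrier G"
  by (induction fs' fs rule: list_induct2) auto

lemma comm_word_0:
  "length fs' = length fs \<Longrightarrow> set fs \<subseteq> carrier G \<Longrightarrow> set fs' \<subseteq> carrier G \<Longrightarrow> comm_word G fs fs' 0 = \<one>"
  by (induction fs' fs rule: list_induct2) auto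

lemma comm_word_1:
  "length fs' = length fs \<Longrightarrow> set fs \<subseteq> carrier G \<Longrightarrow> set fs' \<subseteq> carrier G \<Longrightarrow>
    comm_word G fs fs' 1 = mprod G (map2 (commutator G) fs fs')"
  by (induction fs' fs rule: list_induct2) (auto simp: int_pow_1)

text \<open>The exponent stays inside the brackets, so the bound is independent of \<open>m\<close>.
  This is why the image of \<open>\<Psi>\<close> is bounded for the ordinary
  \<open>scl\<close>.\<close>

lemma comm_word_mball:
  "length fs' = length fs \<Longrightarrow> set fs \<subseteq> carrier G \<Longrightarrow> set fs' \<subseteq> carrier G \<Longrightarrow>
    comm_word G fs fs' m \<in> mball G (carrier G) (length fs)"
proof (induction fs' fs rule: list_induct2)
  case Nil
  interpret A: normal "carrier G" G by (rule carrier_normal)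
  show ?case by (simp add: A.mball_0)
next
  case (Cons f' fs' f fs)
  interpret A: normal "carrier G" G by (rule carrier_normal)
  have "commutator G f (f' [^] m) \<otimes> comm_word G fs fs' m \<in> mball G (carrier G) (1 + length fs)"
    using Cons by (intro A.mball_mult A.mball_commutator) auto
  then show ?case by simp
qed

end

text \<open>Each bracket costs one commutator for additivity in its second entry and one for passing
  the rest of the first word, uniformly in \<open>m\<close> and \<open>n\<close>.\<close>

lemma (in comm_pair) comm_word_add:
  assumes "length fs' = length fs" "set fs \<subseteq> carrier G" "set fs' \<subseteq> K"
  shows "approx G H (2 * length fs) (comm_word G fs fs' (m + n)) (comm_word G fs fs' m \<otimes> comm_word G fs fs' n)"
  using assms
proof (induction fs' fs rule: list_induct2)
  case (Cons f' fs' f fs)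
  let ?x = "\<lambda>m::int. commutator G f (f' [^] m)" and ?A = "comm_word G fs fs'"
  have f: "f \<in> carrier G" "f' \<in> K" "f' \<in> carrier G" using Cons.prems by auto
  have fK: "f' [^] i \<in> K" for i :: int using subgroup_int_pow_closed[OF K.subgroup_axioms f(2)] .
  have fsK: "set fs' \<subseteq> carrier G" using Cons.prems by auto
  have A: "?A i \<in> carrier G" for i using Cons fsK by (intro comm_word_closed) auto
  have x1: "?x i \<in> carrier G" for i by (rule commutator_closed[OF f(1) int_pow_closed[OF f(3)]])
  have x2: "?x i \<in> H" for i by (rule comm_in[OF f(1) fK])
  note x = x1 x2
  have 1: "approx G H 1 (?x (m + n)) (?x m \<otimes> ?x n)"
    using approx_comm_right[OF f(1) fK fK, of m n] f by (simp add: int_pow_mult)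
  have 2: "approx G H (1 + 2 * length fs) (?x (m + n) \<otimes> ?A (m + n)) ((?x m \<otimes> ?x n) \<otimes> (?A m \<otimes> ?A n))"
    using Cons by (intro approx_mult 1) auto
  have "approx G H (0 + (1 + 0)) (?x m \<otimes> ((?x n \<otimes> ?A m) \<otimes> ?A n)) (?x m \<otimes> ((?A m \<otimes> ?x n) \<otimes> ?A n))"
    using x A by (intro approx_mult approx_refl approx_commute) auto
  then have 3: "approx G H 1 ((?x m \<otimes> ?x n) \<otimes> (?A m \<otimes> ?A n)) ((?x m \<otimes> ?A m) \<otimes> (?x n \<otimes> ?A n))"
    using x A by (simp add: m_assoc)
  show ?case using approx_trans[OF 2 3] by simp
qed simp

lemma (in comm_pair) comm_word_pow:
  assumes "length fs' = length fs" "set fs \<subseteq> carrier G" "set fs' \<subseteq> K"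
  shows "\<exists>k. approx G H k (comm_word G fs fs' m) (comm_word G fs fs' 1 [^] m)"
proof -
  let ?w = "comm_word G fs fs'"
  have fsK: "set fs' \<subseteq> carrier G" using assms by auto
  have c: "?w i \<in> carrier G" for i using assms fsK by (intro comm_word_closed) auto
  note add = comm_word_add[OF assms]
  show ?thesis
  proof (induction m rule: int_induct[where k=0])
    case base
    then show ?case using comm_word_0[OF assms(1,2) fsK] by auto
  next
    case (step1 i)
    then obtain k where k: "approx G H k (?w i) (?w 1 [^] i)" by blast
    have "approx G H (2 * length fs + (k + 0)) (?w (i + 1)) (?w 1 [^] i \<otimes> ?w 1)"
      by (rule approx_trans[OF add approx_mult[OF k approx_refl[OF c]]])
    then show ?case using c by (auto simp: int_pow_mult int_pow_1)
  next
    case (step2 i)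
    then obtain k where k: "approx G H k (?w i) (?w 1 [^] i)" by blast
    have "approx G H (2 * length fs) (?w (i - 1) \<otimes> ?w 1) (?w i)"
      using approx_sym[OF add[of "i - 1" 1]] by simp
    then have "approx G H (2 * length fs + k + 0) (?w (i - 1) \<otimes> ?w 1 \<otimes> inv (?w 1)) (?w 1 [^] i \<otimes> inv (?w 1))"
      using c by (intro approx_mult approx_trans[OF _ k] approx_refl) auto
    moreover have "?w 1 [^] i \<otimes> inv (?w 1) = ?w 1 [^] (i - 1)"
      using c int_pow_diff[of "?w 1" i 1] by (simp add: int_pow_1)
    ultimately show ?case using c by (auto simp: m_assoc)
  qed
qed

text \<open>The error counts the \<open>n\<close> summands; the size of \<open>m\<close> does not
  enter. This matters when \<open>m\<close> is the unbounded value \<open>\<Phi> y\<close>.\<close>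

lemma (in comm_pair) comm_word_nat_mult:
  assumes "length fs' = length fs" "set fs \<subseteq> carrier G" "set fs' \<subseteq> K"
  shows "approx G H (n * (2 * length fs)) (comm_word G fs fs' (int n * m)) (comm_word G fs fs' m [^] n)"
proof (induction n)
  case 0
  have "set fs' \<subseteq> carrier G" using assms by auto
  then show ?case using comm_word_0[OF assms(1,2)] by simp
next
  case (Suc n)
  let ?w = "comm_word G fs fs'"
  have fsK: "set fs' \<subseteq> carrier G" using assms by auto
  have c: "?w i \<in> carrier G" for i using assms fsK by (intro comm_word_closed) auto
  have "approx G H (2 * length fs + (n * (2 * length fs) + 0)) (?w (int n * m + m)) (?w m [^] n \<otimes> ?w m)"
    by (rule approx_trans[OF comm_word_add[OF assms] approx_mult[OF Suc approx_refl[OF c]]])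
  then show ?case by (simp add: algebra_simps)
qed

text \<open>Used in \<open>G\<close>, where the values at 1 and -1 have finite mixed length by
  \<open>\<Psi>_lcs\<close>. It yields the upper quasi-isometry bound.\<close>

lemma (in comm_pair) comm_word_linear:
  assumes "length fs' = length fs" "set fs \<subseteq> carrier G" "set fs' \<subseteq> K"
    and c1: "comm_word G fs fs' 1 \<in> mball G H c" "comm_word G fs fs' (- 1) \<in> mball G H c"
  shows "comm_word G fs fs' m \<in> mball G H (nat \<bar>m\<bar> * (2 * length fs + c))"
proof -
  have *: "comm_word G fs fs' (int n * e) \<in> mball G H (n * (2 * length fs + c))" if "e = 1 \<or> e = -1" for n e
  proof -
    have "comm_word G fs fs' e \<in> mball G H c" using that c1 by auto
    from approx_mball[OF approx_sym[OF comm_word_nat_mult[OF assms(1-3), of n e]] mball_pow[OF this, of n]]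
    show ?thesis by (simp add: algebra_simps)
  qed
  show ?thesis using *[of 1 "nat m"] *[of "-1" "nat (- m)"] by (cases "m \<ge> 0") auto
qed

section \<open>Lifting along surjective homomorphisms\<close>

context group_hom
begin

lemma hom_comm_word:
  "length fs' = length fs \<Longrightarrow> set fs \<subseteq> carrier G \<Longrightarrow> set fs' \<subseteq> carrier G \<Longrightarrow>
    h (comm_word G fs fs' m) = comm_word H (map h fs) (map h fs') m"
proof (induction fs' fs rule: list_induct2)
  case (Cons f' fs' f fs)
  then show ?case using G.comm_word_closed[of fs' fs m] by (auto simp: hom_commutator hom_int_pow)
qed auto

lemma lift_mball:
  assumes surj: "carrier H \<subseteq> h ` carrier G" and y: "y \<in> mball H (carrier H) n"
  shows "\<exists>x\<in>mball G (carrier G) n. h x = y"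
proof -
  interpret A: normal "carrier G" G by (rule G.carrier_normal)
  interpret B: normal "carrier H" H by (rule H.carrier_normal)
  show ?thesis using y
  proof (induction rule: B.mball_induct)
    case one then show ?case by (auto simp: A.mball_0)
  next
    case (step k c y)
    then obtain g x where "c = commutator H g x" "g \<in> carrier H" "x \<in> carrier H" by (auto simp: B.letters_conv)
    then obtain a b where ab: "a \<in> carrier G" "b \<in> carrier G" "c = h (commutator G a b)"
      using surj by (auto simp: image_subset_iff subset_iff image_iff hom_commutator) (metis hom_commutator)
    from step obtain x' where x': "x' \<in> mball G (carrier G) k" "h x' = y" by blast
    have "commutator G a b \<otimes> x' \<in> mball G (carrier G) (1 + k)"
      using ab x' by (intro A.mball_mult A.mball_commutator)
    moreover have "h (commutator G a b \<otimes> x') = c \<otimes>\<^bsub>H\<^esub> y"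
      using ab x' A.mball_carrier by simp
    ultimately show ?case by auto
  qed
qed

lemma lift_lcs:
  assumes surj: "carrier H \<subseteq> h ` carrier G"
  shows "lcs H k \<subseteq> h ` lcs G k"
proof (induction k)
  case (Suc k)
  show ?case
  proof (cases k)
    case (Suc j)
    then have k: "k \<ge> 1" by simp
    have "subgroup (h ` lcs G (Suc k)) H" by (rule subgroup_img_is_subgroup[OF G.lcs_subgroup])
    moreover have "comm_set H (lcs H k) \<subseteq> h ` lcs G (Suc k)"
    proof
      fix c assume "c \<in> comm_set H (lcs H k)"
      then obtain g x where gx: "c = commutator H g x" "g \<in> carrier H" "x \<in> lcs H k" by (auto simp: comm_set_def)
      have "g \<in> h ` carrier G" "x \<in> h ` lcs G k" using gx surj Suc.IH by auto
      then obtain a b where ab: "a \<in> carrier G" "b \<in> lcs G k" "g = h a" "x = h b" by (auto simp only: image_iff)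
      then have "c = h (commutator G a b)" using gx by (simp add: hom_commutator G.lcs_carrier)
      then show "c \<in> h ` lcs G (Suc k)" using G.commutator_in_lcs[OF k ab(1,2)] by blast
    qed
    ultimately show ?thesis unfolding H.lcs_Suc[OF k] by (rule H.generate_subgroup_incl[rotated])
  qed (use surj in auto)
qed (use surj in auto)

end

section \<open>The coarse kernel of a one-relator quotient\<close>

locale one_relator =
  fixes F :: "('a, 'b) monoid_scheme" and B :: "'a set" and q :: nat and r :: 'a
    and N :: "'a set" and G :: "'a set monoid" and \<pi> :: "'a \<Rightarrow> 'a set" and fs fs' :: "'a list"
  assumes free: "free_group_on F B" and q: "q \<ge> 2"
    and r: "r \<in> lcs F q" and N_def: "N = normal_closure F {r}" and G_def: "G = F Mod N"
    and \<pi>_def: "\<pi> = (\<lambda>x. N #>\<^bsub>F\<^esub> x)"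
    and len: "length fs' = length fs" and fs: "set fs \<subseteq> carrier F" and fs': "set fs' \<subseteq> lcs F (q - 1)"
    and coset: "mprod F (map2 (commutator F) fs fs') <#\<^bsub>F\<^esub> lcs F (Suc q) = r <#\<^bsub>F\<^esub> lcs F (Suc q)"
begin

sublocale F: group F using free by (simp add: free_group_on_def)

lemma r_carrier: "r \<in> carrier F" using r by (rule F.lcs_carrier)

sublocale N: normal N F
  unfolding N_def using r_carrier by (intro F.normal_closure_normal) simp

sublocale G: group G unfolding G_def by (rule N.factorgroup_is_group)

sublocale \<pi>: group_hom F G \<pi>
  unfolding group_hom_def group_hom_axioms_def \<pi>_def using N.r_coset_hom_Mod F.group_axioms G.group_axioms
  by (simp add: G_def)

sublocale CF: comm_pair "lcs F q" F "lcs F (q - 1)"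
  using F.comm_pair_lcs[of "q - 1"] q by simp

sublocale CG: comm_pair "lcs G q" G "lcs G (q - 1)"
  using G.comm_pair_lcs[of "q - 1"] q by simp

sublocale AF: normal "carrier F" F by (rule F.carrier_normal)

sublocale AG: normal "carrier G" G by (rule G.carrier_normal)

lemma q1: "q \<ge> 1" using q by simp

lemma lcs_commH:
  "CF.commH = lcs F (Suc q)" "CG.commH = lcs G (Suc q)"
  using F.lcs_Suc[OF q1] G.lcs_Suc[OF q1] by simp_all

lemma lcs_AG: "x \<in> lcs G (Suc q) \<Longrightarrow> x \<in> AG.commH"
  using G.lcs_antimono[of 2 "Suc q"] G.lcs_Suc[of 1] q by (auto simp: numeral_2_eq_2)

lemma \<pi>_surj: "carrier G \<subseteq> \<pi> ` carrier F"
  by (auto simp: G_def FactGroup_def RCOSETS_def \<pi>_def)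

lemma \<pi>_one_iff: "x \<in> carrier F \<Longrightarrow> \<pi> x = \<one>\<^bsub>G\<^esub> \<longleftrightarrow> x \<in> N"
proof -
  assume x: "x \<in> carrier F"
  have one: "\<one>\<^bsub>G\<^esub> = N" by (simp add: G_def FactGroup_def)
  show ?thesis unfolding one \<pi>_def
  proof
    assume "N #>\<^bsub>F\<^esub> x = N"
    then show "x \<in> N" using F.rcos_self[OF x N.subgroup_axioms] by simp
  next
    assume "x \<in> N"
    then show "N #>\<^bsub>F\<^esub> x = N" by (rule N.rcos_const[OF F.group_axioms])
  qed
qed

lemma \<pi>_eqD:
  assumes "x \<in> carrier F" "y \<in> carrier F" "\<pi> x = \<pi> y"
  shows "inv\<^bsub>F\<^esub> x \<otimes>\<^bsub>F\<^esub> y \<in> N"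
  using assms \<pi>_one_iff[of "inv\<^bsub>F\<^esub> x \<otimes>\<^bsub>F\<^esub> y"] by simp

lemma r_in_N: "r \<in> N"
  unfolding N_def using F.normal_closure_incl[of "{r}"] r_carrier by auto

definition w where "w = comm_word F fs fs'"

definition \<Psi> where "\<Psi> m = \<pi> (w m)"

lemma fs'_carrier: "set fs' \<subseteq> carrier F" using fs' F.lcs_subset by (rule subset_trans)

lemma w_carrier: "w m \<in> carrier F"
  unfolding w_def using F.comm_word_closed[OF len fs fs'_carrier] .

lemma \<Psi>_comm_word: "\<Psi> m = comm_word G (map \<pi> fs) (map \<pi> fs') m"
  unfolding \<Psi>_def w_def by (rule \<pi>.hom_comm_word[OF len fs fs'_carrier])

lemma \<pi>_fs: "length (map \<pi> fs') = length (map \<pi> fs)" "set (map \<pi> fs) \<subseteq> carrier G"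
  "set (map \<pi> fs') \<subseteq> lcs G (q - 1)"
  using len fs fs' \<pi>.hom_lcs[of "q - 1"] by auto

lemma \<Psi>_carrier: "\<Psi> m \<in> carrier G"
  unfolding \<Psi>_def using w_carrier by simp

definition K where "K = 2 * length fs"

lemma \<Psi>_add: "approx G (lcs G q) K (\<Psi> (m + n)) (\<Psi> m \<otimes>\<^bsub>G\<^esub> \<Psi> n)"
  unfolding \<Psi>_comm_word K_def using CG.comm_word_add[OF \<pi>_fs] by simp

lemma \<Psi>_nat_mult: "approx G (lcs G q) (n * K) (\<Psi> (int n * m)) (\<Psi> m [^]\<^bsub>G\<^esub> n)"
  unfolding \<Psi>_comm_word K_def using CG.comm_word_nat_mult[OF \<pi>_fs] by simp

text \<open>\<open>w 1\<close> and \<open>r\<close> agree modulo \<open>lcs F (Suc q)\<close> by the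
  coset hypothesis, and \<open>comm_word_pow\<close> carries this to all exponents. Only the
  congruence is used later, so \<open>n\<close> is not estimated.\<close>

lemma w_approx: "\<exists>n. approx F (lcs F q) n (w m) (r [^]\<^bsub>F\<^esub> m)"
proof -
  let ?rb = "mprod F (map2 (commutator F) fs fs')"
  have w1: "w 1 = ?rb" unfolding w_def by (rule F.comm_word_1[OF len fs fs'_carrier])
  then have rbc: "?rb \<in> carrier F" using w_carrier[of 1] by simp
  have "?rb \<otimes>\<^bsub>F\<^esub> \<one>\<^bsub>F\<^esub> \<in> ?rb <#\<^bsub>F\<^esub> lcs F (Suc q)"
    unfolding l_coset_def by (rule UN_I[OF F.lcs_closed(1)]) simp
  then have "?rb \<in> r <#\<^bsub>F\<^esub> lcs F (Suc q)" unfolding coset F.r_one[OF rbc] .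
  then obtain l where l: "l \<in> lcs F (Suc q)" "?rb = r \<otimes>\<^bsub>F\<^esub> l" unfolding l_coset_def by blast
  then have "inv\<^bsub>F\<^esub> ?rb \<otimes>\<^bsub>F\<^esub> r \<in> lcs F (Suc q)"
    using r_carrier F.lcs_carrier[OF l(1)] by (simp add: F.inv_mult_group F.m_assoc del: lcs.simps)
  then obtain n where n: "approx F (lcs F q) n ?rb r"
    using CF.commH_approx[OF rbc r_carrier] lcs_commH by blast
  obtain k where k: "approx F (lcs F q) k (w m) (w 1 [^]\<^bsub>F\<^esub> m)"
    unfolding w_def using CF.comm_word_pow[OF len fs fs'] by blast
  obtain j where "approx F (lcs F q) j (w 1 [^]\<^bsub>F\<^esub> m) (r [^]\<^bsub>F\<^esub> m)"
    using CF.approx_int_pow[OF n] w1 by auto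
  then show ?thesis using CF.approx_trans[OF k] by blast
qed

lemma w_lcs: "w m \<in> lcs F q"
proof -
  obtain n where "approx F (lcs F q) n (w m) (r [^]\<^bsub>F\<^esub> m)" using w_approx by blast
  then show ?thesis using CF.approx_mem_H[OF CF.approx_sym] F.lcs_int_pow[OF r] by blast
qed

text \<open>All conjugates of \<open>r\<close> agree with \<open>r\<close> up to one commutator with
  an entry in \<open>lcs F q\<close>, so modulo \<open>lcs F (Suc q)\<close> every element of
  \<open>N\<close> is a power of \<open>r\<close>.\<close>

lemma N_approx:
  assumes "\<rho> \<in> N"
  shows "\<exists>(k::int) n. approx F (lcs F q) n (r [^]\<^bsub>F\<^esub> k) \<rho>"
proof -
  let ?S = "{g \<otimes>\<^bsub>F\<^esub> s \<otimes>\<^bsub>F\<^esub> inv\<^bsub>F\<^esub> g | g s. g \<in> carrier F \<and> s \<in> {r}}"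
  have gen: "approx F (lcs F q) 1 r s" if "s \<in> ?S" for s
    using that CF.approx_sym[OF CF.approx_conj[OF r]] by auto
  have "\<rho> \<in> generate F ?S" using assms unfolding N_def normal_closure_def .
  then show ?thesis
  proof (induction rule: generate.induct)
    case one
    have "approx F (lcs F q) 0 (r [^]\<^bsub>F\<^esub> (0::int)) \<one>\<^bsub>F\<^esub>" by simp
    then show ?case by blast
  next
    case (incl s)
    then have "approx F (lcs F q) 1 (r [^]\<^bsub>F\<^esub> (1::int)) s" using gen r_carrier by (simp add: F.int_pow_1)
    then show ?case by blast
  next
    case (inv s)
    then have "approx F (lcs F q) 1 (r [^]\<^bsub>F\<^esub> (- 1::int)) (inv\<^bsub>F\<^esub> s)"
      using CF.approx_inv[OF gen[OF inv]] r_carrier by (simp add: F.int_pow_neg F.int_pow_1)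
    then show ?case by blast
  next
    case (eng x y)
    then obtain k l :: int and m n where
      "approx F (lcs F q) m (r [^]\<^bsub>F\<^esub> k) x" "approx F (lcs F q) n (r [^]\<^bsub>F\<^esub> l) y" by blast
    then have "approx F (lcs F q) (m + n) (r [^]\<^bsub>F\<^esub> k \<otimes>\<^bsub>F\<^esub> r [^]\<^bsub>F\<^esub> l) (x \<otimes>\<^bsub>F\<^esub> y)"
      by (rule CF.approx_mult)
    then show ?case using r_carrier by (auto simp: F.int_pow_mult[symmetric])
  qed
qed

text \<open>As \<open>r\<close> becomes trivial in \<open>G\<close>, \<open>w m\<close> may be
  divided by \<open>r [^] m\<close>, and the quotient lies in \<open>lcs F (Suc q)\<close>.\<close>

lemma \<Psi>_lcs: "\<Psi> m \<in> lcs G (Suc q)"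
proof -
  obtain n where "approx F (lcs F q) n (r [^]\<^bsub>F\<^esub> m) (w m)" using w_approx CF.approx_sym by blast
  then have "inv\<^bsub>F\<^esub> (r [^]\<^bsub>F\<^esub> m) \<otimes>\<^bsub>F\<^esub> w m \<in> lcs F (Suc q)" using CF.approx_commH lcs_commH by blast
  then have "\<pi> (inv\<^bsub>F\<^esub> (r [^]\<^bsub>F\<^esub> m) \<otimes>\<^bsub>F\<^esub> w m) \<in> lcs G (Suc q)" using \<pi>.hom_lcs by blast
  moreover have "\<pi> r = \<one>\<^bsub>G\<^esub>" using r_in_N r_carrier \<pi>_one_iff by blast
  then have "\<pi> (inv\<^bsub>F\<^esub> (r [^]\<^bsub>F\<^esub> m) \<otimes>\<^bsub>F\<^esub> w m) = \<Psi> m"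
    using r_carrier w_carrier \<Psi>_carrier by (simp add: \<pi>.hom_int_pow G.int_pow_one \<Psi>_def)
  ultimately show ?thesis by simp
qed

text \<open>Every element of \<open>lcs G (Suc q)\<close> differs from some \<open>\<Psi> k\<close> by the image of an element of
  \<open>lcs F (Suc q)\<close>, whose stable mixed commutator length is controlled in the free group.\<close>
lemma approximate_by_\<Psi>:
  assumes y: "y \<in> lcs G (Suc q)" "y \<in> mball G (carrier G) j"
  shows "\<exists>k. scl G (lcs G q) (inv\<^bsub>G\<^esub> (\<Psi> k) \<otimes>\<^bsub>G\<^esub> y) \<le> 4 ^ q * real (length fs + j)"
proof -
  \<comment> \<open>The lift \<open>x\<close> keeps the commutator length, the lift \<open>u\<close>
    the depth in the lower central series. Their quotient lies in \<open>N\<close> and determines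
    \<open>k\<close>; dividing \<open>x\<close> by \<open>w k\<close> restores the depth at the
    price of \<open>length fs\<close> commutators.\<close>
  obtain x where x: "x \<in> mball F (carrier F) j" "\<pi> x = y" using \<pi>.lift_mball[OF \<pi>_surj y(2)] by blast
  have xc: "x \<in> carrier F" using AF.mball_carrier x(1) by blast
  obtain u where u: "u \<in> lcs F (Suc q)" "\<pi> u = y" using \<pi>.lift_lcs[OF \<pi>_surj] y(1) by blast
  have uc: "u \<in> carrier F" using u(1) by (rule F.lcs_carrier)
  define \<rho> where "\<rho> = inv\<^bsub>F\<^esub> u \<otimes>\<^bsub>F\<^esub> x"
  have \<rho>: "\<rho> \<in> N" unfolding \<rho>_def using \<pi>_eqD[OF uc xc] u x by simp
  have x_eq: "x = u \<otimes>\<^bsub>F\<^esub> \<rho>" using uc xc by (simp add: \<rho>_def F.inv_cancel_left)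
  obtain k :: int and n where k: "approx F (lcs F q) n (r [^]\<^bsub>F\<^esub> k) \<rho>" using N_approx[OF \<rho>] by blast
  obtain m where m: "approx F (lcs F q) m (w k) (r [^]\<^bsub>F\<^esub> k)" using w_approx by blast
  obtain l where l: "approx F (lcs F q) l \<one>\<^bsub>F\<^esub> u"
    using CF.commH_approx[of "\<one>\<^bsub>F\<^esub>" u] u(1) uc lcs_commH by auto
  have "approx F (lcs F q) (l + (m + n)) (\<one>\<^bsub>F\<^esub> \<otimes>\<^bsub>F\<^esub> w k) (u \<otimes>\<^bsub>F\<^esub> \<rho>)"
    by (rule CF.approx_mult[OF l CF.approx_trans[OF m k]])
  then have z: "inv\<^bsub>F\<^esub> (w k) \<otimes>\<^bsub>F\<^esub> x \<in> lcs F (Suc q)" (is "?z \<in> _")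
    using CF.approx_commH lcs_commH x_eq w_carrier by fastforce
  have "w k \<in> mball F (carrier F) (length fs)" unfolding w_def by (rule F.comm_word_mball[OF len fs fs'_carrier])
  then have "?z \<in> mball F (carrier F) (length fs + j)" by (intro AF.mball_mult AF.mball_inv x(1))
  then have "scl F (carrier F) ?z \<le> length fs + j" by (rule AF.scl_le_mball)
  then have "4 ^ q * scl F (carrier F) ?z \<le> 4 ^ q * real (length fs + j)" by (intro mult_left_mono) auto
  then have "scl F (lcs F q) ?z \<le> 4 ^ q * real (length fs + j)"
    using free_group_scl_lcs[OF free q1 z] by linarith
  moreover have "scl G (lcs G q) (\<pi> ?z) \<le> scl F (lcs F q) ?z"
    using z lcs_commH by (intro \<pi>.hom_scl F.lcs_normal G.lcs_normal \<pi>.hom_lcs) simp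
  ultimately have le: "scl G (lcs G q) (\<pi> ?z) \<le> 4 ^ q * real (length fs + j)" by linarith
  have e: "\<pi> ?z = inv\<^bsub>G\<^esub> (\<Psi> k) \<otimes>\<^bsub>G\<^esub> y" using x xc w_carrier by (simp add: \<Psi>_def)
  show ?thesis using le unfolding e by (rule exI)
qed

lemma \<Psi>_linear: "\<exists>c. \<forall>m. \<Psi> m \<in> mball G (lcs G q) (nat \<bar>m\<bar> * c)"
proof -
  obtain a b where ab: "\<Psi> 1 \<in> mball G (lcs G q) a" "\<Psi> (- 1) \<in> mball G (lcs G q) b"
    using \<Psi>_lcs CG.generate_comm_set lcs_commH by (metis (no_types))
  then have "\<Psi> 1 \<in> mball G (lcs G q) (max a b)" "\<Psi> (- 1) \<in> mball G (lcs G q) (max a b)"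
    by (auto elim!: CG.mball_mono[rotated])
  then show ?thesis unfolding \<Psi>_comm_word using CG.comm_word_linear[OF \<pi>_fs] by blast
qed

lemma \<Psi>_diff: "approx G (lcs G q) K (inv\<^bsub>G\<^esub> (\<Psi> m) \<otimes>\<^bsub>G\<^esub> \<Psi> n) (\<Psi> (n - m))"
proof -
  have "approx G (lcs G q) (0 + K) (inv\<^bsub>G\<^esub> (\<Psi> m) \<otimes>\<^bsub>G\<^esub> \<Psi> (m + (n - m))) (inv\<^bsub>G\<^esub> (\<Psi> m) \<otimes>\<^bsub>G\<^esub> (\<Psi> m \<otimes>\<^bsub>G\<^esub> \<Psi> (n - m)))"
    using \<Psi>_carrier by (intro CG.approx_mult \<Psi>_add CG.approx_refl) auto
  then show ?thesis using \<Psi>_carrier by (simp add: G.inv_cancel_left)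
qed

lemma dscl_\<Psi>_upper: "\<exists>C. \<forall>m n. dscl G (lcs G q) (\<Psi> m) (\<Psi> n) \<le> real C * real_of_int \<bar>m - n\<bar> + real K"
proof -
  obtain c where c: "\<And>m. \<Psi> m \<in> mball G (lcs G q) (nat \<bar>m\<bar> * c)" using \<Psi>_linear by blast
  have "dscl G (lcs G q) (\<Psi> m) (\<Psi> n) \<le> real c * real_of_int \<bar>m - n\<bar> + real K" for m n
  proof -
    have "inv\<^bsub>G\<^esub> (\<Psi> m) \<otimes>\<^bsub>G\<^esub> \<Psi> n \<in> mball G (lcs G q) (nat \<bar>n - m\<bar> * c + K)"
      using CG.approx_mball[OF CG.approx_sym[OF \<Psi>_diff] c] .
    then have "dscl G (lcs G q) (\<Psi> m) (\<Psi> n) \<le> real (nat \<bar>n - m\<bar> * c + K)"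
      unfolding dscl_def by (rule CG.scl_le_mball)
    then show ?thesis by (simp add: abs_minus_commute mult.commute)
  qed
  then show ?thesis by blast
qed

lemma dscl_\<Psi>_G: "dscl G (carrier G) (\<Psi> m) (\<Psi> n) \<le> real K"
proof -
  have "set (map \<pi> fs') \<subseteq> carrier G" using \<pi>_fs(3) G.lcs_subset by blast
  then have b: "\<Psi> i \<in> mball G (carrier G) (length fs)" for i
    unfolding \<Psi>_comm_word using G.comm_word_mball[OF \<pi>_fs(1,2)] by simp
  have "inv\<^bsub>G\<^esub> (\<Psi> m) \<otimes>\<^bsub>G\<^esub> \<Psi> n \<in> mball G (carrier G) (length fs + length fs)"
    by (intro AG.mball_mult AG.mball_inv b)
  then show ?thesis unfolding dscl_def K_def using AG.scl_le_mball by fastforce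
qed

end

section \<open>The quasimorphism on \<open>lcs G q\<close>, the lower bounds and the coarse
  kernel\<close>

locale one_relator_quasimorphism = one_relator +
  fixes h \<phi> :: "'a \<Rightarrow> real"
  assumes h_add: "x \<in> lcs F q \<Longrightarrow> y \<in> lcs F q \<Longrightarrow> h (x \<otimes>\<^bsub>F\<^esub> y) = h x + h y"
    and h_zero: "x \<in> lcs F (Suc q) \<Longrightarrow> h x = 0" and h_r: "h r \<noteq> 0"
    and \<phi>_quasi: "x \<in> carrier F \<Longrightarrow> y \<in> carrier F \<Longrightarrow> \<bar>\<phi> (x \<otimes>\<^bsub>F\<^esub> y) - \<phi> x - \<phi> y\<bar> \<le> 2"
    and \<phi>_right: "x \<in> carrier F \<Longrightarrow> n \<in> N \<Longrightarrow> \<phi> (x \<otimes>\<^bsub>F\<^esub> n) = \<phi> x + \<phi> n"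
    and \<phi>_conj: "x \<in> carrier F \<Longrightarrow> n \<in> N \<Longrightarrow> \<phi> (x \<otimes>\<^bsub>F\<^esub> n \<otimes>\<^bsub>F\<^esub> inv\<^bsub>F\<^esub> x) = \<phi> n"
    and \<phi>_r: "\<phi> r \<noteq> 0"
begin

definition \<beta> where "\<beta> = \<bar>1 / \<phi> r\<bar>"

definition \<nu> where "\<nu> x = h x / h r - \<phi> x / \<phi> r"

lemma \<beta>_pos: "\<beta> > 0"
  using \<phi>_r by (simp add: \<beta>_def)

lemma N_lcs: "x \<in> N \<Longrightarrow> x \<in> lcs F q"
proof -
  have "{g \<otimes>\<^bsub>F\<^esub> s \<otimes>\<^bsub>F\<^esub> inv\<^bsub>F\<^esub> g | g s. g \<in> carrier F \<and> s \<in> {r}} \<subseteq> lcs F q"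
    using F.lcs_conj(1)[OF _ r] by auto
  from F.generate_subgroup_incl[OF this F.lcs_subgroup]
  show "x \<in> N \<Longrightarrow> x \<in> lcs F q" unfolding N_def normal_closure_def by blast
qed

lemma h_one: "h \<one>\<^bsub>F\<^esub> = 0"
  by (rule h_zero) simp

lemma h_inv: "x \<in> lcs F q \<Longrightarrow> h (inv\<^bsub>F\<^esub> x) = - h x"
  using h_add[of x "inv\<^bsub>F\<^esub> x"] h_one F.lcs_carrier[of x q] F.lcs_closed(3)[of x q] by simp

text \<open>The number \<open>n\<close> is irrelevant, as \<open>h\<close> vanishes on all of
  \<open>lcs F (Suc q)\<close>. Congruences without estimates, such as \<open>w_approx\<close>,
  therefore suffice for \<open>h\<close>.\<close>

lemma h_cong:
  assumes "approx F (lcs F q) n x y" "x \<in> lcs F q"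
  shows "h y = h x"
proof -
  have c: "x \<in> carrier F" "y \<in> carrier F" using assms by auto
  have z: "inv\<^bsub>F\<^esub> x \<otimes>\<^bsub>F\<^esub> y \<in> lcs F (Suc q)" using CF.approx_commH[OF assms(1)] lcs_commH by blast
  have "h (x \<otimes>\<^bsub>F\<^esub> (inv\<^bsub>F\<^esub> x \<otimes>\<^bsub>F\<^esub> y)) = h x + h (inv\<^bsub>F\<^esub> x \<otimes>\<^bsub>F\<^esub> y)"
    using z F.lcs_Suc_subset by (intro h_add assms) blast
  then show ?thesis using h_zero[OF z] c by (simp add: F.inv_cancel_left)
qed

lemma h_int_pow:
  assumes "x \<in> lcs F q"
  shows "h (x [^]\<^bsub>F\<^esub> (m::int)) = of_int m * h x"
proof -
  have n: "h (x [^]\<^bsub>F\<^esub> (k::nat)) = of_nat k * h x" for k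
    by (induction k) (use assms in \<open>simp_all add: h_one h_add distrib_right\<close>)
  show ?thesis
  proof (cases m)
    case (nonneg k) then show ?thesis using n by (simp add: int_pow_int)
  next
    case (neg k)
    then have "x [^]\<^bsub>F\<^esub> m = inv\<^bsub>F\<^esub> (x [^]\<^bsub>F\<^esub> Suc k)"
      using F.lcs_carrier[OF assms] by (metis F.int_pow_neg_int)
    then have "h (x [^]\<^bsub>F\<^esub> m) = - (of_nat (Suc k) * h x)"
      using h_inv[OF F.lcs_pow[OF assms, of "Suc k"]] n[of "Suc k"] by (simp only:)
    then show ?thesis using neg by (simp only: of_int_minus of_int_of_nat_eq mult_minus_left)
  qed
qed

lemma \<phi>_one: "\<phi> \<one>\<^bsub>F\<^esub> = 0"
  using \<phi>_right[of "\<one>\<^bsub>F\<^esub>" "\<one>\<^bsub>F\<^esub>"] N.one_closed by simp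

lemma \<nu>_N: "n \<in> N \<Longrightarrow> \<nu> n = 0"
proof -
  let ?S = "{g \<otimes>\<^bsub>F\<^esub> s \<otimes>\<^bsub>F\<^esub> inv\<^bsub>F\<^esub> g | g s. g \<in> carrier F \<and> s \<in> {r}}"
  have NS: "N = generate F ?S" by (simp only: N_def normal_closure_def)
  have S: "\<nu> s = 0 \<and> s \<in> N" if "s \<in> ?S" for s
  proof -
    from that obtain g where g: "g \<in> carrier F" "s = g \<otimes>\<^bsub>F\<^esub> r \<otimes>\<^bsub>F\<^esub> inv\<^bsub>F\<^esub> g" by blast
    have "h s = h r" using h_cong[OF CF.approx_sym[OF CF.approx_conj[OF r g(1)]] r] g(2) by simp
    moreover have "\<phi> s = \<phi> r" using \<phi>_conj[OF g(1) r_in_N] g(2) by simp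
    moreover have "s \<in> N" unfolding NS by (rule generate.incl[OF that])
    ultimately show ?thesis using h_r \<phi>_r by (simp add: \<nu>_def)
  qed
  have mult: "\<nu> (x \<otimes>\<^bsub>F\<^esub> y) = \<nu> x + \<nu> y" if "x \<in> N" "y \<in> N" for x y
    using h_add[OF N_lcs[OF that(1)] N_lcs[OF that(2)]] \<phi>_right[OF N.mem_carrier[OF that(1)] that(2)]
    by (simp add: \<nu>_def add_divide_distrib)
  have one: "\<nu> \<one>\<^bsub>F\<^esub> = 0" by (simp add: \<nu>_def h_one \<phi>_one)
  assume "n \<in> N"
  then have "n \<in> generate F ?S" unfolding NS .
  then show "\<nu> n = 0"
  proof (induction rule: generate.induct)
    case one show ?case by (rule \<open>\<nu> \<one>\<^bsub>F\<^esub> = 0\<close>)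
  next
    case (incl s) then show ?case using S by blast
  next
    case (inv s)
    have s: "\<nu> s = 0" "s \<in> N" using S[OF inv] by blast+
    then show ?case using mult[of s "inv\<^bsub>F\<^esub> s"] one N.m_inv_closed[OF s(2)] N.mem_carrier[OF s(2)] by simp
  next
    case (eng x y)
    have xy: "x \<in> N" "y \<in> N" using eng(1,2) by (simp_all only: NS)
    show ?case unfolding mult[OF xy] eng(3,4) by simp
  qed
qed

lemma \<nu>_cong:
  assumes "x \<in> lcs F q" "y \<in> lcs F q" "\<pi> x = \<pi> y"
  shows "\<nu> x = \<nu> y"
proof -
  have c: "x \<in> carrier F" "y \<in> carrier F" using assms by (auto intro: F.lcs_carrier)
  define n where "n = inv\<^bsub>F\<^esub> x \<otimes>\<^bsub>F\<^esub> y"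
  have n: "n \<in> N" unfolding n_def by (rule \<pi>_eqD[OF c assms(3)])
  have "y = x \<otimes>\<^bsub>F\<^esub> n" using c by (simp add: n_def F.inv_cancel_left)
  then have "\<nu> y = \<nu> x + \<nu> n"
    using h_add[OF assms(1) N_lcs[OF n]] \<phi>_right[OF c(1) n] by (simp add: \<nu>_def add_divide_distrib)
  then show ?thesis using \<nu>_N[OF n] by simp
qed

text \<open>The choice does not matter for \<open>y \<in> lcs G q\<close>, where \<open>\<nu>\<close> is constant on the fibres of \<open>\<pi>\<close>.\<close>
definition \<mu> where "\<mu> y = \<nu> (SOME x. x \<in> lcs F q \<and> \<pi> x = y)"

lemma \<mu>_\<pi>: "x \<in> lcs F q \<Longrightarrow> \<mu> (\<pi> x) = \<nu> x"
  unfolding \<mu>_def by (rule someI2[of _ x]) (auto intro: \<nu>_cong)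

lemma lift_q: "y \<in> lcs G q \<Longrightarrow> \<exists>x\<in>lcs F q. \<pi> x = y"
  using \<pi>.lift_lcs[OF \<pi>_surj, of q] by (auto simp: subset_iff image_iff)

lemma \<nu>_quasi:
  assumes "x \<in> lcs F q" "y \<in> lcs F q"
  shows "\<bar>\<nu> (x \<otimes>\<^bsub>F\<^esub> y) - \<nu> x - \<nu> y\<bar> \<le> 2 * \<beta>"
proof -
  have "\<nu> (x \<otimes>\<^bsub>F\<^esub> y) - \<nu> x - \<nu> y = - ((\<phi> (x \<otimes>\<^bsub>F\<^esub> y) - \<phi> x - \<phi> y) * (1 / \<phi> r))"
    unfolding \<nu>_def h_add[OF assms] by (simp add: add_divide_distrib diff_divide_distrib)
  moreover have "\<bar>\<phi> (x \<otimes>\<^bsub>F\<^esub> y) - \<phi> x - \<phi> y\<bar> * \<beta> \<le> 2 * \<beta>"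
    using \<phi>_quasi assms \<beta>_pos by (intro mult_right_mono) (auto intro: F.lcs_carrier)
  ultimately show ?thesis by (simp only: abs_minus_cancel abs_mult \<beta>_def)
qed

lemma \<mu>_quasi:
  assumes "x \<in> lcs G q" "y \<in> lcs G q"
  shows "\<bar>\<mu> (x \<otimes>\<^bsub>G\<^esub> y) - \<mu> x - \<mu> y\<bar> \<le> 2 * \<beta>"
proof -
  obtain a b where ab: "a \<in> lcs F q" "\<pi> a = x" "b \<in> lcs F q" "\<pi> b = y"
    using lift_q[OF assms(1)] lift_q[OF assms(2)] by blast
  have "\<pi> (a \<otimes>\<^bsub>F\<^esub> b) = x \<otimes>\<^bsub>G\<^esub> y" using ab F.lcs_carrier[OF ab(1)] F.lcs_carrier[OF ab(3)] by simp
  then show ?thesis using \<nu>_quasi[OF ab(1,3)] \<mu>_\<pi>[OF ab(1)] \<mu>_\<pi>[OF ab(3)] \<mu>_\<pi>[OF F.lcs_closed(2)[OF ab(1,3)]] ab by simp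
qed

text \<open>Defect 2 for each of the three products and for each of the two pairs of an element with
  its inverse.\<close>

lemma \<phi>_commutator:
  assumes x: "x \<in> carrier F" and y: "y \<in> carrier F"
  shows "\<bar>\<phi> (commutator F x y)\<bar> \<le> 10"
proof -
  have i: "\<bar>\<phi> z + \<phi> (inv\<^bsub>F\<^esub> z)\<bar> \<le> 2" if "z \<in> carrier F" for z
    using \<phi>_quasi[of z "inv\<^bsub>F\<^esub> z"] that \<phi>_one by simp
  show ?thesis
    unfolding commutator_def
    using \<phi>_quasi[of x y] \<phi>_quasi[of "x \<otimes>\<^bsub>F\<^esub> y" "inv\<^bsub>F\<^esub> x"] \<phi>_quasi[of "x \<otimes>\<^bsub>F\<^esub> y \<otimes>\<^bsub>F\<^esub> inv\<^bsub>F\<^esub> x" "inv\<^bsub>F\<^esub> y"]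
      i[OF x] i[OF y] x y by simp
qed

text \<open>Per letter, 10 for the commutator and 2 for its product with the rest.\<close>

lemma \<phi>_mball:
  assumes "x \<in> mball F (carrier F) n"
  shows "\<bar>\<phi> x\<bar> \<le> 12 * real n"
  using assms
proof (induction rule: AF.mball_induct)
  case one then show ?case by (simp add: \<phi>_one)
next
  case (step k c y)
  have cy: "c \<in> carrier F" "y \<in> carrier F" using step AF.letters_carrier AF.mball_carrier by auto
  have "\<bar>\<phi> c\<bar> \<le> 10" using step(1) \<phi>_commutator by (auto simp: AF.letters_conv)
  then show ?case using \<phi>_quasi[OF cy] step(3) by simp
qed

text \<open>The commutator has a lift in \<open>lcs F (Suc q)\<close>, where \<open>h\<close>
  vanishes, so only \<open>\<phi>\<close> contributes.\<close>

lemma \<mu>_commutator: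
  assumes g: "g \<in> carrier G" and y: "y \<in> lcs G q"
  shows "\<bar>\<mu> (commutator G g y)\<bar> \<le> 10 * \<beta>" "\<bar>\<mu> (commutator G y g)\<bar> \<le> 10 * \<beta>"
proof -
  obtain b where b: "b \<in> lcs F q" "\<pi> b = y" using lift_q[OF y] by blast
  obtain a where a: "a \<in> carrier F" "\<pi> a = g" using \<pi>_surj g by blast
  have bc: "b \<in> carrier F" using b(1) by (rule F.lcs_carrier)
  have L: "commutator F a b \<in> lcs F (Suc q)" by (rule F.commutator_in_lcs[OF q1 a(1) b(1)])
  then have L': "commutator F b a \<in> lcs F (Suc q)" using F.inv_commutator[OF a(1) bc] F.lcs_closed(3) by metis
  have *: "\<bar>\<mu> (\<pi> z)\<bar> \<le> 10 * \<beta>" if z: "z \<in> lcs F (Suc q)" "\<bar>\<phi> z\<bar> \<le> 10" for z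
  proof -
    have "z \<in> lcs F q" using z(1) F.lcs_Suc_subset by blast
    then have "\<mu> (\<pi> z) = - (\<phi> z * (1 / \<phi> r))" using \<mu>_\<pi> h_zero[OF z(1)] by (simp add: \<nu>_def)
    moreover have "\<bar>\<phi> z\<bar> * \<beta> \<le> 10 * \<beta>" using z(2) \<beta>_pos by (intro mult_right_mono) auto
    ultimately show ?thesis by (simp only: abs_minus_cancel abs_mult \<beta>_def)
  qed
  show "\<bar>\<mu> (commutator G g y)\<bar> \<le> 10 * \<beta>"
    using *[OF L \<phi>_commutator[OF a(1) bc]] a b bc by (simp add: \<pi>.hom_commutator)
  show "\<bar>\<mu> (commutator G y g)\<bar> \<le> 10 * \<beta>"
    using *[OF L' \<phi>_commutator[OF bc a(1)]] a b bc by (simp add: \<pi>.hom_commutator)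
qed

lemma \<mu>_one: "\<mu> \<one>\<^bsub>G\<^esub> = 0"
  using \<mu>_\<pi>[OF F.lcs_closed(1)] \<nu>_N[OF N.one_closed] by simp

lemma \<mu>_mball:
  assumes "y \<in> mball G (lcs G q) n"
  shows "\<bar>\<mu> y\<bar> \<le> 12 * \<beta> * real n"
  using assms
proof (induction rule: CG.mball_induct)
  case one then show ?case by (simp add: \<mu>_one)
next
  case (step k c y)
  have cy: "c \<in> lcs G q" "y \<in> lcs G q" using step CG.letters_subset_H CG.mball_H by auto
  have "\<bar>\<mu> c\<bar> \<le> 10 * \<beta>" using step(1) \<mu>_commutator by (auto simp: CG.letters_conv)
  then show ?case using \<mu>_quasi[OF cy] step(3) by (simp add: algebra_simps)
qed

lemma \<mu>_pow:
  assumes y: "y \<in> lcs G q"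
  shows "\<bar>\<mu> (y [^]\<^bsub>G\<^esub> n) - real n * \<mu> y\<bar> \<le> 2 * \<beta> * real n"
proof (induction n)
  case 0 then show ?case by (simp add: \<mu>_one)
next
  case (Suc n)
  then show ?case using \<mu>_quasi[OF G.lcs_pow[OF y, of n] y] by (simp add: algebra_simps)
qed

text \<open>\<open>\<mu>\<close> is not assumed homogeneous: on \<open>n\<close>-th powers it
  deviates from \<open>n\<close> times its value by up to \<open>2 * \<beta> * n\<close>, which
  after division by \<open>n\<close> is the additive constant.\<close>

lemma \<mu>_le_scl:
  assumes y: "y \<in> lcs G (Suc q)"
  shows "\<bar>\<mu> y\<bar> \<le> 12 * \<beta> * scl G (lcs G q) y + 2 * \<beta>"
proof -
  have yC: "y \<in> CG.commH" using y lcs_commH by simp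
  have "(\<lambda>n. 12 * \<beta> * (real (cl G (lcs G q) (y [^]\<^bsub>G\<^esub> n)) / real n) + 2 * \<beta>)
      \<longlonglongrightarrow> 12 * \<beta> * scl G (lcs G q) y + 2 * \<beta>"
    by (intro tendsto_add tendsto_mult_left tendsto_const CG.scl_LIMSEQ yC)
  then show ?thesis
  proof (rule LIMSEQ_le_const, intro exI[of _ 1] allI impI)
    fix n :: nat assume n: "1 \<le> n"
    have yq: "y \<in> lcs G q" using CG.commH_H[OF yC] .
    have "\<bar>\<mu> (y [^]\<^bsub>G\<^esub> n)\<bar> \<le> 12 * \<beta> * real (cl G (lcs G q) (y [^]\<^bsub>G\<^esub> n))"
      by (rule \<mu>_mball[OF CG.mball_cl[OF CG.commH_closed(4)[OF yC]]])
    then have "\<bar>real n * \<mu> y\<bar> \<le> 12 * \<beta> * real (cl G (lcs G q) (y [^]\<^bsub>G\<^esub> n)) + 2 * \<beta> * real n"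
      using \<mu>_pow[OF yq, of n] by linarith
    also have "\<dots> = real n * (12 * \<beta> * (real (cl G (lcs G q) (y [^]\<^bsub>G\<^esub> n)) / real n) + 2 * \<beta>)"
      using n by (simp add: field_simps)
    finally have "real n * \<bar>\<mu> y\<bar> \<le> real n * (12 * \<beta> * (real (cl G (lcs G q) (y [^]\<^bsub>G\<^esub> n)) / real n) + 2 * \<beta>)"
      by (simp only: abs_mult abs_of_nat)
    then show "\<bar>\<mu> y\<bar> \<le> 12 * \<beta> * (real (cl G (lcs G q) (y [^]\<^bsub>G\<^esub> n)) / real n) + 2 * \<beta>"
      using n by (subst (asm) mult_le_cancel_left_pos) auto
  qed
qed

text \<open>\<open>h\<close> sees only the class of \<open>w m\<close>, which is that of
  \<open>r [^] m\<close>, and yields exactly \<open>m\<close>. \<open>\<phi>\<close> is bounded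
  because \<open>w m\<close> is a product of \<open>length fs\<close> commutators for every
  \<open>m\<close>.\<close>

lemma \<mu>_\<Psi>: "\<bar>\<mu> (\<Psi> m) - of_int m\<bar> \<le> 12 * \<beta> * real (length fs)"
proof -
  obtain n where n: "approx F (lcs F q) n (w m) (r [^]\<^bsub>F\<^esub> m)" using w_approx by blast
  have "h (w m) = of_int m * h r" using h_cong[OF n w_lcs] h_int_pow[OF r] by simp
  then have "\<mu> (\<Psi> m) - of_int m = - (\<phi> (w m) * (1 / \<phi> r))"
    using \<mu>_\<pi>[OF w_lcs] h_r by (simp add: \<Psi>_def \<nu>_def)
  moreover have "\<bar>\<phi> (w m)\<bar> \<le> 12 * real (length fs)"
    by (rule \<phi>_mball) (simp only: w_def F.comm_word_mball[OF len fs fs'_carrier])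
  then have "\<bar>\<phi> (w m)\<bar> * \<beta> \<le> 12 * real (length fs) * \<beta>" using \<beta>_pos by (intro mult_right_mono) auto
  ultimately show ?thesis by (simp only: abs_minus_cancel abs_mult \<beta>_def mult_ac)
qed

lemma lcs_Suc_q: "x \<in> lcs G (Suc q) \<Longrightarrow> x \<in> lcs G q"
  using G.lcs_Suc_subset by blast

lemma \<mu>_diff:
  assumes "a \<in> lcs G (Suc q)" "b \<in> lcs G (Suc q)"
  shows "\<bar>\<mu> a - \<mu> b\<bar> \<le> 12 * \<beta> * dscl G (lcs G q) a b + 4 * \<beta>"
proof -
  let ?z = "inv\<^bsub>G\<^esub> a \<otimes>\<^bsub>G\<^esub> b"
  have c: "a \<in> carrier G" "b \<in> carrier G" using assms by (auto intro: G.lcs_carrier)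
  have z: "?z \<in> lcs G (Suc q)" by (intro G.lcs_closed assms)
  have "a \<otimes>\<^bsub>G\<^esub> ?z = b" using c by (simp add: G.inv_cancel_left)
  then show ?thesis
    using \<mu>_quasi[OF lcs_Suc_q[OF assms(1)] lcs_Suc_q[OF z]] \<mu>_le_scl[OF z] by (simp add: dscl_def)
qed

definition \<Phi> :: "'a set \<Rightarrow> int" where "\<Phi> y = round (\<mu> y)"

lemma \<Phi>_\<mu>: "\<bar>real_of_int (\<Phi> y) - \<mu> y\<bar> \<le> 1 / 2"
  unfolding \<Phi>_def using of_int_round_abs_le .

lemma abs_le_ceiling: "\<bar>real_of_int x\<bar> \<le> C \<Longrightarrow> \<bar>x\<bar> \<le> \<lceil>C\<rceil>"
  by linarith

lemma coarse_iso: "coarse_iso_from_Z (\<lambda>x y. x \<otimes>\<^bsub>G\<^esub> y) (lcs G (Suc q)) (dscl G (lcs G q)) (range \<Psi>) \<Psi>"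
proof -
  obtain C where C: "\<And>m n. dscl G (lcs G q) (\<Psi> m) (\<Psi> n) \<le> real C * real_of_int \<bar>m - n\<bar> + real K"
    using dscl_\<Psi>_upper by blast
  have upper: "dscl G (lcs G q) (\<Psi> m) (\<Psi> n) \<le> real C * real_of_int R + real K" if "\<bar>m - n\<bar> \<le> R" for m n R
  proof -
    have "real C * real_of_int \<bar>m - n\<bar> \<le> real C * real_of_int R" using that by (intro mult_left_mono) auto
    then show ?thesis using C[of m n] by linarith
  qed
  have \<Phi>\<Psi>: "\<bar>\<Phi> (\<Psi> m) - m\<bar> \<le> \<lceil>12 * \<beta> * real (length fs) + 1\<rceil>" for m
    by (rule abs_le_ceiling, unfold of_int_diff) (use \<Phi>_\<mu>[of "\<Psi> m"] \<mu>_\<Psi>[of m] in linarith)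
  show ?thesis
    unfolding coarse_iso_from_Z_def
  proof (intro conjI exI[of _ \<Phi>])
    show "\<forall>R. \<exists>S. \<forall>m n. \<bar>m - n\<bar> \<le> R \<longrightarrow> dscl G (lcs G q) (\<Psi> m) (\<Psi> n) \<le> S" using upper by blast
    have "dscl G (lcs G q) (\<Psi> (m + n)) (\<Psi> m \<otimes>\<^bsub>G\<^esub> \<Psi> n) \<le> real K" for m n
      unfolding dscl_def by (rule CG.scl_le_mball) (use \<Psi>_add[of m n] in \<open>simp add: approx_def\<close>)
    then show "\<exists>C. \<forall>m n. dscl G (lcs G q) (\<Psi> (m + n)) (\<Psi> m \<otimes>\<^bsub>G\<^esub> \<Psi> n) \<le> C" by blast
    have "\<bar>\<Phi> (x \<otimes>\<^bsub>G\<^esub> y) - \<Phi> x - \<Phi> y\<bar> \<le> \<lceil>2 * \<beta> + 2\<rceil>" if "x \<in> lcs G (Suc q)" "y \<in> lcs G (Suc q)" for x y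
      by (rule abs_le_ceiling, unfold of_int_diff)
         (use \<mu>_quasi[OF lcs_Suc_q[OF that(1)] lcs_Suc_q[OF that(2)]] \<Phi>_\<mu>[of x] \<Phi>_\<mu>[of y] \<Phi>_\<mu>[of "x \<otimes>\<^bsub>G\<^esub> y"] in linarith)
    then show "\<exists>C. \<forall>x\<in>lcs G (Suc q). \<forall>y\<in>lcs G (Suc q). \<bar>\<Phi> (x \<otimes>\<^bsub>G\<^esub> y) - \<Phi> x - \<Phi> y\<bar> \<le> C" by blast
    have "real_of_int \<bar>\<Phi> a - \<Phi> b\<bar> \<le> 12 * \<beta> * R + 4 * \<beta> + 1"
      if "a \<in> lcs G (Suc q)" "b \<in> lcs G (Suc q)" "dscl G (lcs G q) a b \<le> R" for a b R
    proof -
      have "12 * \<beta> * dscl G (lcs G q) a b \<le> 12 * \<beta> * R" using that(3) \<beta>_pos by (intro mult_left_mono) auto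
      then show ?thesis using \<mu>_diff[OF that(1,2)] \<Phi>_\<mu>[of a] \<Phi>_\<mu>[of b]
        unfolding of_int_abs of_int_diff by linarith
    qed
    then show "\<forall>R. \<exists>S. \<forall>a\<in>range \<Psi>. \<forall>b\<in>range \<Psi>. dscl G (lcs G q) a b \<le> R \<longrightarrow> real_of_int \<bar>\<Phi> a - \<Phi> b\<bar> \<le> S"
      using \<Psi>_lcs by blast
    show "\<exists>C. \<forall>m. \<bar>\<Phi> (\<Psi> m) - m\<bar> \<le> C" using \<Phi>\<Psi> by blast
    show "\<exists>C. \<forall>a\<in>range \<Psi>. dscl G (lcs G q) (\<Psi> (\<Phi> a)) a \<le> C" using upper[OF \<Phi>\<Psi>] by blast
  qed auto
qed

lemma quasi_isometric: "quasi_isometric_bounds_Z (dscl G (lcs G q)) \<Psi>"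
proof -
  obtain C where C: "\<And>m n. dscl G (lcs G q) (\<Psi> m) (\<Psi> n) \<le> real C * real_of_int \<bar>m - n\<bar> + real K"
    using dscl_\<Psi>_upper by blast
  \<comment> \<open>At each end \<open>\<mu>\<close> differs from the integer by at most
    \<open>12 * \<beta> * length fs\<close>, and \<open>\<mu>_diff\<close> adds
    \<open>4 * \<beta>\<close>; dividing by \<open>12 * \<beta>\<close> gives the bound for the
    distance.\<close>
  define D where "D = (24 * \<beta> * real (length fs) + 4 * \<beta>) / (12 * \<beta>)"
  have "1 / (12 * \<beta>) * real_of_int \<bar>m - n\<bar> - D \<le> dscl G (lcs G q) (\<Psi> m) (\<Psi> n)" for m n
  proof -
    have "real_of_int \<bar>m - n\<bar> \<le> 12 * \<beta> * dscl G (lcs G q) (\<Psi> m) (\<Psi> n) + (24 * \<beta> * real (length fs) + 4 * \<beta>)"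
      using \<mu>_diff[OF \<Psi>_lcs \<Psi>_lcs, of m n] \<mu>_\<Psi>[of m] \<mu>_\<Psi>[of n]
      unfolding of_int_abs of_int_diff by linarith
    then have "real_of_int \<bar>m - n\<bar> / (12 * \<beta>) \<le>
        (12 * \<beta> * dscl G (lcs G q) (\<Psi> m) (\<Psi> n) + (24 * \<beta> * real (length fs) + 4 * \<beta>)) / (12 * \<beta>)"
      using \<beta>_pos by (intro divide_right_mono) auto
    also have "\<dots> = dscl G (lcs G q) (\<Psi> m) (\<Psi> n) + D" unfolding D_def add_divide_distrib using \<beta>_pos by simp
    finally show ?thesis by simp
  qed
  then show ?thesis unfolding quasi_isometric_bounds_Z_def
    using C \<beta>_pos by (intro exI[of _ "1 / (12 * \<beta>)"] exI[of _ "real C"] exI[of _ D] exI[of _ "real K"]) auto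
qed

text \<open>A bound on \<open>scl\<close> controls the commutator length of high powers only. So
  \<open>y [^] n\<close> is approximated by some \<open>\<Psi> k\<close>, and \<open>\<mu>\<close>
  compares \<open>k\<close> with \<open>n * \<Phi> y\<close>. All errors are linear in
  \<open>n\<close> with factors independent of \<open>y\<close>, and homogeneity of
  \<open>scl\<close> divides them by \<open>n\<close>.\<close>

lemma coarse_kernel_bound:
  assumes "C \<ge> 0"
  shows "\<exists>D. \<forall>y\<in>lcs G (Suc q). scl G (carrier G) y \<le> C \<longrightarrow>
    scl G (lcs G q) (inv\<^bsub>G\<^esub> (\<Psi> (\<Phi> y)) \<otimes>\<^bsub>G\<^esub> y) \<le> D"
proof -
  obtain c where c: "\<And>m. \<Psi> m \<in> mball G (lcs G q) (nat \<bar>m\<bar> * c)" using \<Psi>_linear by blast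
  define s where "s = real (length fs)"
  \<comment> \<open>The bound of \<open>approximate_by_\<Psi>\<close> for length
    \<open>j \<le> (C + 1) * n\<close>, per unit of \<open>n\<close>.\<close>
  define A where "A = 4 ^ q * (s + C + 1)"
  \<comment> \<open>Distance from \<open>k\<close> to \<open>n * \<Phi> y\<close> per unit of
    \<open>n\<close>: 1 for rounding, \<open>2 * \<beta>\<close> from \<open>\<mu>_pow\<close>,
    \<open>12 * \<beta> * s\<close> from \<open>\<mu>_\<Psi>\<close>, the rest from
    \<open>\<mu>_diff\<close>.\<close>
  define E where "E = 1 + 2 * \<beta> + 12 * \<beta> * s + 4 * \<beta> + 12 * \<beta> * A"
  have s: "s \<ge> 0" by (simp add: s_def)
  \<comment> \<open>One \<open>K\<close> is for multiplying the exponent by \<open>n\<close> and one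
    for the difference of exponents; \<open>c * E\<close> is the length of \<open>\<Psi>\<close> at
    that difference, \<open>A\<close> comes from \<open>\<zeta>\<close>, and 3 covers the remaining
    \<open>n + 1\<close>.\<close>
  have "scl G (lcs G q) (inv\<^bsub>G\<^esub> (\<Psi> (\<Phi> y)) \<otimes>\<^bsub>G\<^esub> y) \<le> 2 * real K + real c * E + A + 3"
    if y: "y \<in> lcs G (Suc q)" and le: "scl G (carrier G) y \<le> C" for y
  proof -
    have yq: "y \<in> lcs G q" by (rule lcs_Suc_q[OF y])
    have yc: "y \<in> carrier G" using y by (rule G.lcs_carrier)
    have yA: "y \<in> AG.commH" by (rule lcs_AG[OF y])
    have "\<forall>\<^sub>F n in sequentially. real (cl G (carrier G) (y [^]\<^bsub>G\<^esub> n)) / real n < C + 1"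
      by (rule order_tendstoD(2)[OF AG.scl_LIMSEQ[OF yA]]) (use le in simp)
    then obtain M where "\<And>n. n \<ge> M \<Longrightarrow> real (cl G (carrier G) (y [^]\<^bsub>G\<^esub> n)) / real n < C + 1"
      by (auto simp: eventually_sequentially)
    then obtain n where n: "n \<ge> 1" "real (cl G (carrier G) (y [^]\<^bsub>G\<^esub> n)) / real n < C + 1"
      by (meson max.cobounded1 max.cobounded2)
    define j where "j = cl G (carrier G) (y [^]\<^bsub>G\<^esub> n)"
    have j: "real j \<le> (C + 1) * real n" using n by (simp add: j_def pos_divide_less_eq)
    have yn: "y [^]\<^bsub>G\<^esub> n \<in> lcs G (Suc q)" by (rule G.lcs_pow[OF y])
    have "y [^]\<^bsub>G\<^esub> n \<in> mball G (carrier G) j" unfolding j_def by (rule AG.mball_cl[OF AG.commH_closed(4)[OF yA]])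
    then obtain k where k: "scl G (lcs G q) (inv\<^bsub>G\<^esub> (\<Psi> k) \<otimes>\<^bsub>G\<^esub> y [^]\<^bsub>G\<^esub> n) \<le> 4 ^ q * real (length fs + j)"
      using approximate_by_\<Psi>[OF yn] by blast
    define \<zeta> where "\<zeta> = inv\<^bsub>G\<^esub> (\<Psi> k) \<otimes>\<^bsub>G\<^esub> y [^]\<^bsub>G\<^esub> n"
    have \<zeta>: "\<zeta> \<in> lcs G (Suc q)" unfolding \<zeta>_def by (intro G.lcs_closed \<Psi>_lcs yn)
    have rn: "real n \<ge> 1" using n(1) by simp
    have "4 ^ q * real (length fs + j) \<le> 4 ^ q * ((s + C + 1) * real n)"
    proof (rule mult_left_mono)
      have "s * 1 \<le> s * real n" using rn s by (intro mult_left_mono) auto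
      then show "real (length fs + j) \<le> (s + C + 1) * real n" using j by (simp add: s_def algebra_simps)
    qed simp
    then have scl\<zeta>: "scl G (lcs G q) \<zeta> \<le> A * real n"
      unfolding \<zeta>_def A_def mult.assoc by (rule order_trans[OF k])
    define m where "m = \<Phi> y"
    have close: "real_of_int \<bar>k - int n * m\<bar> \<le> E * real n"
    proof -
      have tri: "\<bar>k - x\<bar> \<le> p1 + (p2 + p5) + p3 + p4"
        if "\<bar>u - k\<bar> \<le> p1" "\<bar>u - v\<bar> \<le> p + p5" "p \<le> p2" "\<bar>v - t\<bar> \<le> p3" "\<bar>t - x\<bar> \<le> p4"
        for k x u v t p p1 p2 p3 p4 p5 :: real
        using that by linarith
      have "\<bar>\<mu> (\<Psi> k) - of_int k\<bar> \<le> 12 * \<beta> * s" using \<mu>_\<Psi>[of k] by (simp add: s_def)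
      moreover have "\<bar>\<mu> (\<Psi> k) - \<mu> (y [^]\<^bsub>G\<^esub> n)\<bar> \<le> 12 * \<beta> * scl G (lcs G q) \<zeta> + 4 * \<beta>"
        using \<mu>_diff[OF \<Psi>_lcs yn] unfolding \<zeta>_def dscl_def .
      moreover have "12 * \<beta> * scl G (lcs G q) \<zeta> \<le> 12 * \<beta> * (A * real n)"
        using scl\<zeta> \<beta>_pos by (intro mult_left_mono) auto
      moreover have "\<bar>\<mu> (y [^]\<^bsub>G\<^esub> n) - real n * \<mu> y\<bar> \<le> 2 * \<beta> * real n" by (rule \<mu>_pow[OF yq])
      moreover have "\<bar>real n * \<mu> y - real n * of_int m\<bar> \<le> real n"
      proof -
        have "\<bar>\<mu> y - of_int m\<bar> \<le> 1" using \<Phi>_\<mu>[of y] unfolding m_def by linarith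
        then have "real n * \<bar>\<mu> y - of_int m\<bar> \<le> real n * 1" by (intro mult_left_mono) auto
        then show ?thesis by (simp only: right_diff_distrib[symmetric] abs_mult abs_of_nat mult_1_right)
      qed
      ultimately have "\<bar>of_int k - real n * of_int m\<bar> \<le>
          12 * \<beta> * s + (12 * \<beta> * (A * real n) + 4 * \<beta>) + 2 * \<beta> * real n + real n" by (rule tri)
      also have "\<dots> = (12 * \<beta> * s + 4 * \<beta>) * 1 + (12 * \<beta> * (A * real n) + 2 * \<beta> * real n + real n)"
        by (simp add: algebra_simps)
      also have "(12 * \<beta> * s + 4 * \<beta>) * 1 \<le> (12 * \<beta> * s + 4 * \<beta>) * real n"
        using rn s \<beta>_pos by (intro mult_left_mono) auto
      finally show ?thesis by (simp add: E_def algebra_simps)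
    qed
    define T where "T = n * K + (K + nat \<bar>k - int n * m\<bar> * c)"
    have T1: "approx G (lcs G q) (n * K) (\<Psi> m [^]\<^bsub>G\<^esub> n) (\<Psi> (int n * m))"
      by (rule CG.approx_sym[OF \<Psi>_nat_mult])
    have T2: "approx G (lcs G q) (K + nat \<bar>k - int n * m\<bar> * c) (\<Psi> (int n * m)) (\<Psi> k)"
    proof -
      have "inv\<^bsub>G\<^esub> (\<Psi> (int n * m)) \<otimes>\<^bsub>G\<^esub> \<Psi> k \<in> mball G (lcs G q) (nat \<bar>k - int n * m\<bar> * c + K)"
        by (rule CG.approx_mball[OF CG.approx_sym[OF \<Psi>_diff] c])
      then show ?thesis using \<Psi>_carrier by (simp add: approx_def add.commute)
    qed
    have T: "approx G (lcs G q) T (\<Psi> m [^]\<^bsub>G\<^esub> n) (\<Psi> k)" unfolding T_def by (rule CG.approx_trans[OF T1 T2])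
    let ?x = "inv\<^bsub>G\<^esub> (\<Psi> m) \<otimes>\<^bsub>G\<^esub> y"
    have xL: "?x \<in> lcs G (Suc q)" by (intro G.lcs_closed \<Psi>_lcs y)
    have \<zeta>c: "\<zeta> \<in> carrier G" using \<zeta> by (rule G.lcs_carrier)
    have "approx G (lcs G q) (n + (0 + T)) (?x [^]\<^bsub>G\<^esub> n) \<zeta>"
    proof (rule CG.approx_trans)
      show "approx G (lcs G q) n (?x [^]\<^bsub>G\<^esub> n) (inv\<^bsub>G\<^esub> (\<Psi> m) [^]\<^bsub>G\<^esub> n \<otimes>\<^bsub>G\<^esub> y [^]\<^bsub>G\<^esub> n)"
        by (rule CG.approx_mult_pow[OF G.lcs_closed(3)[OF lcs_Suc_q[OF \<Psi>_lcs]] yc])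
      have "approx G (lcs G q) (T + 0) (inv\<^bsub>G\<^esub> (\<Psi> m [^]\<^bsub>G\<^esub> n) \<otimes>\<^bsub>G\<^esub> y [^]\<^bsub>G\<^esub> n) (inv\<^bsub>G\<^esub> (\<Psi> k) \<otimes>\<^bsub>G\<^esub> y [^]\<^bsub>G\<^esub> n)"
        using yc by (intro CG.approx_mult CG.approx_inv T CG.approx_refl) auto
      then show "approx G (lcs G q) (0 + T) (inv\<^bsub>G\<^esub> (\<Psi> m) [^]\<^bsub>G\<^esub> n \<otimes>\<^bsub>G\<^esub> y [^]\<^bsub>G\<^esub> n) \<zeta>"
        using \<Psi>_carrier by (simp add: G.nat_pow_inv \<zeta>_def)
    qed
    then have "scl G (lcs G q) (?x [^]\<^bsub>G\<^esub> n) \<le> scl G (lcs G q) \<zeta> + (n + (0 + T)) + 1"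
      using \<zeta> lcs_commH by (intro CG.scl_approx(2)[OF CG.approx_sym]) auto
    moreover have "scl G (lcs G q) (?x [^]\<^bsub>G\<^esub> n) = real n * scl G (lcs G q) ?x"
      using xL lcs_commH by (intro CG.scl_pow) simp
    moreover have "real T \<le> 2 * real K * real n + real c * (E * real n)"
    proof -
      have "real K * 1 \<le> real K * real n" using rn by (intro mult_left_mono) auto
      moreover have "real c * real_of_int \<bar>k - int n * m\<bar> \<le> real c * (E * real n)"
        using close by (intro mult_left_mono) auto
      ultimately show ?thesis by (simp add: T_def algebra_simps)
    qed
    ultimately have "real n * scl G (lcs G q) ?x \<le> real n * (2 * real K + real c * E + A + 3)"
      using scl\<zeta> rn by (simp add: algebra_simps)
    then show ?thesis using rn by (simp add: m_def)
  qed
  then show ?thesis by blast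
qed

text \<open>A bounded set is translated by the inverse of one of its elements \<open>b0\<close>,
  which makes \<open>coarse_kernel_bound\<close> applicable. Translating back costs the mixed length
  of the fixed \<open>b0\<close> and the defect 1 of \<open>scl_mult\<close>.\<close>

lemma coarse_kernel:
  "represents_coarse_kernel (lcs G (Suc q)) (dscl G (lcs G q)) (dscl G (carrier G)) (range \<Psi>)"
  unfolding represents_coarse_kernel_def
proof (intro conjI allI impI)
  show "\<exists>C. \<forall>a\<in>range \<Psi>. \<forall>b\<in>range \<Psi>. dscl G (carrier G) a b \<le> C" using dscl_\<Psi>_G by blast
  fix B assume B: "B \<subseteq> lcs G (Suc q)" and "\<exists>C. \<forall>a\<in>B. \<forall>b\<in>B. dscl G (carrier G) a b \<le> C"
  then obtain C where C: "\<And>a b. a \<in> B \<Longrightarrow> b \<in> B \<Longrightarrow> dscl G (carrier G) a b \<le> C" by blast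
  show "\<exists>D. \<forall>b\<in>B. \<exists>a\<in>range \<Psi>. dscl G (lcs G q) a b \<le> D"
  proof (cases "B = {}")
    case False
    then obtain b0 where b0: "b0 \<in> B" by blast
    obtain D where D: "\<And>y. y \<in> lcs G (Suc q) \<Longrightarrow> scl G (carrier G) y \<le> max C 0 \<Longrightarrow>
      scl G (lcs G q) (inv\<^bsub>G\<^esub> (\<Psi> (\<Phi> y)) \<otimes>\<^bsub>G\<^esub> y) \<le> D"
      using coarse_kernel_bound[of "max C 0"] by auto
    have b0L: "b0 \<in> lcs G (Suc q)" using b0 B by blast
    have b0c: "b0 \<in> carrier G" using b0L by (rule G.lcs_carrier)
    obtain n where n: "b0 \<in> mball G (lcs G q) n" using b0L lcs_commH CG.generate_comm_set by blast
    have "dscl G (lcs G q) (\<Psi> (\<Phi> (inv\<^bsub>G\<^esub> b0 \<otimes>\<^bsub>G\<^esub> b))) b \<le> real n + D + 1" if b: "b \<in> B" for b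
    proof -
      let ?y = "inv\<^bsub>G\<^esub> b0 \<otimes>\<^bsub>G\<^esub> b"
      have bL: "b \<in> lcs G (Suc q)" using b B by blast
      have bc: "b \<in> carrier G" using bL by (rule G.lcs_carrier)
      have y: "?y \<in> lcs G (Suc q)" by (intro G.lcs_closed b0L bL)
      have "scl G (carrier G) ?y \<le> max C 0" using C[OF b0 b] by (simp add: dscl_def)
      note scly = D[OF y this]
      let ?p = "\<Psi> (\<Phi> ?y)"
      have p: "?p \<in> carrier G" by (rule \<Psi>_carrier)
      have conj: "inv\<^bsub>G\<^esub> ?p \<otimes>\<^bsub>G\<^esub> b0 \<otimes>\<^bsub>G\<^esub> inv\<^bsub>G\<^esub> (inv\<^bsub>G\<^esub> ?p) \<in> mball G (lcs G q) n"
        using p by (intro CG.mball_conj n) auto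
      have "inv\<^bsub>G\<^esub> ?p \<otimes>\<^bsub>G\<^esub> b = (inv\<^bsub>G\<^esub> ?p \<otimes>\<^bsub>G\<^esub> b0 \<otimes>\<^bsub>G\<^esub> inv\<^bsub>G\<^esub> (inv\<^bsub>G\<^esub> ?p)) \<otimes>\<^bsub>G\<^esub> (inv\<^bsub>G\<^esub> ?p \<otimes>\<^bsub>G\<^esub> ?y)"
        using p b0c bc by (simp add: G.m_assoc G.inv_cancel_left)
      moreover have "inv\<^bsub>G\<^esub> ?p \<otimes>\<^bsub>G\<^esub> ?y \<in> CG.commH"
        using y \<Psi>_lcs lcs_commH by (metis G.lcs_closed(2,3))
      ultimately show ?thesis
        using CG.scl_mult[OF CG.mball_commH[OF conj], of "inv\<^bsub>G\<^esub> ?p \<otimes>\<^bsub>G\<^esub> ?y"] CG.scl_le_mball[OF conj] scly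
        by (simp add: dscl_def)
    qed
    then show ?thesis by blast
  qed simp
qed

end

theorem theorem11p21:
  fixes F :: "('a, 'b) monoid_scheme"
    and q :: nat
    and r rb :: 'a
    and N :: "'a set"
    and G :: "'a set monoid"
    and \<pi> :: "'a \<Rightarrow> 'a set"
    and fs fs' :: "'a list"
    and \<Psi> :: "int \<Rightarrow> 'a set"
  assumes free: "finitely_generated_free_group F"
    and q: "q \<ge> 2"
    and r: "r \<in> lcs F q - lcs F (Suc q)"
    and N_def: "N = normal_closure F {r}"
    and G_def: "G = F Mod N"
    and \<pi>_def: "\<pi> = (\<lambda>x. N #>\<^bsub>F\<^esub> x)"
    and H2: "H2_infinite_cyclic G"
    and sv: "simplicial_volume G \<noteq> 0"
    and rb: "rb \<in> lcs F q"
    and rb_coset: "rb <#\<^bsub>F\<^esub> lcs F (Suc q) = r <#\<^bsub>F\<^esub> lcs F (Suc q)"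
    and len: "length fs' = length fs"
    and fs: "set fs \<subseteq> carrier F"
    and fs': "set fs' \<subseteq> lcs F (q - 1)"
    and rb_eq: "rb = mprod F (map2 (commutator F) fs fs')"
    and \<Psi>_def: "\<Psi> = (\<lambda>m. mprod G (map2 (\<lambda>f f'. commutator G (\<pi> f) (\<pi> f' [^]\<^bsub>G\<^esub> m)) fs fs'))"
  shows "range \<Psi> \<subseteq> lcs G (Suc q)
     \<and> represents_coarse_kernel (lcs G (Suc q)) (dscl G (lcs G q)) (dscl G (carrier G)) (range \<Psi>)
     \<and> coarse_iso_from_Z (\<lambda>x y. x \<otimes>\<^bsub>G\<^esub> y) (lcs G (Suc q)) (dscl G (lcs G q)) (range \<Psi>) \<Psi>
     \<and> quasi_isometric_bounds_Z (dscl G (lcs G q)) \<Psi>"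
proof -
  obtain B where B: "finite B" "free_group_on F B" using free by (auto simp: finitely_generated_free_group_def)
  interpret R: one_relator F B q r N G \<pi> fs fs'
    by unfold_locales (use B q r N_def G_def \<pi>_def len fs fs' rb_coset rb_eq in auto)
  obtain h :: "'a \<Rightarrow> real" where h: "\<forall>x\<in>lcs F q. \<forall>y\<in>lcs F q. h (x \<otimes>\<^bsub>F\<^esub> y) = h x + h y"
    "\<forall>x\<in>lcs F (Suc q). h x = 0" "h r \<noteq> 0"
    using free_group_lcs_functional[OF B(2,1) R.q1, of r] r by blast
  have rc: "r \<in> carrier F" by (rule R.r_carrier)
  show ?thesis
  proof (rule quasimorphism_of_simplicial_volume[OF B(2) rc N_def G_def H2 sv])
    fix \<phi> :: "'a \<Rightarrow> real"
    assume \<phi>: "\<And>x y. x \<in> carrier F \<Longrightarrow> y \<in> carrier F \<Longrightarrow> \<bar>\<phi> (x \<otimes>\<^bsub>F\<^esub> y) - \<phi> x - \<phi> y\<bar> \<le> 2"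
      "\<And>x n. x \<in> carrier F \<Longrightarrow> n \<in> N \<Longrightarrow> \<phi> (x \<otimes>\<^bsub>F\<^esub> n) = \<phi> x + \<phi> n"
      "\<And>x n. x \<in> carrier F \<Longrightarrow> n \<in> N \<Longrightarrow> \<phi> (x \<otimes>\<^bsub>F\<^esub> n \<otimes>\<^bsub>F\<^esub> inv\<^bsub>F\<^esub> x) = \<phi> n"
      "\<phi> r \<noteq> 0"
    interpret Q: one_relator_quasimorphism F B q r N G \<pi> fs fs' h \<phi>
      by unfold_locales (use h \<phi> in \<open>auto simp del: lcs.simps\<close>)
    have "\<Psi> = R.\<Psi>"
    proof
      fix m :: int
      have "map2 (\<lambda>f f'. commutator G f (f' [^]\<^bsub>G\<^esub> m)) (map \<pi> fs) (map \<pi> fs') =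
          map2 (\<lambda>f f'. commutator G (\<pi> f) (\<pi> f' [^]\<^bsub>G\<^esub> m)) fs fs'"
        using len[symmetric] by (induction fs fs' rule: list_induct2) auto
      then show "\<Psi> m = R.\<Psi> m" by (simp add: \<Psi>_def R.\<Psi>_comm_word comm_word_def)
    qed
    then show ?thesis using R.\<Psi>_lcs Q.coarse_kernel Q.coarse_iso Q.quasi_isometric by auto
  qed
qed

end
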